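(* Let $W_1,W_2$ be independent one-dimensional standard Brownian motions started at $0$. For $i=1,2$ let $R_i(t)=\sup_{0\le s\le t}W_i(s)-\inf_{0\le s\le t}W_i(s)$, $t\ge 0$, and let $\Theta^{R_i}=\inf\{t\ge 0:R_i(t)>1\}$. Then $$\mathfrak{r}:=\mathbb{E}\left[\min\left\{\Theta^{R_1},\Theta^{R_2}\right\}\right]=\frac12-\frac{2}{\pi}\int_0^\infty\left(1-\frac{4}{(\cos t+\cosh t)^2}\right)\frac{1}{t^3}\,dt\approx 0.346554.$$
   Context: The symbol $\approx$ only indicates a numerical approximation of the exact expression. *)

theory Defs
  imports "HOL-Probability.Probability"
begin

text \<open>
  One-dimensional standard Brownian motion started at 0, with time index restricted to
  nonnegative reals (the values of \<open>W\<close> at negative times are irrelevant). As usual, the starting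
  value and the continuity of paths are required only almost surely.
  The second parameter of \<open>normal_density\<close> is the standard deviation.
\<close>

locale standard_brownian_motion = prob_space M for M :: "'a measure" +
  fixes W :: "real \<Rightarrow> 'a \<Rightarrow> real"
  assumes measurable_at: "0 \<le> t \<Longrightarrow> random_variable borel (W t)"
    and starts_at_0: "AE \<omega> in M. W 0 \<omega> = 0"
    and independent_increments:
      "\<And>(t :: nat \<Rightarrow> real) n. 0 \<le> t 0 \<Longrightarrow> (\<And>i. i < n \<Longrightarrow> t i < t (Suc i)) \<Longrightarrow>
         indep_vars (\<lambda>_. borel) (\<lambda>i \<omega>. W (t (Suc i)) \<omega> - W (t i) \<omega>) {..<n}"
    and normal_increments:
      "0 \<le> s \<Longrightarrow> s < t \<Longrightarrow>
         distributed M lborel (\<lambda>\<omega>. W t \<omega> - W s \<omega>) (normal_density 0 (sqrt (t - s)))"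
    and continuous_paths: "AE \<omega> in M. continuous_on {0..} (\<lambda>t. W t \<omega>)"

text \<open>
  Independence of two processes: independence of the path-valued random variables with respect
  to the product sigma-algebra, i.e. of the sigma-algebras generated by the two families.
\<close>

definition independent_processes ::
    "'a measure \<Rightarrow> (real \<Rightarrow> 'a \<Rightarrow> real) \<Rightarrow> (real \<Rightarrow> 'a \<Rightarrow> real) \<Rightarrow> bool" where
  "independent_processes M X Y \<longleftrightarrow>
     prob_space.indep_var M
       (\<Pi>\<^sub>M t\<in>{0..}. borel) (\<lambda>\<omega>. \<lambda>t\<in>{0..}. X t \<omega>)
       (\<Pi>\<^sub>M t\<in>{0..}. borel) (\<lambda>\<omega>. \<lambda>t\<in>{0..}. Y t \<omega>)"

definition range_process :: "(real \<Rightarrow> 'a \<Rightarrow> real) \<Rightarrow> real \<Rightarrow> 'a \<Rightarrow> real" where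
  "range_process W t \<omega> = (SUP s\<in>{0..t}. W s \<omega>) - (INF s\<in>{0..t}. W s \<omega>)"

text \<open>The infimum is taken in the extended nonnegative reals, so it is \<open>\<infinity>\<close> if the process
  never exceeds level 1.\<close>

definition exceedance_time :: "(real \<Rightarrow> 'a \<Rightarrow> real) \<Rightarrow> 'a \<Rightarrow> ennreal" where
  "exceedance_time R \<omega> = (INF t\<in>{t. 0 \<le> t \<and> 1 < R t \<omega>}. ennreal t)"

end

theory Submission
  imports Defs "HOL-Real_Asymp.Real_Asymp"
begin

text \<open>
  Let \<open>D\<close> and \<open>U\<close> be the distances of a Brownian path below its running maximum and above its
  running minimum, so that the range is \<open>D + U\<close>. Each of \<open>exp (- \<theta>\<^sup>2 t / 2) cosh (\<theta> D)\<close> and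
  \<open>exp (- \<theta>\<^sup>2 t / 2) cosh (\<theta> U)\<close> is a martingale for complex \<open>\<theta>\<close>, and at the exceedance time \<open>\<Theta>\<close>
  one of \<open>D\<close>, \<open>U\<close> vanishes while the other is 1. Optional stopping gives
  \<open>E exp (- \<theta>\<^sup>2 \<Theta> / 2) = 2 / (1 + cosh \<theta>)\<close>. The martingale property is replaced by an exact
  Gaussian identity for the walk sampled on a grid, up to an error bounded by the sum of the squared
  increments of the running maximum, which vanishes in the limit because that maximum is continuous
  and monotone.

  With \<open>\<theta> = (1 + \<i>) t\<close> this is the characteristic function of \<open>\<Theta>\<close>, of squared modulus
  \<open>4 / (cos t + cosh t)\<^sup>2\<close> at \<open>t\<^sup>2\<close>. Integrating \<open>1 - cos (t\<^sup>2 X)\<close> against \<open>t\<^sup>-\<^sup>3\<close> for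
  \<open>X = \<Theta>\<^sub>1 - \<Theta>\<^sub>2\<close> yields \<open>E \<bar>X\<bar>\<close>, and \<open>min x y = (x + y - \<bar>x - y\<bar>) / 2\<close> with \<open>E \<Theta> = 1 / 2\<close> gives
  the integral formula.

  For the numerical value, one of the two characteristic functions is expanded into partial
  fractions. The same computation then turns the integral into the rapidly convergent series
  \<open>\<Sum>\<^sub>a (3 / a\<^sup>4 + 2 tanh a / a\<^sup>3) / cosh\<^sup>2 a\<close> over \<open>a = \<pi> (k + 1/2)\<close>.
\<close>

section \<open>Range of a discrete walk\<close>

text \<open>Why cosh: its derivative vanishes at 0. The drawdown moves like the negated path except
  where it is reflected at 0, and there cosh changes only to second order; this is why squared
  increments of the running maximum control the error, apart from rare large steps. At the exit it
  is unknown which of D, U is 0 and which is 1, but the sum of the two martingales carries the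
  deterministic factor 1 + cosh \<theta>. The condition 0 \<le> Re (\<theta>^2) keeps the
  exponential factor bounded; the characteristic function sits on its boundary. In the numerical
  part, 2 / (1 + cosh \<theta>) = 1 / cosh^2 (\<theta> / 2) has double poles where \<theta>^2 / 2 =
  -l with l = 2 a^2, and each contributes the signed density 4 (2 l s - 1) exp (- l s). Integrating
  |s - \<Theta>| against it leaves only E \<Theta>, E exp (- l \<Theta>) and E \<Theta> exp (- l
  \<Theta>), which the transform of the unexpanded factor gives in closed form; the last two decay
  like 1 / cosh^2 a. The remaining rational terms cancel in the sum, since 2 / a^2 and 6 / a^4 both
  sum to 1.\<close>

text \<open>\<open>\<xi>\<close> lists the increments of a walk. Its drawdown is the running maximum minus the current
  value; applied to \<open>- \<xi>\<close> it gives the height above the running minimum.\<close>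

fun drawdown :: "(nat \<Rightarrow> real) \<Rightarrow> nat \<Rightarrow> real" where
  "drawdown \<xi> 0 = 0"
| "drawdown \<xi> (Suc k) = max (drawdown \<xi> k - \<xi> k) 0"

definition walk_range :: "(nat \<Rightarrow> real) \<Rightarrow> nat \<Rightarrow> real" where
  "walk_range \<xi> k = drawdown \<xi> k + drawdown (\<lambda>i. - \<xi> i) k"

text \<open>The horizon \<open>n\<close> makes this a bounded stopping time, so the stopped sums are
  finite and \<open>LEAST\<close> always has a witness.\<close>

definition walk_exit :: "nat \<Rightarrow> (nat \<Rightarrow> real) \<Rightarrow> nat" where
  "walk_exit n \<xi> = (LEAST k. n \<le> k \<or> 1 < walk_range \<xi> k)"

lemma drawdown_nonneg [simp]: "0 \<le> drawdown \<xi> k"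
  by (cases k) auto

lemma drawdown_cong: "(\<And>i. i < k \<Longrightarrow> \<xi> i = \<eta> i) \<Longrightarrow> drawdown \<xi> k = drawdown \<eta> k"
  by (induction k) auto

lemma walk_range_cong: "(\<And>i. i < k \<Longrightarrow> \<xi> i = \<eta> i) \<Longrightarrow> walk_range \<xi> k = walk_range \<eta> k"
  unfolding walk_range_def
  using drawdown_cong[of k \<xi> \<eta>] drawdown_cong[of k "\<lambda>i. - \<xi> i" "\<lambda>i. - \<eta> i"] by simp

lemma walk_range_minus: "walk_range (\<lambda>i. - \<xi> i) = walk_range \<xi>"
  by (auto simp: walk_range_def fun_eq_iff)

lemma walk_exit_minus: "walk_exit n (\<lambda>i. - \<xi> i) = walk_exit n \<xi>"
  by (simp add: walk_exit_def walk_range_minus)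

text \<open>The recursion keeps the old maximiser \<open>j\<close> as long as the drawdown stays
  nonnegative; otherwise the new endpoint is the maximiser and the drawdown restarts at 0. The two
  conjuncts together characterise a maximum.\<close>

lemma drawdown_bounds:
  assumes "\<And>i. i < k \<Longrightarrow> \<xi> i = X (Suc i) - X i"
  shows "(\<forall>j\<le>k. X j - X k \<le> drawdown \<xi> k) \<and> (\<exists>j\<le>k. X j - X k = drawdown \<xi> k)"
  using assms
proof (induction k)
  case 0
  then show ?case by auto
next
  case (Suc k)
  then have IH: "\<And>j. j \<le> k \<Longrightarrow> X j - X k \<le> drawdown \<xi> k"
    and "\<exists>j\<le>k. X j - X k = drawdown \<xi> k" by auto
  then obtain j where j: "j \<le> k" "X j - X k = drawdown \<xi> k" by blast
  have x: "\<xi> k = X (Suc k) - X k" using Suc.prems by simp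
  have "X i - X (Suc k) \<le> drawdown \<xi> (Suc k)" if "i \<le> Suc k" for i
    using IH[of i] that x by (cases "i = Suc k") auto
  moreover have "\<exists>i\<le>Suc k. X i - X (Suc k) = drawdown \<xi> (Suc k)"
  proof (cases "drawdown \<xi> k - \<xi> k \<ge> 0")
    case True
    with j x show ?thesis by (intro exI[of _ j]) auto
  next
    case False
    then show ?thesis by (intro exI[of _ "Suc k"]) auto
  qed
  ultimately show ?case by blast
qed

text \<open>Phrased through pairs of times, as in \<open>rational_exit\<close>, so that a walk
  sampled from a path can be compared with the path itself.\<close>

lemma walk_range_gt_iff:
  assumes "\<And>i. i < k \<Longrightarrow> \<xi> i = X (Suc i) - X i"
  shows "c < walk_range \<xi> k \<longleftrightarrow> (\<exists>i\<le>k. \<exists>j\<le>k. c < X i - X j)"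
proof -
  have D: "(\<forall>j\<le>k. X j - X k \<le> drawdown \<xi> k) \<and> (\<exists>j\<le>k. X j - X k = drawdown \<xi> k)"
    by (rule drawdown_bounds) (rule assms)
  have U: "(\<forall>j\<le>k. - X j - - X k \<le> drawdown (\<lambda>i. - \<xi> i) k) \<and>
           (\<exists>j\<le>k. - X j - - X k = drawdown (\<lambda>i. - \<xi> i) k)"
    by (rule drawdown_bounds) (use assms in simp)
  show ?thesis
  proof
    assume "c < walk_range \<xi> k"
    with D U show "\<exists>i\<le>k. \<exists>j\<le>k. c < X i - X j"
      unfolding walk_range_def by (smt (verit))
  next
    assume "\<exists>i\<le>k. \<exists>j\<le>k. c < X i - X j"
    with D U show "c < walk_range \<xi> k"
      unfolding walk_range_def by (smt (verit))
  qed
qed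

text \<open>The added maximum is the growth of the running maximum; the growth of the range on the
  other side is dropped.\<close>

lemma walk_range_Suc_ge:
  "walk_range \<xi> k + max (\<xi> k - drawdown \<xi> k) 0 \<le> walk_range \<xi> (Suc k)"
  unfolding walk_range_def using drawdown_nonneg[of \<xi> k] drawdown_nonneg[of "\<lambda>i. - \<xi> i" k] by auto

lemma walk_range_Suc_le: "walk_range \<xi> (Suc k) \<le> walk_range \<xi> k + \<bar>\<xi> k\<bar>"
  unfolding walk_range_def using drawdown_nonneg[of \<xi> k] drawdown_nonneg[of "\<lambda>i. - \<xi> i" k]
  unfolding drawdown.simps by linarith

text \<open>If neither component is reflected, they change by \<open>- \<xi> k\<close> and
  \<open>+ \<xi> k\<close>, which cancel. Growth thus means a new maximum or a new minimum; this
  identifies the state at the exit.\<close>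

lemma walk_range_increase:
  assumes "walk_range \<xi> k < walk_range \<xi> (Suc k)"
  shows "drawdown \<xi> (Suc k) = 0 \<or> drawdown (\<lambda>i. - \<xi> i) (Suc k) = 0"
  using assms unfolding walk_range_def by (auto simp: max_def split: if_splits)

lemma walk_range_mono: "j \<le> k \<Longrightarrow> walk_range \<xi> j \<le> walk_range \<xi> k"
proof (induction rule: inc_induct)
  case (step n)
  then show ?case using walk_range_Suc_ge[of \<xi> n] by linarith
qed simp

lemma walk_exit_le: "walk_exit n \<xi> \<le> n"
  unfolding walk_exit_def by (rule Least_le) simp

text \<open>Monotonicity of the range makes "not yet stopped" visible from step \<open>k\<close>
  alone. This is the adaptedness that later turns sums up to the exit into sums of fixed length with
  indicators.\<close>

lemma less_walk_exit_iff: "k < walk_exit n \<xi> \<longleftrightarrow> k < n \<and> walk_range \<xi> k \<le> 1"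
proof
  assume "k < walk_exit n \<xi>"
  then show "k < n \<and> walk_range \<xi> k \<le> 1"
    unfolding walk_exit_def using not_less_Least by force
next
  assume *: "k < n \<and> walk_range \<xi> k \<le> 1"
  have "n \<le> walk_exit n \<xi> \<or> 1 < walk_range \<xi> (walk_exit n \<xi>)"
    unfolding walk_exit_def by (rule LeastI[of _ n]) simp
  with * walk_range_mono[of "walk_exit n \<xi>" k \<xi>] show "k < walk_exit n \<xi>"
    by (cases "walk_exit n \<xi> \<le> k") auto
qed

lemma walk_range_exit: "walk_exit n \<xi> < n \<Longrightarrow> 1 < walk_range \<xi> (walk_exit n \<xi>)"
  using less_walk_exit_iff[of "walk_exit n \<xi>" n \<xi>] by auto

text \<open>The increment of the running maximum, truncated at 1 so that the last step, which may be
  large, keeps the sum up to the exit bounded.\<close>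

definition max_increment :: "(nat \<Rightarrow> real) \<Rightarrow> nat \<Rightarrow> real" where
  "max_increment \<xi> k = min (max (\<xi> k - drawdown \<xi> k) 0) 1"

lemma max_increment_bounds: "0 \<le> max_increment \<xi> k" "max_increment \<xi> k \<le> 1" "max_increment \<xi> k \<le> \<bar>\<xi> k\<bar>"
  using drawdown_nonneg[of \<xi> k] unfolding max_increment_def by linarith+

text \<open>All steps but the last contribute at most the range before the exit, which is at most 1;
  the truncation bounds the last step by 1 as well.\<close>

lemma sum_max_increment_le: "(\<Sum>k<walk_exit n \<xi>. max_increment \<xi> k) \<le> 2"
proof (cases "walk_exit n \<xi>")
  case (Suc m)
  have "(\<Sum>k<j. max_increment \<xi> k) \<le> walk_range \<xi> j" for j
  proof (induction j)
    case (Suc j)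
    then show ?case using walk_range_Suc_ge[of \<xi> j] by (simp add: max_increment_def)
  qed (simp add: walk_range_def)
  from this[of m] have "(\<Sum>k<m. max_increment \<xi> k) \<le> 1"
    using less_walk_exit_iff[of m n \<xi>] Suc by auto
  with Suc max_increment_bounds(2)[of \<xi> m] show ?thesis by simp
qed simp

text \<open>Sum of squares \<le> largest term times sum. The maximum with 0 covers a negative
  \<open>\<epsilon>\<close>, which the hypothesis allows when the exit is immediate.\<close>

lemma sum_max_increment_squares_le:
  assumes "\<And>k. k < walk_exit n \<xi> \<Longrightarrow> \<bar>\<xi> k\<bar> \<le> \<epsilon>"
  shows "(\<Sum>k<walk_exit n \<xi>. (max_increment \<xi> k)\<^sup>2) \<le> 2 * max \<epsilon> 0"
proof -
  have "(\<Sum>k<walk_exit n \<xi>. (max_increment \<xi> k)\<^sup>2) \<le> (\<Sum>k<walk_exit n \<xi>. max_increment \<xi> k * max \<epsilon> 0)"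
    unfolding power2_eq_square
  proof (intro sum_mono mult_left_mono)
    fix k assume "k \<in> {..<walk_exit n \<xi>}"
    then show "max_increment \<xi> k \<le> max \<epsilon> 0"
      using assms[of k] max_increment_bounds(3)[of \<xi> k] by auto
  qed (rule max_increment_bounds)
  also have "\<dots> = (\<Sum>k<walk_exit n \<xi>. max_increment \<xi> k) * max \<epsilon> 0"
    by (simp add: sum_distrib_right)
  also have "\<dots> \<le> 2 * max \<epsilon> 0"
    by (intro mult_right_mono sum_max_increment_le) simp
  finally show ?thesis .
qed

text \<open>Before the exit the argument is at most 1. The cap 2 only serves to bound the stopped
  functional in spite of the Gaussian overshoot.\<close>

definition capped_cosh :: "complex \<Rightarrow> real \<Rightarrow> complex" where
  "capped_cosh \<theta> x = cosh (\<theta> * of_real (min x 2))"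

section \<open>Bounds for cosh and the error of one reflected step\<close>

lemma norm_cosh_le: "norm (cosh (z :: complex)) \<le> exp (norm z)"
proof -
  have "norm (cosh z) \<le> (norm (exp z) + norm (exp (- z))) / 2"
    unfolding cosh_def using norm_triangle_ineq[of "exp z" "exp (- z)"] by simp
  also have "\<dots> \<le> exp (norm z)"
    using norm_exp[of z] norm_exp[of "- z"] by (simp del: norm_exp_eq_Re)
  finally show ?thesis .
qed

text \<open>The linear Taylor terms of exp z and exp (- z) cancel, which makes the reflection error
  quadratic.\<close>

lemma norm_cosh_minus_1_le: "norm (cosh (z :: complex) - 1) \<le> (norm z)\<^sup>2 * exp (norm z)"
proof -
  have T: "norm (exp z - (1 + z)) \<le> exp (norm z) * (norm z)\<^sup>2" for z :: complex
    using Taylor_exp_field[of z 1] by (simp add: power2_eq_square)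
  have "cosh z - 1 = ((exp z - (1 + z)) + (exp (- z) - (1 + - z))) / 2"
    by (simp add: cosh_def field_simps scaleR_conv_of_real)
  then have "norm (cosh z - 1) \<le> (norm (exp z - (1 + z)) + norm (exp (- z) - (1 + - z))) / 2"
    by (metis divide_right_mono norm_divide norm_numeral norm_triangle_ineq zero_le_numeral)
  also have "\<dots> \<le> (norm z)\<^sup>2 * exp (norm z)"
    using T[of z] T[of "- z"] by (simp add: mult.commute)
  finally show ?thesis .
qed

lemma norm_capped_cosh_le: "0 \<le> x \<Longrightarrow> norm (capped_cosh \<theta> x) \<le> exp (2 * norm \<theta>)"
  unfolding capped_cosh_def
  by (rule order_trans[OF norm_cosh_le])
    (auto simp: norm_mult mult.commute[of 2] intro!: mult_left_mono)

lemma continuous_capped_cosh: "continuous_on UNIV (capped_cosh \<theta>)"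
  unfolding capped_cosh_def cosh_def by (intro continuous_intros)

text \<open>The first error term comes from the reflection at 0, the second one from jumps larger than 1.\<close>

lemma capped_cosh_reflected_step:
  fixes d x :: real and \<theta> :: complex
  assumes d: "0 \<le> d" "d \<le> 1"
  defines "a \<equiv> norm \<theta>"
  shows "norm (capped_cosh \<theta> (max (d - x) 0) - cosh (\<theta> * of_real (d - x)))
    \<le> a\<^sup>2 * exp a * (min (max (x - d) 0) 1)\<^sup>2 + 2 * exp (2 * a) * (x ^ 4 * exp (a * \<bar>x\<bar>))"
proof -
  have a: "0 \<le> a" by (simp add: a_def)
  let ?R = "a\<^sup>2 * exp a * (min (max (x - d) 0) 1)\<^sup>2 + 2 * exp (2 * a) * (x ^ 4 * exp (a * \<bar>x\<bar>))"
  \<comment> \<open>The fourth power is chosen because its Gaussian moment is of order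
    \<open>\<delta>\<^sup>2\<close>, which remains negligible after summation over all
    steps.\<close>
  have x4: "1 \<le> x ^ 4 * exp (a * \<bar>x\<bar>)" "exp (a * \<bar>x\<bar>) \<le> x ^ 4 * exp (a * \<bar>x\<bar>)" if "\<bar>x\<bar> > 1"
  proof -
    have "1 \<le> \<bar>x\<bar> ^ 4" by (rule one_le_power) (use that in simp)
    then have "1 \<le> x ^ 4" by simp
    then show "exp (a * \<bar>x\<bar>) \<le> x ^ 4 * exp (a * \<bar>x\<bar>)" by simp
    moreover have "1 \<le> exp (a * \<bar>x\<bar>)" using a by simp
    ultimately show "1 \<le> x ^ 4 * exp (a * \<bar>x\<bar>)" by linarith
  qed
  have e2: "1 \<le> exp (2 * a)" "exp a \<le> exp (2 * a)" using a by auto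
  \<comment> \<open>No reflection and no cap; a small reflection; an upward jump beyond 1; a capped
    downward jump. As \<open>d\<close> lies between 0 and 1, the last two force
    \<open>\<bar>x\<bar> > 1\<close>.\<close>
  consider "0 \<le> d - x" "d - x \<le> 2" | "d - x < 0" "x - d \<le> 1" | "x - d > 1" | "d - x > 2" by linarith
  then show ?thesis
  proof cases
    case 1
    then show ?thesis using a by (simp add: capped_cosh_def)
  next
    case 2
    have "cosh (\<theta> * of_real (d - x)) = cosh (- (\<theta> * of_real (d - x)))" by (simp only: cosh_minus)
    then have "norm (capped_cosh \<theta> (max (d - x) 0) - cosh (\<theta> * of_real (d - x)))
      = norm (cosh (\<theta> * of_real (x - d)) - 1)"
      using 2 by (simp add: capped_cosh_def norm_minus_commute algebra_simps)
    also have "\<dots> \<le> (a * (x - d))\<^sup>2 * exp (a * (x - d))"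
      using norm_cosh_minus_1_le[of "\<theta> * of_real (x - d)"] 2
      by (simp add: norm_mult a_def del: of_real_diff)
    also have "\<dots> \<le> (a * (x - d))\<^sup>2 * exp (a * 1)"
      using 2 a by (intro mult_left_mono) (auto intro: mult_left_mono simp del: mult_1_right)
    also have "\<dots> \<le> ?R"
      using 2 a by (simp add: power_mult_distrib)
    finally show ?thesis .
  next
    case 3
    then have x: "\<bar>x\<bar> > 1" "x > 1" using d by auto
    have "norm (capped_cosh \<theta> (max (d - x) 0) - cosh (\<theta> * of_real (d - x)))
      \<le> 1 + exp (a * \<bar>d - x\<bar>)"
      using 3 norm_cosh_le[of "\<theta> * of_real (d - x)"]
        norm_triangle_ineq4[of 1 "cosh (\<theta> * of_real (d - x))"]
      by (simp add: capped_cosh_def norm_mult a_def del: of_real_diff)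
    also have "\<dots> \<le> 1 + exp (a * \<bar>x\<bar>)"
      using 3 d a by (auto intro!: mult_left_mono)
    also have "\<dots> \<le> 2 * (x ^ 4 * exp (a * \<bar>x\<bar>))"
      using x4[OF x(1)] by linarith
    also have "\<dots> \<le> 2 * exp (2 * a) * (x ^ 4 * exp (a * \<bar>x\<bar>))"
      using e2 by (intro mult_right_mono) auto
    also have "\<dots> \<le> ?R"
      by simp
    finally show ?thesis .
  next
    case 4
    then have x: "\<bar>x\<bar> > 1" "x < -1" using d by auto
    have "norm (capped_cosh \<theta> (max (d - x) 0) - cosh (\<theta> * of_real (d - x)))
      \<le> exp (2 * a) + exp (a * \<bar>d - x\<bar>)"
      using 4 norm_cosh_le[of "\<theta> * of_real (d - x)"] norm_capped_cosh_le[of "max (d - x) 0" \<theta>]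
        norm_triangle_ineq4[of "capped_cosh \<theta> (max (d - x) 0)" "cosh (\<theta> * of_real (d - x))"]
      by (simp add: norm_mult a_def del: of_real_diff)
    also have "\<dots> \<le> exp (2 * a) * (x ^ 4 * exp (a * \<bar>x\<bar>)) + exp (2 * a) * (x ^ 4 * exp (a * \<bar>x\<bar>))"
    proof (rule add_mono)
      show "exp (2 * a) \<le> exp (2 * a) * (x ^ 4 * exp (a * \<bar>x\<bar>))"
        using x4[OF x(1)] by (simp del: exp_le_cancel_iff)
      have "exp (a * \<bar>d - x\<bar>) \<le> exp (a * (1 + \<bar>x\<bar>))"
        using d a by (auto intro!: mult_left_mono)
      also have "\<dots> = exp a * exp (a * \<bar>x\<bar>)" by (simp add: distrib_left exp_add)
      also have "\<dots> \<le> exp (2 * a) * (x ^ 4 * exp (a * \<bar>x\<bar>))"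
        using e2 x4[OF x(1)] by (intro mult_mono) auto
      finally show "exp (a * \<bar>d - x\<bar>) \<le> exp (2 * a) * (x ^ 4 * exp (a * \<bar>x\<bar>))" .
    qed
    also have "\<dots> \<le> ?R"
      by simp
    finally show ?thesis .
  qed
qed

section \<open>Gaussian walks stopped when the range exceeds 1\<close>

text \<open>The imaginary part of \<open>w\<close> is supplied by the characteristic function of the
  normal law; the real part is added by completing the square, that is, by translating the
  integration variable by \<open>a\<close>.\<close>

lemma has_bochner_integral_std_normal_exp:
  fixes w :: complex
  shows "has_bochner_integral lborel (\<lambda>z. std_normal_density z *\<^sub>R exp (w * of_real z)) (exp (w\<^sup>2 / 2))"
proof -
  define a b where "a = Re w" and "b = Im w"
  have w: "w = of_real a + \<i> * of_real b" by (simp add: a_def b_def complex_eq)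
  have "integrable std_normal_distribution (\<lambda>z. iexp (b * z))"
    by (rule prob_space.integrable_iexp) (auto intro: prob_space_normal_density)
  then have "has_bochner_integral std_normal_distribution (\<lambda>z. iexp (b * z)) (exp (- (of_real b)\<^sup>2 / 2))"
    unfolding has_bochner_integral_iff
    using fun_cong[OF char_std_normal_distribution, of b] by (simp add: char_def exp_of_real[symmetric])
  then have "has_bochner_integral lborel (\<lambda>z. std_normal_density z *\<^sub>R iexp (b * z)) (exp (- (of_real b)\<^sup>2 / 2))"
    unfolding has_bochner_integral_iff by (simp add: integrable_density integral_density)
  then have "has_bochner_integral lborel
      (\<lambda>z. std_normal_density (- a + 1 * z) *\<^sub>R iexp (b * (- a + 1 * z))) (exp (- (of_real b)\<^sup>2 / 2) /\<^sub>R \<bar>1\<bar>)"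
    by (rule iffD1[OF lborel_has_bochner_integral_real_affine_iff, rotated]) simp
  from has_bochner_integral_mult_right[OF this, of "exp (of_real (a\<^sup>2 / 2) + \<i> * of_real (a * b))"]
  have "has_bochner_integral lborel
      (\<lambda>z. exp (of_real (a\<^sup>2 / 2) + \<i> * of_real (a * b)) *
         (std_normal_density (- a + 1 * z) *\<^sub>R iexp (b * (- a + 1 * z))))
      (exp (of_real (a\<^sup>2 / 2) + \<i> * of_real (a * b)) * (exp (- (of_real b)\<^sup>2 / 2) /\<^sub>R \<bar>1\<bar>))"
    by simp
  also have "exp (of_real (a\<^sup>2 / 2) + \<i> * of_real (a * b)) * (exp (- (of_real b)\<^sup>2 / 2) /\<^sub>R \<bar>1\<bar>) = exp (w\<^sup>2 / 2)"
  proof -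
    have "of_real (a\<^sup>2 / 2) + \<i> * of_real (a * b) + - (of_real b)\<^sup>2 / 2 = w\<^sup>2 / 2"
      by (simp add: w complex_eq_iff power2_eq_square)
    then show ?thesis unfolding abs_one inverse_1 scaleR_one mult_exp_exp by (simp only:)
  qed
  also have "(\<lambda>z. exp (of_real (a\<^sup>2 / 2) + \<i> * of_real (a * b)) *
         (std_normal_density (- a + 1 * z) *\<^sub>R iexp (b * (- a + 1 * z))))
      = (\<lambda>z. std_normal_density z *\<^sub>R exp (w * of_real z))"
  proof
    fix z :: real
    have "- (- a + 1 * z)\<^sup>2 / 2 = - z\<^sup>2 / 2 + (a * z - a\<^sup>2 / 2)"
      by (simp add: power2_eq_square field_simps)
    then have 1: "std_normal_density (- a + 1 * z) = std_normal_density z * exp (a * z - a\<^sup>2 / 2)"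
      unfolding std_normal_density_def mult.assoc mult_exp_exp by (simp only:)
    have "(of_real (a\<^sup>2 / 2) + \<i> * of_real (a * b)) + (of_real (a * z - a\<^sup>2 / 2) + \<i> * of_real (b * (- a + 1 * z)))
        = w * of_real z"
      by (simp add: w complex_eq_iff algebra_simps)
    then have 2: "exp (of_real (a\<^sup>2 / 2) + \<i> * of_real (a * b)) *
        (of_real (exp (a * z - a\<^sup>2 / 2)) * iexp (b * (- a + 1 * z))) = exp (w * of_real z)"
      unfolding exp_of_real[symmetric] mult_exp_exp by (simp only:)
    show "exp (of_real (a\<^sup>2 / 2) + \<i> * of_real (a * b)) *
         (std_normal_density (- a + 1 * z) *\<^sub>R iexp (b * (- a + 1 * z)))
       = std_normal_density z *\<^sub>R exp (w * of_real z)"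
      unfolding 1 2[symmetric] by (simp only: scaleR_conv_of_real of_real_mult mult_ac)
  qed
  finally show ?thesis .
qed

lemma (in prob_space) has_bochner_integral_normal_exp:
  fixes w :: complex
  assumes X: "distributed M lborel X (normal_density 0 \<sigma>)" and \<sigma>: "0 < \<sigma>"
  shows "has_bochner_integral M (\<lambda>\<omega>. exp (w * of_real (X \<omega>))) (exp (w\<^sup>2 * of_real (\<sigma>\<^sup>2) / 2))"
proof -
  have "distributed M lborel (\<lambda>x. (X x - 0) / \<sigma>) std_normal_density"
    using X normal_standard_normal_convert[OF \<sigma>] by blast
  then have Z: "distr M lborel (\<lambda>x. X x / \<sigma>) = std_normal_distribution"
      "(\<lambda>x. X x / \<sigma>) \<in> measurable M lborel"
    by (auto dest: distributed_distr_eq_density distributed_measurable)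
  have "has_bochner_integral std_normal_distribution (\<lambda>z. exp (w * of_real \<sigma> * of_real z))
      (exp ((w * of_real \<sigma>)\<^sup>2 / 2))"
    by (intro has_bochner_integral_density has_bochner_integral_std_normal_exp) auto
  then have "has_bochner_integral M (\<lambda>\<omega>. exp (w * of_real \<sigma> * of_real (X \<omega> / \<sigma>))) (exp ((w * of_real \<sigma>)\<^sup>2 / 2))"
    using Z(2) unfolding Z(1)[symmetric] has_bochner_integral_iff
    by (simp add: integrable_distr_eq integral_distr)
  then show ?thesis
    using \<sigma> by (simp add: power_mult_distrib)
qed

text \<open>For z = |X| / \<sigma>, the term of index 4 in the exponential series gives z^4 \<le> 24
  exp z, and exp ((a + 1) z) is at most the sum of the exponentials with both signs. Their two equal
  expectations give 48. The bound \<sigma> \<le> 1 removes \<sigma> from the exponent.\<close>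

lemma (in prob_space) normal_fourth_moment_exp_le:
  assumes X: "distributed M lborel X (normal_density 0 \<sigma>)" and \<sigma>: "0 < \<sigma>" "\<sigma> \<le> 1" and a: "0 \<le> a"
  shows "integrable M (\<lambda>\<omega>. X \<omega> ^ 4 * exp (a * \<bar>X \<omega>\<bar>))" (is ?A)
    and "expectation (\<lambda>\<omega>. X \<omega> ^ 4 * exp (a * \<bar>X \<omega>\<bar>)) \<le> \<sigma> ^ 4 * (48 * exp ((a + 1)\<^sup>2 / 2))" (is ?B)
proof -
  have [measurable]: "X \<in> borel_measurable M"
    using distributed_measurable[OF X] by simp
  let ?Z = "\<lambda>\<omega>. X \<omega> / \<sigma>"
  have Z: "distributed M lborel ?Z std_normal_density"
    using X normal_standard_normal_convert[OF \<sigma>(1)] by force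
  have E: "has_bochner_integral M (\<lambda>\<omega>. exp (s * ?Z \<omega>)) (exp (s\<^sup>2 / 2))" for s :: real
  proof -
    have "has_bochner_integral M (\<lambda>\<omega>. Re (exp (of_real s * of_real (?Z \<omega>))))
        (Re (exp ((of_real s)\<^sup>2 * of_real (1\<^sup>2) / 2)))"
      by (intro has_bochner_integral_Re has_bochner_integral_normal_exp[OF Z]) simp
    moreover have "Re (exp ((of_real s)\<^sup>2 * of_real (1\<^sup>2) / 2)) = exp (s\<^sup>2 / 2)"
      by (simp add: Re_exp power2_eq_square)
    moreover have "Re (exp (of_real s * of_real (?Z \<omega>))) = exp (s * ?Z \<omega>)" for \<omega>
      by (simp add: Re_exp)
    ultimately show ?thesis by simp
  qed
  have D: "has_bochner_integral M
      (\<lambda>\<omega>. \<sigma> ^ 4 * (24 * (exp ((a + 1) * ?Z \<omega>) + exp ((- (a + 1)) * ?Z \<omega>))))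
      (\<sigma> ^ 4 * (24 * (exp ((a + 1)\<^sup>2 / 2) + exp ((- (a + 1))\<^sup>2 / 2))))"
    by (intro has_bochner_integral_mult_right has_bochner_integral_add E)
  have bd: "X \<omega> ^ 4 * exp (a * \<bar>X \<omega>\<bar>)
      \<le> \<sigma> ^ 4 * (24 * (exp ((a + 1) * ?Z \<omega>) + exp ((- (a + 1)) * ?Z \<omega>)))" for \<omega>
  proof -
    define z where "z = \<bar>?Z \<omega>\<bar>"
    have X: "\<bar>X \<omega>\<bar> = \<sigma> * z" using \<sigma> by (simp add: z_def)
    have z0: "0 \<le> z" by (simp add: z_def)
    have "summable (\<lambda>k. inverse (fact k) * z ^ k)"
      by (rule summable_exp)
    then have "(\<Sum>k\<in>{4::nat}. inverse (fact k) * z ^ k) \<le> (\<Sum>k. inverse (fact k) * z ^ k)"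
      by (rule sum_le_suminf) (use z0 in simp_all)
    also have "\<dots> = exp z" by (simp add: exp_def)
    finally have z4: "z ^ 4 \<le> 24 * exp z"
      by (simp add: fact_numeral)
    have "X \<omega> ^ 4 = \<bar>X \<omega>\<bar> ^ 4" by simp
    also have "\<dots> = \<sigma> ^ 4 * z ^ 4" by (simp add: X power_mult_distrib)
    finally have "X \<omega> ^ 4 * exp (a * \<bar>X \<omega>\<bar>) = \<sigma> ^ 4 * (z ^ 4 * exp (a * (\<sigma> * z)))"
      by (simp add: X)
    also have "\<dots> \<le> \<sigma> ^ 4 * ((24 * exp z) * exp (a * z))"
    proof -
      have "\<sigma> * z \<le> z" using mult_right_mono[OF \<sigma>(2) z0] by simp
      then have "exp (a * (\<sigma> * z)) \<le> exp (a * z)" using a by (simp add: mult_left_mono)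
      from mult_mono[OF z4 this] show ?thesis
        using \<sigma> by (simp add: mult_left_mono)
    qed
    also have "(24 * exp z) * exp (a * z) = 24 * exp ((a + 1) * z)"
      by (simp add: mult_exp_exp distrib_right add.commute)
    also have "exp ((a + 1) * z) \<le> exp ((a + 1) * ?Z \<omega>) + exp ((- (a + 1)) * ?Z \<omega>)"
    proof (cases "0 \<le> ?Z \<omega>")
      case True
      then have "z = ?Z \<omega>" unfolding z_def by (rule abs_of_nonneg)
      then show ?thesis by (simp only: le_add_same_cancel1 exp_ge_zero)
    next
      case False
      then have "z = - ?Z \<omega>" unfolding z_def by (intro abs_of_neg) linarith
      then have "(a + 1) * z = (- (a + 1)) * ?Z \<omega>" by (simp only: mult_minus_left mult_minus_right)
      then show ?thesis by (simp only: le_add_same_cancel2 exp_ge_zero)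
    qed
    finally show ?thesis using \<sigma> by (simp only: mult_left_mono zero_le_power less_imp_le mult_le_cancel_left_pos zero_less_numeral zero_less_power)
  qed
  have nn: "0 \<le> X \<omega> ^ 4 * exp (a * \<bar>X \<omega>\<bar>)" for \<omega> by simp
  have "norm (X \<omega> ^ 4 * exp (a * \<bar>X \<omega>\<bar>))
      \<le> norm (\<sigma> ^ 4 * (24 * (exp ((a + 1) * ?Z \<omega>) + exp ((- (a + 1)) * ?Z \<omega>))))" for \<omega>
    unfolding real_norm_def abs_of_nonneg[OF nn] by (rule order_trans[OF bd abs_ge_self])
  then show ?A
    by (intro Bochner_Integration.integrable_bound[OF integrable.intros[OF D]] AE_I2) measurable
  show ?B
    using integral_mono[OF \<open>?A\<close> integrable.intros[OF D] bd]
    unfolding has_bochner_integral_integral_eq[OF D] power2_minus by simp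
qed

lemma norm_sinh_le: "norm (sinh (z :: complex)) \<le> exp (norm z)"
proof -
  have "norm (sinh z) \<le> (norm (exp z) + norm (exp (- z))) / 2"
    unfolding sinh_def using norm_triangle_ineq4[of "exp z" "exp (- z)"] by simp
  also have "\<dots> \<le> exp (norm z)"
    using norm_exp[of z] norm_exp[of "- z"] by (simp del: norm_exp_eq_Re)
  finally show ?thesis .
qed

section \<open>The approximate martingale identity for the stopped walk\<close>

lemma borel_measurable_drawdown:
  assumes "\<And>i. i < k \<Longrightarrow> (\<lambda>v. g v i) \<in> borel_measurable N"
  shows "(\<lambda>v. drawdown (g v) k) \<in> borel_measurable N"
  using assms
proof (induction k)
  case (Suc k)
  have [measurable]: "(\<lambda>v. drawdown (g v) k) \<in> borel_measurable N"
    by (rule Suc.IH) (simp add: Suc.prems)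
  have [measurable]: "(\<lambda>v. g v k) \<in> borel_measurable N" by (simp add: Suc.prems)
  show ?case by simp
qed simp

lemma borel_measurable_walk_range:
  assumes "\<And>i. i < k \<Longrightarrow> (\<lambda>v. g v i) \<in> borel_measurable N"
  shows "(\<lambda>v. walk_range (g v) k) \<in> borel_measurable N"
  unfolding walk_range_def
  by (intro borel_measurable_add borel_measurable_drawdown borel_measurable_uminus assms)

lemma sum_less_walk_exit:
  "(\<Sum>k<walk_exit n \<xi>. f k) = (\<Sum>k<n. if walk_range \<xi> k \<le> 1 then f k else 0)"
proof -
  have "{..<walk_exit n \<xi>} = {..<n} \<inter> {k. walk_range \<xi> k \<le> 1}"
    by (auto simp: less_walk_exit_iff)
  then show ?thesis by (simp add: sum.inter_restrict)
qed

lemma (in prob_space) indep_vars_past_present: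
  fixes \<xi> :: "nat \<Rightarrow> 'a \<Rightarrow> real"
  assumes "indep_vars (\<lambda>_. borel) \<xi> {..<n}" and "k < n"
    and "G \<in> borel_measurable (PiM {..<k} (\<lambda>_. borel))" and "H \<in> borel_measurable borel"
  shows "indep_var borel (\<lambda>\<omega>. G (\<lambda>i\<in>{..<k}. \<xi> i \<omega>)) borel (\<lambda>\<omega>. H (\<xi> k \<omega>))"
proof -
  have "indep_var (PiM {..<k} (\<lambda>_. borel)) (\<lambda>\<omega>. restrict (\<lambda>i. \<xi> i \<omega>) {..<k})
      (PiM {k} (\<lambda>_. borel)) (\<lambda>\<omega>. restrict (\<lambda>i. \<xi> i \<omega>) {k})"
    by (rule indep_var_restrict[OF assms(1)]) (use assms(2) in auto)
  from indep_var_compose[OF this assms(3), of "\<lambda>v. H (v k)" borel] assms(4)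
  show ?thesis by (simp add: comp_def)
qed

text \<open>Telescoping reduces the claim to one step. By the addition theorem, an unreflected step
  multiplies cosh (\<theta> D) by cosh (\<theta> \<xi>), of mean exp (\<theta>^2 \<delta> / 2), and
  adds a sinh term of mean 0; independence of the past makes it cancel against the discount. Only
  the error of \<open>capped_cosh_reflected_step\<close> survives.\<close>

lemma (in prob_space)
  fixes \<theta> :: complex and \<xi> :: "nat \<Rightarrow> 'a \<Rightarrow> real"
  assumes [measurable]: "\<And>i. \<xi> i \<in> borel_measurable M"
    and indep: "indep_vars (\<lambda>_. borel) \<xi> {..<n}"
    and normal: "\<And>i. i < n \<Longrightarrow> distributed M lborel (\<xi> i) (normal_density 0 (sqrt \<delta>))"
    and \<delta>: "0 < \<delta>" "\<delta> \<le> 1"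
    and \<theta>: "0 \<le> Re (\<theta>\<^sup>2)"
  defines "\<tau> \<equiv> \<lambda>\<omega>. walk_exit n (\<lambda>i. \<xi> i \<omega>)"
  defines "Y \<equiv> \<lambda>\<omega>. exp (- (\<theta>\<^sup>2 / 2) * of_real (\<delta> * \<tau> \<omega>)) * capped_cosh \<theta> (drawdown (\<lambda>i. \<xi> i \<omega>) (\<tau> \<omega>))"
  defines "S \<equiv> \<lambda>\<omega>. \<Sum>k<\<tau> \<omega>. (max_increment (\<lambda>i. \<xi> i \<omega>) k)\<^sup>2"
  shows borel_measurable_exit_cosh: "Y \<in> borel_measurable M"
    and integrable_sum_max_increment_squares: "integrable M S"
    and expectation_exit_cosh:
      "norm (expectation Y - 1) \<le> (norm \<theta>)\<^sup>2 * exp (norm \<theta>) * expectation S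
        + n * (2 * exp (2 * norm \<theta>) * (\<delta>\<^sup>2 * (48 * exp ((norm \<theta> + 1)\<^sup>2 / 2))))"
proof -
  define D where "D k \<omega> = drawdown (\<lambda>i. \<xi> i \<omega>) k" for k \<omega>
  define R where "R k \<omega> = walk_range (\<lambda>i. \<xi> i \<omega>) k" for k \<omega>
  define P where "P k \<omega> = max_increment (\<lambda>i. \<xi> i \<omega>) k" for k \<omega>
  define N where "N k \<omega> = exp (- (\<theta>\<^sup>2 / 2) * of_real (\<delta> * real k)) * capped_cosh \<theta> (D k \<omega>)" for k \<omega>
  define \<Delta> where "\<Delta> k \<omega> = (if R k \<omega> \<le> 1 then N (Suc k) \<omega> - N k \<omega> else 0)" for k \<omega>
  define Q where "Q k \<omega> = (if R k \<omega> \<le> 1 then (P k \<omega>)\<^sup>2 else 0)" for k \<omega>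
  define a where "a = norm \<theta>"
  have a: "0 \<le> a" by (simp add: a_def)
  have D[measurable]: "D k \<in> borel_measurable M" for k
    unfolding D_def by (rule borel_measurable_drawdown) simp
  have [measurable]: "R k \<in> borel_measurable M" for k
    unfolding R_def by (rule borel_measurable_walk_range) simp
  have [measurable]: "P k \<in> borel_measurable M" for k
    unfolding P_def max_increment_def D_def[symmetric] by measurable
  have [measurable]: "capped_cosh \<theta> \<in> borel_measurable borel"
    using continuous_capped_cosh by (rule borel_measurable_continuous_onI)
  have N[measurable]: "N k \<in> borel_measurable M" for k
    unfolding N_def by measurable
  have [measurable]: "\<Delta> k \<in> borel_measurable M" for k
    unfolding \<Delta>_def by measurable
  have [measurable]: "Q k \<in> borel_measurable M" for k
    unfolding Q_def by measurable
  have Y: "Y \<omega> = 1 + (\<Sum>k<n. \<Delta> k \<omega>)" for \<omega>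
  proof -
    have "Y \<omega> = N (\<tau> \<omega>) \<omega>" by (simp add: Y_def N_def D_def)
    also have "\<dots> = N 0 \<omega> + (\<Sum>k<\<tau> \<omega>. N (Suc k) \<omega> - N k \<omega>)"
      using sum_lessThan_telescope[of "\<lambda>k. N k \<omega>" "\<tau> \<omega>"] by simp
    also have "N 0 \<omega> = 1" by (simp add: N_def D_def capped_cosh_def)
    also have "(\<Sum>k<\<tau> \<omega>. N (Suc k) \<omega> - N k \<omega>) = (\<Sum>k<n. \<Delta> k \<omega>)"
      unfolding \<tau>_def sum_less_walk_exit \<Delta>_def R_def ..
    finally show ?thesis .
  qed
  have S: "S \<omega> = (\<Sum>k<n. Q k \<omega>)" for \<omega>
    unfolding S_def \<tau>_def sum_less_walk_exit Q_def R_def P_def ..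
  show "Y \<in> borel_measurable M"
    unfolding Y by measurable
  have [simp]: "integrable M (Q k)" for k
  proof (rule integrable_const_bound[of _ 1])
    have "Q k \<omega> \<le> 1" for \<omega>
      using max_increment_bounds[of "\<lambda>i. \<xi> i \<omega>" k] by (auto simp: Q_def P_def power_le_one)
    then show "AE \<omega> in M. norm (Q k \<omega>) \<le> 1" by (simp add: Q_def)
  qed measurable
  show "integrable M S"
    unfolding S by simp
  \<comment> \<open>This is where \<open>0 \<le> Re (\<theta>\<^sup>2)\<close> enters: the discount
    factors have modulus at most 1.\<close>
  have le1: "norm (exp (- (\<theta>\<^sup>2 / 2) * of_real (\<delta> * real k))) \<le> 1" for k :: nat
    using \<theta> \<delta> by (simp add: mult_nonneg_nonneg del: Re_power2)
  have N_le: "norm (N k \<omega>) \<le> exp (2 * a)" for k \<omega>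
  proof -
    have "norm (N k \<omega>) \<le> 1 * exp (2 * a)"
      unfolding N_def norm_mult a_def by (intro mult_mono le1 norm_capped_cosh_le) (auto simp: D_def)
    then show ?thesis by simp
  qed
  have int\<Delta>[simp]: "integrable M (\<Delta> k)" for k
  proof (rule integrable_const_bound[of _ "2 * exp (2 * a)"])
    have "norm (\<Delta> k \<omega>) \<le> 2 * exp (2 * a)" for \<omega>
      using norm_triangle_ineq4[of "N (Suc k) \<omega>" "N k \<omega>"] N_le[of k \<omega>] N_le[of "Suc k" \<omega>]
      by (auto simp: \<Delta>_def)
    then show "AE \<omega> in M. norm (\<Delta> k \<omega>) \<le> 2 * exp (2 * a)" by simp
  qed measurable
  have step: "norm (expectation (\<Delta> k)) \<le> a\<^sup>2 * exp a * expectation (Q k)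
      + 2 * exp (2 * a) * (\<delta>\<^sup>2 * (48 * exp ((a + 1)\<^sup>2 / 2)))" if k: "k < n" for k
  proof -
    define q where "q = exp (- (\<theta>\<^sup>2 / 2) * of_real (\<delta> * real (Suc k)))"
    have q: "norm q \<le> 1" unfolding q_def by (rule le1)
    define C where "C \<omega> = (if R k \<omega> \<le> 1 then cosh (\<theta> * of_real (D k \<omega>)) else 0)" for \<omega>
    define C' where "C' \<omega> = (if R k \<omega> \<le> 1 then sinh (\<theta> * of_real (D k \<omega>)) else 0)" for \<omega>
    define E where "E \<omega> = (if R k \<omega> \<le> 1 then capped_cosh \<theta> (max (D k \<omega> - \<xi> k \<omega>) 0)
        - cosh (\<theta> * of_real (D k \<omega> - \<xi> k \<omega>)) else 0)" for \<omega>
    \<comment> \<open>Before the exit the drawdown is at most the range, so the cap at 2 is inactive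
      in \<open>N k\<close>.\<close>
    have DR: "D k \<omega> \<le> 1" if "R k \<omega> \<le> 1" for \<omega>
      using that drawdown_nonneg[of "\<lambda>i. - \<xi> i \<omega>" k] unfolding R_def D_def walk_range_def by linarith
    have cont: "cosh \<in> borel_measurable (borel :: complex measure)"
      "sinh \<in> borel_measurable (borel :: complex measure)"
      by (intro borel_measurable_continuous_onI continuous_on_cosh continuous_on_sinh continuous_on_id)+
    note [measurable] = cont
    have [measurable]: "C \<in> borel_measurable M" "C' \<in> borel_measurable M" "E \<in> borel_measurable M"
      unfolding C_def C'_def E_def by measurable
    \<comment> \<open>\<open>q\<close> is the discount after the step; \<open>E\<close> carries
      reflection and cap, and the bracket is the step of the unreflected functional.\<close>
    have eq: "\<Delta> k \<omega> = q * E \<omega> + q * (C \<omega> * cosh (\<theta> * of_real (\<xi> k \<omega>))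
        - C' \<omega> * sinh (\<theta> * of_real (\<xi> k \<omega>)) - exp (\<theta>\<^sup>2 * of_real \<delta> / 2) * C \<omega>)" for \<omega>
    proof (cases "R k \<omega> \<le> 1")
      case True
      have "N k \<omega> = q * (exp (\<theta>\<^sup>2 * of_real \<delta> / 2) * C \<omega>)"
        using True DR[OF True]
        by (simp add: N_def C_def q_def capped_cosh_def mult.assoc[symmetric] mult_exp_exp)
          (simp add: field_simps)
      moreover have "N (Suc k) \<omega> = q * capped_cosh \<theta> (max (D k \<omega> - \<xi> k \<omega>) 0)"
        by (simp add: N_def q_def D_def)
      moreover have "C \<omega> * cosh (\<theta> * of_real (\<xi> k \<omega>)) - C' \<omega> * sinh (\<theta> * of_real (\<xi> k \<omega>))
          = cosh (\<theta> * of_real (D k \<omega> - \<xi> k \<omega>))"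
        using True by (simp add: C_def C'_def cosh_diff right_diff_distrib)
      ultimately show ?thesis
        using True by (simp add: \<Delta>_def E_def algebra_simps)
    next
      case False
      then show ?thesis by (simp add: \<Delta>_def E_def C_def C'_def)
    qed
    have C_le: "norm (C \<omega>) \<le> exp a" for \<omega>
    proof (cases "R k \<omega> \<le> 1")
      case True
      have "norm (C \<omega>) \<le> exp (norm (\<theta> * of_real (D k \<omega>)))"
        using True by (simp add: C_def norm_cosh_le)
      also have "\<dots> \<le> exp a"
        using DR[OF True] a by (simp add: norm_mult a_def mult_left_le D_def)
      finally show ?thesis .
    qed (simp add: C_def)
    have C'_le: "norm (C' \<omega>) \<le> exp a" for \<omega>
    proof (cases "R k \<omega> \<le> 1")
      case True
      have "norm (C' \<omega>) \<le> exp (norm (\<theta> * of_real (D k \<omega>)))"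
        using True norm_sinh_le by (simp add: C'_def)
      also have "\<dots> \<le> exp a"
        using DR[OF True] a by (simp add: norm_mult a_def mult_left_le D_def)
      finally show ?thesis .
    qed (simp add: C'_def)
    have [simp]: "integrable M C" "integrable M C'"
      using C_le C'_le by (auto intro!: integrable_const_bound[of _ "exp a"])
    have hx: "has_bochner_integral M (\<lambda>\<omega>. exp (w * of_real (\<xi> k \<omega>))) (exp (w\<^sup>2 * of_real \<delta> / 2))" for w :: complex
      using has_bochner_integral_normal_exp[OF normal[OF k], of w] \<delta> by simp
    have hc: "has_bochner_integral M (\<lambda>\<omega>. cosh (\<theta> * of_real (\<xi> k \<omega>))) (exp (\<theta>\<^sup>2 * of_real \<delta> / 2))"
      using has_bochner_integral_scaleR_right[of "1/2" , OF has_bochner_integral_add[OF hx[of \<theta>] hx[of "- \<theta>"]]]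
      by (simp add: cosh_def scaleR_add_right[symmetric] scaleR_2[symmetric])
    have hs: "has_bochner_integral M (\<lambda>\<omega>. sinh (\<theta> * of_real (\<xi> k \<omega>))) 0"
      using has_bochner_integral_scaleR_right[of "1/2" , OF has_bochner_integral_diff[OF hx[of \<theta>] hx[of "- \<theta>"]]]
      by (simp add: sinh_def)
    \<comment> \<open>Writes \<open>C\<close> and \<open>C'\<close> as functionals of the first
      \<open>k\<close> increments, as \<open>indep_vars_past_present\<close> requires.\<close>
    define G where "G f v = (if walk_range v k \<le> 1 then f (\<theta> * of_real (drawdown v k)) else 0)"
      for f :: "complex \<Rightarrow> complex" and v :: "nat \<Rightarrow> real"
    have G[measurable]: "G f \<in> borel_measurable (PiM {..<k} (\<lambda>_. borel))"
      if [measurable]: "f \<in> borel_measurable borel" for f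
    proof -
      have [measurable]: "(\<lambda>v. drawdown v k) \<in> borel_measurable (PiM {..<k} (\<lambda>_. borel))"
        "(\<lambda>v. walk_range v k) \<in> borel_measurable (PiM {..<k} (\<lambda>_. borel))"
        by (auto intro!: borel_measurable_drawdown borel_measurable_walk_range measurable_component_singleton)
      show ?thesis unfolding G_def by measurable
    qed
    have GC: "G cosh (\<lambda>i\<in>{..<k}. \<xi> i \<omega>) = C \<omega>" "G sinh (\<lambda>i\<in>{..<k}. \<xi> i \<omega>) = C' \<omega>" for \<omega>
      using drawdown_cong[of k "\<lambda>i\<in>{..<k}. \<xi> i \<omega>" "\<lambda>i. \<xi> i \<omega>"]
        walk_range_cong[of k "\<lambda>i\<in>{..<k}. \<xi> i \<omega>" "\<lambda>i. \<xi> i \<omega>"]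
      by (simp_all add: G_def C_def C'_def R_def D_def)
    have i1: "indep_var borel C borel (\<lambda>\<omega>. cosh (\<theta> * of_real (\<xi> k \<omega>)))"
      using indep_vars_past_present[OF indep k, of "G cosh" "\<lambda>x. cosh (\<theta> * of_real x)"] by (simp add: GC)
    have i2: "indep_var borel C' borel (\<lambda>\<omega>. sinh (\<theta> * of_real (\<xi> k \<omega>)))"
      using indep_vars_past_present[OF indep k, of "G sinh" "\<lambda>x. sinh (\<theta> * of_real x)"] by (simp add: GC)
    note hc' = integrable.intros[OF hc] has_bochner_integral_integral_eq[OF hc]
    note hs' = integrable.intros[OF hs] has_bochner_integral_integral_eq[OF hs]
    note [simp] = indep_var_integrable[OF i1 \<open>integrable M C\<close> hc'(1)]
      indep_var_integrable[OF i2 \<open>integrable M C'\<close> hs'(1)]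
    have zero: "expectation (\<lambda>\<omega>. C \<omega> * cosh (\<theta> * of_real (\<xi> k \<omega>))
        - C' \<omega> * sinh (\<theta> * of_real (\<xi> k \<omega>)) - exp (\<theta>\<^sup>2 * of_real \<delta> / 2) * C \<omega>) = 0"
      using indep_var_lebesgue_integral[OF i1 _ hc'(1)] indep_var_lebesgue_integral[OF i2 _ hs'(1)]
      by (simp add: hc'(2) hs'(2))
    have s: "sqrt \<delta> \<le> 1" "0 < sqrt \<delta>" "sqrt \<delta> ^ 4 = \<delta>\<^sup>2"
      using \<delta> by (auto simp: power4_eq_xxxx power2_eq_square)
    note fm = normal_fourth_moment_exp_le[OF normal[OF k] s(2,1) a]
    define B where "B \<omega> = a\<^sup>2 * exp a * Q k \<omega> + 2 * exp (2 * a) * (\<xi> k \<omega> ^ 4 * exp (a * \<bar>\<xi> k \<omega>\<bar>))" for \<omega>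
    have E_le: "norm (E \<omega>) \<le> B \<omega>" for \<omega>
    proof (cases "R k \<omega> \<le> 1")
      case True
      with capped_cosh_reflected_step[of "D k \<omega>" \<theta> "\<xi> k \<omega>"] DR[OF True]
      show ?thesis by (simp add: E_def B_def a_def Q_def P_def max_increment_def D_def)
    qed (auto simp: E_def B_def Q_def)
    have intB: "integrable M B" unfolding B_def using fm(1) by simp
    have intE: "integrable M E"
      by (rule Bochner_Integration.integrable_bound[OF intB]; (measurable)?)
        (use E_le in \<open>auto intro!: AE_I2 order_trans[OF _ abs_ge_self]\<close>)
    have "expectation (\<Delta> k) = q * expectation E + q * expectation (\<lambda>\<omega>. C \<omega> * cosh (\<theta> * of_real (\<xi> k \<omega>))
        - C' \<omega> * sinh (\<theta> * of_real (\<xi> k \<omega>)) - exp (\<theta>\<^sup>2 * of_real \<delta> / 2) * C \<omega>)"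
      unfolding eq[abs_def] using intE by (subst Bochner_Integration.integral_add) auto
    then have "norm (expectation (\<Delta> k)) = norm q * norm (expectation E)"
      by (simp add: zero norm_mult)
    also have "\<dots> \<le> 1 * norm (expectation E)"
      using q by (intro mult_right_mono) auto
    also have "\<dots> \<le> expectation (\<lambda>\<omega>. norm (E \<omega>))"
      by simp
    also have "\<dots> \<le> expectation B"
      using intE intB E_le by (intro integral_mono) auto
    also have "\<dots> = a\<^sup>2 * exp a * expectation (Q k)
        + 2 * exp (2 * a) * expectation (\<lambda>\<omega>. \<xi> k \<omega> ^ 4 * exp (a * \<bar>\<xi> k \<omega>\<bar>))"
      unfolding B_def using fm(1) by simp
    also have "\<dots> \<le> a\<^sup>2 * exp a * expectation (Q k) + 2 * exp (2 * a) * (\<delta>\<^sup>2 * (48 * exp ((a + 1)\<^sup>2 / 2)))"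
      using fm(2) s(3) by (intro add_left_mono mult_left_mono) auto
    finally show ?thesis .
  qed
  have "expectation Y - 1 = (\<Sum>k<n. expectation (\<Delta> k))"
    unfolding Y[abs_def] by (simp add: prob_space)
  then have "norm (expectation Y - 1) \<le> (\<Sum>k<n. norm (expectation (\<Delta> k)))"
    by (simp add: norm_sum)
  also have "\<dots> \<le> (\<Sum>k<n. a\<^sup>2 * exp a * expectation (Q k)
      + 2 * exp (2 * a) * (\<delta>\<^sup>2 * (48 * exp ((a + 1)\<^sup>2 / 2))))"
    by (intro sum_mono step) simp
  also have "\<dots> = a\<^sup>2 * exp a * expectation S + n * (2 * exp (2 * a) * (\<delta>\<^sup>2 * (48 * exp ((a + 1)\<^sup>2 / 2))))"
    unfolding S[abs_def] by (simp add: sum.distrib sum_distrib_left)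
  finally show "norm (expectation Y - 1) \<le> (norm \<theta>)\<^sup>2 * exp (norm \<theta>) * expectation S
        + n * (2 * exp (2 * norm \<theta>) * (\<delta>\<^sup>2 * (48 * exp ((norm \<theta> + 1)\<^sup>2 / 2))))"
    by (simp add: a_def)
qed

section \<open>Passage to continuous paths\<close>

text \<open>Agrees with the exceedance time of the range on continuous paths and is measurable on the
  product space, which the exceedance time itself need not be.\<close>

definition rational_exit :: "(real \<Rightarrow> real) \<Rightarrow> ennreal" where
  "rational_exit w = (INF s\<in>\<rat> \<inter> {0..}. INF u\<in>\<rat> \<inter> {0..}.
     if 1 < w s - w u then ennreal (max s u) else \<top>)"

lemma rational_exit_cong: "(\<And>t. 0 \<le> t \<Longrightarrow> v t = w t) \<Longrightarrow> rational_exit v = rational_exit w"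
  unfolding rational_exit_def by (intro INF_cong refl if_cong) auto

lemma rational_exit_restrict: "rational_exit (\<lambda>t\<in>{0..}. w t) = rational_exit w"
  by (rule rational_exit_cong) simp

lemma borel_measurable_rational_exit:
  "rational_exit \<in> borel_measurable (\<Pi>\<^sub>M t\<in>{0..}. borel)"
proof -
  have [measurable]: "(\<lambda>w. w s) \<in> borel_measurable (\<Pi>\<^sub>M t\<in>{0::real..}. borel :: real measure)"
    if "s \<in> \<rat> \<inter> {0..}" for s :: real
    using that by (intro measurable_component_singleton) auto
  have c: "countable (\<rat> \<inter> {0::real..})"
    using countable_rat by (rule countable_subset[rotated]) auto
  show ?thesis
    unfolding rational_exit_def
    by (intro borel_measurable_INF c) measurable
qed

text \<open>The approximation is from the left, so that moving witness times to rationals never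
  makes them later. At 0 the point itself is rational.\<close>

lemma rational_near:
  fixes w :: "real \<Rightarrow> real"
  assumes w: "continuous_on {0..} w" and s: "0 \<le> s" and e: "0 < e"
  obtains r where "r \<in> \<rat>" "0 \<le> r" "r \<le> s" "\<bar>w r - w s\<bar> < e"
proof (cases "s = 0")
  case True
  with e show ?thesis by (intro that[of 0]) auto
next
  case False
  from w s e obtain d where d: "0 < d" "\<And>x. 0 \<le> x \<Longrightarrow> \<bar>x - s\<bar> < d \<Longrightarrow> \<bar>w x - w s\<bar> < e"
    unfolding continuous_on_iff dist_real_def by (metis atLeast_iff)
  from False s d obtain r where "r \<in> \<rat>" "max 0 (s - d) < r" "r < s"
    using Rats_dense_in_real[of "max 0 (s - d)" s] by auto
  with d show ?thesis by (intro that[of r]) auto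
qed

text \<open>Continuity on the compact interval gives boundedness, without which the real
  \<open>SUP\<close> and \<open>INF\<close> would be meaningless.\<close>

lemma range_process_gt_iff:
  assumes W: "continuous_on {0..} (\<lambda>t. W t \<omega>)" and t: "0 \<le> t"
  shows "c < range_process W t \<omega> \<longleftrightarrow> (\<exists>s\<in>{0..t}. \<exists>u\<in>{0..t}. c < W s \<omega> - W u \<omega>)"
proof -
  have ne: "{0..t} \<noteq> {}" using t by auto
  have "compact ((\<lambda>t. W t \<omega>) ` {0..t})"
    using W by (intro compact_continuous_image continuous_on_subset[OF W]) auto
  then have "bounded ((\<lambda>t. W t \<omega>) ` {0..t})" by (rule compact_imp_bounded)
  then have b: "bdd_above ((\<lambda>t. W t \<omega>) ` {0..t})" "bdd_below ((\<lambda>t. W t \<omega>) ` {0..t})"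
    by (simp_all add: bounded_imp_bdd_above bounded_imp_bdd_below)
  show ?thesis
  proof
    assume "c < range_process W t \<omega>"
    then have "c + (INF s\<in>{0..t}. W s \<omega>) < (SUP s\<in>{0..t}. W s \<omega>)"
      by (simp add: range_process_def)
    then obtain s where s: "s \<in> {0..t}" "c + (INF s\<in>{0..t}. W s \<omega>) < W s \<omega>"
      using less_cSUP_iff[OF ne b(1)] by blast
    then have "(INF s\<in>{0..t}. W s \<omega>) < W s \<omega> - c" by simp
    then obtain u where "u \<in> {0..t}" "W u \<omega> < W s \<omega> - c"
      using cINF_less_iff[OF ne b(2)] by blast
    with s show "\<exists>s\<in>{0..t}. \<exists>u\<in>{0..t}. c < W s \<omega> - W u \<omega>"
      by (intro bexI[of _ s] bexI[of _ u]) auto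
  next
    assume "\<exists>s\<in>{0..t}. \<exists>u\<in>{0..t}. c < W s \<omega> - W u \<omega>"
    then obtain s u where "s \<in> {0..t}" "u \<in> {0..t}" "c < W s \<omega> - W u \<omega>" by blast
    then show "c < range_process W t \<omega>"
      using cSUP_upper[OF _ b(1), of s] cINF_lower[OF b(2), of u]
      unfolding range_process_def by fastforce
  qed
qed

text \<open>The strict inequality leaves slack: each of the two values may move by less than half
  the excess over 1, and both times move to rationals on their left.\<close>

lemma exit_real_witness_le:
  assumes w: "continuous_on {0..} w" and t: "s \<in> {0..t}" "u \<in> {0..t}" and gt: "1 < w s - w u"
  shows "rational_exit w \<le> ennreal t"
proof -
  define e where "e = (w s - w u - 1) / 2"
  have e: "0 < e" using gt by (simp add: e_def)
  obtain s' where s': "s' \<in> \<rat>" "0 \<le> s'" "s' \<le> s" "\<bar>w s' - w s\<bar> < e"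
    by (rule rational_near[OF w _ e, of s]) (use t in auto)
  obtain u' where u': "u' \<in> \<rat>" "0 \<le> u'" "u' \<le> u" "\<bar>w u' - w u\<bar> < e"
    by (rule rational_near[OF w _ e, of u]) (use t in auto)
  have gt': "1 < w s' - w u'"
    using s'(4) u'(4) unfolding abs_diff_less_iff e_def by argo
  have "rational_exit w \<le> ennreal (max s' u')"
    unfolding rational_exit_def
    by (rule INF_lower2[of s'], use s' in simp, rule INF_lower2[of u']) (use u' gt' in auto)
  also have "\<dots> \<le> ennreal t"
    using s' u' t by (intro ennreal_leI) auto
  finally show ?thesis .
qed

lemma exceedance_time_eq_rational_exit:
  assumes W: "continuous_on {0..} (\<lambda>t. W t \<omega>)"
  shows "exceedance_time (range_process W) \<omega> = rational_exit (\<lambda>t. W t \<omega>)"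
proof (rule antisym)
  show "exceedance_time (range_process W) \<omega> \<le> rational_exit (\<lambda>t. W t \<omega>)"
    unfolding rational_exit_def
  proof (intro INF_greatest)
    fix s u :: real assume su: "s \<in> \<rat> \<inter> {0..}" "u \<in> \<rat> \<inter> {0..}"
    show "exceedance_time (range_process W) \<omega> \<le>
      (if 1 < W s \<omega> - W u \<omega> then ennreal (max s u) else \<top>)"
    proof (cases "1 < W s \<omega> - W u \<omega>")
      case True
      have m: "s \<in> {0..max s u}" "u \<in> {0..max s u}" "0 \<le> max s u" using su by auto
      have "1 < range_process W (max s u) \<omega>"
        unfolding range_process_gt_iff[of W \<omega> "max s u", OF W m(3)] using True m by blast
      then have "exceedance_time (range_process W) \<omega> \<le> ennreal (max s u)"
        unfolding exceedance_time_def using m by (intro INF_lower) auto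
      with True show ?thesis by simp
    qed (simp only: if_False top_greatest)
  qed
  show "rational_exit (\<lambda>t. W t \<omega>) \<le> exceedance_time (range_process W) \<omega>"
    unfolding exceedance_time_def
    by (rule INF_greatest) (auto simp: range_process_gt_iff[of W \<omega>, OF W] intro: exit_real_witness_le[OF W])
qed

lemma rational_exit_less_witness:
  assumes "rational_exit w < ennreal c"
  obtains t s u where "t < c" "s \<in> {0..t}" "u \<in> {0..t}" "1 < w s - w u"
proof -
  from assms obtain s u where su: "s \<in> \<rat> \<inter> {0..}" "u \<in> \<rat> \<inter> {0..}"
    and "(if 1 < w s - w u then ennreal (max s u) else \<top>) < ennreal c"
    unfolding rational_exit_def INF_less_iff by blast
  then have "1 < w s - w u" "ennreal (max s u) < ennreal c"
    by (auto split: if_splits)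
  then show thesis
    using su by (intro that[of "max s u" s u]) (auto simp: ennreal_less_iff)
qed

section \<open>A fixed continuous path sampled on refining grids\<close>

context
  fixes w :: "real \<Rightarrow> real" and T :: real and n :: "nat \<Rightarrow> nat" and \<delta> :: "nat \<Rightarrow> real"
    and \<xi> :: "nat \<Rightarrow> nat \<Rightarrow> real"
  assumes w: "continuous_on {0..} w" and T: "rational_exit w = ennreal T" "0 \<le> T"
    and \<delta>_pos: "\<And>m. 0 < \<delta> m" and \<delta>_lim: "\<delta> \<longlonglongrightarrow> 0"
    and horizon: "filterlim (\<lambda>m. \<delta> m * real (n m)) at_top sequentially"
    and \<xi>: "\<And>m k. \<xi> m k = w (\<delta> m * real (Suc k)) - w (\<delta> m * real k)"
begin

private lemma walk_gt_iff:
  "1 < walk_range (\<xi> m) k \<longleftrightarrow> (\<exists>i\<le>k. \<exists>j\<le>k. 1 < w (\<delta> m * real i) - w (\<delta> m * real j))"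
  by (rule walk_range_gt_iff) (rule \<xi>)

text \<open>From below there is no error: a grid exit is an exit of the path, so it comes no earlier
  than \<open>T\<close> once the horizon has passed \<open>T\<close>. From above, a pair of witness
  times before \<open>a\<close> is replaced by nearby grid points, which still witness the exit by
  continuity.\<close>

lemma tendsto_walk_exit: "(\<lambda>m. \<delta> m * real (walk_exit (n m) (\<xi> m))) \<longlonglongrightarrow> T"
proof (rule order_tendstoI)
  have ge: "\<forall>\<^sub>F m in sequentially. T \<le> \<delta> m * real (walk_exit (n m) (\<xi> m))"
    using eventually_compose_filterlim[OF eventually_ge_at_top[of T] horizon]
  proof eventually_elim
    case (elim m)
    show ?case
    proof (cases "walk_exit (n m) (\<xi> m) < n m")
      case True
      define k where "k = walk_exit (n m) (\<xi> m)"
      have "1 < walk_range (\<xi> m) k"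
        using walk_range_exit[OF True] by (simp add: k_def)
      then obtain i j where ij: "i \<le> k" "j \<le> k" "1 < w (\<delta> m * real i) - w (\<delta> m * real j)"
        unfolding walk_gt_iff by blast
      have "rational_exit w \<le> ennreal (\<delta> m * real k)"
        using ij \<delta>_pos[of m] by (intro exit_real_witness_le[OF w _ _ ij(3)]) auto
      then show ?thesis
        using T \<delta>_pos[of m] by (simp add: k_def ennreal_le_iff less_imp_le)
    next
      case False
      then have "walk_exit (n m) (\<xi> m) = n m"
        using walk_exit_le[of "n m" "\<xi> m"] by simp
      with elim show ?thesis by simp
    qed
  qed
  show "\<forall>\<^sub>F m in sequentially. a < \<delta> m * real (walk_exit (n m) (\<xi> m))" if "a < T" for a
    using ge by eventually_elim (use that in linarith)
  show "\<forall>\<^sub>F m in sequentially. \<delta> m * real (walk_exit (n m) (\<xi> m)) < a" if "T < a" for a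
  proof -
    have "rational_exit w < ennreal a"
      using that T by (simp add: ennreal_lessI)
    then obtain t s u where t: "t < a" "s \<in> {0..t}" "u \<in> {0..t}" "1 < w s - w u"
      by (rule rational_exit_less_witness)
    \<comment> \<open>The grid points are the multiples of \<open>\<delta> m\<close> just below
      \<open>s\<close>; rounding down keeps their index within that of \<open>t\<close>.\<close>
    have grid: "(\<lambda>m. w (\<delta> m * real (nat \<lfloor>s / \<delta> m\<rfloor>))) \<longlonglongrightarrow> w s" if s: "0 \<le> s" for s
    proof (rule continuous_on_tendsto_compose[OF w])
      have fl: "\<delta> m * real (nat \<lfloor>s / \<delta> m\<rfloor>) \<le> s \<and> s - \<delta> m \<le> \<delta> m * real (nat \<lfloor>s / \<delta> m\<rfloor>)" for m
      proof -
        have "real (nat \<lfloor>s / \<delta> m\<rfloor>) = of_int \<lfloor>s / \<delta> m\<rfloor>"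
          using s \<delta>_pos[of m] by simp
        moreover have "\<delta> m * of_int \<lfloor>s / \<delta> m\<rfloor> \<le> \<delta> m * (s / \<delta> m)"
          "\<delta> m * (s / \<delta> m - 1) \<le> \<delta> m * of_int \<lfloor>s / \<delta> m\<rfloor>"
          using \<delta>_pos[of m] by (intro mult_left_mono; linarith)+
        moreover have "\<delta> m * (s / \<delta> m) = s" "\<delta> m * (s / \<delta> m - 1) = s - \<delta> m"
          using \<delta>_pos[of m] by (simp_all add: right_diff_distrib)
        ultimately show ?thesis by simp
      qed
      show "(\<lambda>m. \<delta> m * real (nat \<lfloor>s / \<delta> m\<rfloor>)) \<longlonglongrightarrow> s"
      proof (rule tendsto_sandwich)
        show "(\<lambda>m. s - \<delta> m) \<longlonglongrightarrow> s"
          using tendsto_diff[OF tendsto_const \<delta>_lim, of s] by simp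
        show "(\<lambda>m. s) \<longlonglongrightarrow> s" by simp
      qed (use fl in auto)
      show "\<forall>\<^sub>F m in sequentially. \<delta> m * real (nat \<lfloor>s / \<delta> m\<rfloor>) \<in> {0..}"
        using \<delta>_pos by (intro always_eventually) (simp add: less_imp_le)
      show "s \<in> {0..}" using s by simp
    qed
    have "(\<lambda>m. w (\<delta> m * real (nat \<lfloor>s / \<delta> m\<rfloor>)) - w (\<delta> m * real (nat \<lfloor>u / \<delta> m\<rfloor>))) \<longlonglongrightarrow> w s - w u"
      using t by (intro tendsto_diff grid) auto
    from order_tendstoD(1)[OF this t(4)]
      eventually_compose_filterlim[OF eventually_gt_at_top[of t] horizon]
    show ?thesis
    proof eventually_elim
      case (elim m)
      define k where "k = nat \<lfloor>t / \<delta> m\<rfloor>"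
      have k: "real k \<le> t / \<delta> m"
        using t \<delta>_pos[of m] by (simp add: k_def)
      have "1 < walk_range (\<xi> m) k"
        unfolding walk_gt_iff
      proof (intro exI conjI)
        show "1 < w (\<delta> m * real (nat \<lfloor>s / \<delta> m\<rfloor>)) - w (\<delta> m * real (nat \<lfloor>u / \<delta> m\<rfloor>))"
          using elim by simp
      qed (use t \<delta>_pos[of m] in \<open>auto simp: k_def intro!: nat_mono floor_mono divide_right_mono\<close>)
      then have "walk_exit (n m) (\<xi> m) \<le> k"
        using less_walk_exit_iff[of k "n m" "\<xi> m"] by auto
      then have "\<delta> m * real (walk_exit (n m) (\<xi> m)) \<le> \<delta> m * real k"
        using \<delta>_pos[of m] by simp
      also have "\<dots> \<le> t" using k \<delta>_pos[of m] by (simp add: field_simps)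
      also have "t < a" by (rule t)
      finally show ?case .
    qed
  qed
qed

text \<open>The grid exit eventually precedes \<open>T + 1\<close>, and the path is uniformly
  continuous up to that time.\<close>

lemma eventually_small_increments:
  assumes "0 < \<epsilon>"
  shows "\<forall>\<^sub>F m in sequentially. \<forall>k<walk_exit (n m) (\<xi> m). \<bar>\<xi> m k\<bar> < \<epsilon>"
proof -
  have "uniformly_continuous_on {0..T + 1} w"
    by (intro compact_uniformly_continuous continuous_on_subset[OF w]) auto
  then obtain d where d: "0 < d"
    "\<And>x y. x \<in> {0..T + 1} \<Longrightarrow> y \<in> {0..T + 1} \<Longrightarrow> dist y x < d \<Longrightarrow> dist (w y) (w x) < \<epsilon>"
    unfolding uniformly_continuous_on_def using assms by metis
  have "\<forall>\<^sub>F m in sequentially. \<delta> m * real (walk_exit (n m) (\<xi> m)) < T + 1"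
    using tendsto_walk_exit by (rule order_tendstoD) simp
  with order_tendstoD(2)[OF \<delta>_lim d(1)] show ?thesis
  proof eventually_elim
    case (elim m)
    show ?case
    proof (intro allI impI)
      fix k assume "k < walk_exit (n m) (\<xi> m)"
      then have "\<delta> m * real (Suc k) \<le> \<delta> m * real (walk_exit (n m) (\<xi> m))"
        using \<delta>_pos[of m] by (intro mult_left_mono) auto
      with elim have "\<delta> m * real (Suc k) \<le> T + 1" by simp
      moreover have "0 \<le> \<delta> m * real k" "\<delta> m * real k \<le> \<delta> m * real (Suc k)" "\<delta> m * real (Suc k) - \<delta> m * real k = \<delta> m"
        using \<delta>_pos[of m] by (auto simp: algebra_simps)
      ultimately have "dist (w (\<delta> m * real (Suc k))) (w (\<delta> m * real k)) < \<epsilon>"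
        using elim(1) \<delta>_pos[of m] by (intro d(2)) (auto simp: dist_real_def simp del: of_nat_Suc)
      then show "\<bar>\<xi> m k\<bar> < \<epsilon>" unfolding \<xi> dist_real_def .
    qed
  qed
qed

lemma tendsto_sum_max_increment_squares:
  "(\<lambda>m. \<Sum>k<walk_exit (n m) (\<xi> m). (max_increment (\<xi> m) k)\<^sup>2) \<longlonglongrightarrow> 0"
proof (rule order_tendstoI)
  fix a :: real assume "0 < a"
  then have "0 < a / 3" by simp
  from eventually_small_increments[OF this]
  show "\<forall>\<^sub>F m in sequentially. (\<Sum>k<walk_exit (n m) (\<xi> m). (max_increment (\<xi> m) k)\<^sup>2) < a"
  proof eventually_elim
    case (elim m)
    then have "(\<Sum>k<walk_exit (n m) (\<xi> m). (max_increment (\<xi> m) k)\<^sup>2) \<le> 2 * max (a / 3) 0"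
      by (intro sum_max_increment_squares_le) (auto simp: less_imp_le)
    with \<open>0 < a\<close> show ?case by simp
  qed
next
  fix a :: real assume "a < 0"
  then show "\<forall>\<^sub>F m in sequentially. a < (\<Sum>k<walk_exit (n m) (\<xi> m). (max_increment (\<xi> m) k)\<^sup>2)"
    by (intro always_eventually allI less_le_trans[OF _ sum_nonneg]) auto
qed

text \<open>The range increases in the exit step, so one of the two drawdowns is exactly 0 and the
  other equals the range. That range exceeds 1 by at most the size of the last increment.\<close>

lemma tendsto_capped_cosh_exit:
  "(\<lambda>m. capped_cosh \<theta> (drawdown (\<xi> m) (walk_exit (n m) (\<xi> m)))
      + capped_cosh \<theta> (drawdown (\<lambda>i. - \<xi> m i) (walk_exit (n m) (\<xi> m)))) \<longlonglongrightarrow> 1 + cosh \<theta>"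
proof -
  define R where "R m = walk_range (\<xi> m) (walk_exit (n m) (\<xi> m))" for m
  \<comment> \<open>The horizon eventually exceeds \<open>T + 1\<close>, so the walk stops because
    of its range and not because time ran out.\<close>
  have lt: "\<forall>\<^sub>F m in sequentially. walk_exit (n m) (\<xi> m) < n m"
    using order_tendstoD(2)[OF tendsto_walk_exit, of "T + 1"]
      eventually_compose_filterlim[OF eventually_ge_at_top[of "T + 1"] horizon]
  proof (simp, elim eventually_rev_mp, intro always_eventually allI impI)
    fix m assume "\<delta> m * real (walk_exit (n m) (\<xi> m)) < T + 1" "T + 1 \<le> \<delta> m * real (n m)"
    then have "\<delta> m * real (walk_exit (n m) (\<xi> m)) < \<delta> m * real (n m)" by linarith
    then show "walk_exit (n m) (\<xi> m) < n m"
      using \<delta>_pos[of m] by simp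
  qed
  have last: "\<exists>k. walk_exit (n m) (\<xi> m) = Suc k \<and> walk_range (\<xi> m) k \<le> 1 \<and> 1 < walk_range (\<xi> m) (Suc k)"
    if "walk_exit (n m) (\<xi> m) < n m" for m
  proof (cases "walk_exit (n m) (\<xi> m)")
    case 0
    with walk_range_exit[OF that] show ?thesis by (simp add: walk_range_def)
  next
    case (Suc k)
    with walk_range_exit[OF that] less_walk_exit_iff[of k "n m" "\<xi> m"] show ?thesis by auto
  qed
  have "R \<longlonglongrightarrow> 1"
  proof (rule order_tendstoI)
    fix a :: real assume a: "1 < a"
    then have "0 < a - 1" by simp
    from eventually_small_increments[OF this] lt show "\<forall>\<^sub>F m in sequentially. R m < a"
    proof eventually_elim
      case (elim m)
      from last[OF elim(2)] obtain k where k: "walk_exit (n m) (\<xi> m) = Suc k" "walk_range (\<xi> m) k \<le> 1" by blast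
      with elim(1) have "\<bar>\<xi> m k\<bar> < a - 1" by simp
      with k walk_range_Suc_le[of "\<xi> m" k] show ?case by (simp add: R_def)
    qed
  next
    fix a :: real assume a: "a < 1"
    from lt show "\<forall>\<^sub>F m in sequentially. a < R m"
    proof eventually_elim
      case (elim m)
      with walk_range_exit[OF elim] a show ?case by (simp add: R_def)
    qed
  qed
  then have "(\<lambda>m. 1 + capped_cosh \<theta> (R m)) \<longlonglongrightarrow> 1 + capped_cosh \<theta> 1"
    by (intro tendsto_intros continuous_on_tendsto_compose[OF continuous_capped_cosh]) auto
  moreover have "\<forall>\<^sub>F m in sequentially. 1 + capped_cosh \<theta> (R m) =
      capped_cosh \<theta> (drawdown (\<xi> m) (walk_exit (n m) (\<xi> m)))
      + capped_cosh \<theta> (drawdown (\<lambda>i. - \<xi> m i) (walk_exit (n m) (\<xi> m)))"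
    using lt
  proof eventually_elim
    case (elim m)
    from last[OF elim] obtain k where k: "walk_exit (n m) (\<xi> m) = Suc k"
      "walk_range (\<xi> m) k < walk_range (\<xi> m) (Suc k)" by fastforce
    from walk_range_increase[OF k(2)] show ?case
      unfolding R_def k(1) walk_range_def by (auto simp: capped_cosh_def)
  qed
  ultimately show ?thesis
    by (simp add: capped_cosh_def tendsto_cong)
qed

end

section \<open>Transform of the exceedance time\<close>

context standard_brownian_motion
begin

lemma path_measurable: "(\<lambda>\<omega>. \<lambda>t\<in>{0..}. W t \<omega>) \<in> measurable M (\<Pi>\<^sub>M t\<in>{0..}. borel)"
  using measurable_at by (intro measurable_restrict) auto

lemma borel_measurable_exit [measurable]: "(\<lambda>\<omega>. rational_exit (\<lambda>t. W t \<omega>)) \<in> borel_measurable M"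
  using measurable_compose[OF path_measurable borel_measurable_rational_exit]
  by (simp add: rational_exit_restrict)

text \<open>Peak of the normal density times the length 2 of the interval.\<close>

lemma prob_increment_le_1:
  assumes "0 < t"
  shows "prob {\<omega> \<in> space M. \<bar>W t \<omega> - W 0 \<omega>\<bar> \<le> 1} \<le> 2 / sqrt (2 * pi * t)"
proof -
  let ?X = "\<lambda>\<omega>. W t \<omega> - W 0 \<omega>" and ?c = "1 / sqrt (2 * pi * t)"
  have D: "distributed M lborel ?X (normal_density 0 (sqrt (t - 0)))"
    by (rule normal_increments) (use assms in auto)
  have "emeasure M {\<omega> \<in> space M. \<bar>?X \<omega>\<bar> \<le> 1} = emeasure M (?X -` {-1..1} \<inter> space M)"
    by (rule arg_cong[where f="emeasure M"]) auto
  also have "\<dots> = (\<integral>\<^sup>+ x. ennreal (normal_density 0 (sqrt t) x) * indicator {-1..1} x \<partial>lborel)"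
    using distributed_emeasure[OF D, of "{-1..1}"] by simp
  also have "\<dots> \<le> (\<integral>\<^sup>+ x. ennreal ?c * indicator {-1..1::real} x \<partial>lborel)"
  proof (rule nn_integral_mono)
    fix x :: real
    have "normal_density 0 (sqrt t) x = ?c * exp (- x\<^sup>2 / (2 * t))"
      using assms by (simp add: normal_density_def)
    also have "\<dots> \<le> ?c * 1"
      using assms by (intro mult_left_mono) auto
    finally have "normal_density 0 (sqrt t) x \<le> ?c" by simp
    then show "ennreal (normal_density 0 (sqrt t) x) * indicator {-1..1} x \<le> ennreal ?c * indicator {-1..1} x"
      by (simp add: indicator_def ennreal_leI)
  qed
  also have "\<dots> = ennreal ?c * 2"
    by (simp add: nn_integral_cmult_indicator)
  also have "\<dots> = ennreal (2 / sqrt (2 * pi * t))"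
    using assms by (simp add: ennreal_mult[symmetric] flip: ennreal_numeral)
  finally show ?thesis
    using assms by (simp add: emeasure_eq_measure ennreal_le_iff)
qed

text \<open>Without an exit the path stays within 1 of its starting value at every integer time, and
  the probability of this at time \<open>Suc m\<close> tends to 0.\<close>

lemma AE_exit_finite: "AE \<omega> in M. rational_exit (\<lambda>t. W t \<omega>) < \<top>"
proof -
  define A where "A = {\<omega> \<in> space M. rational_exit (\<lambda>t. W t \<omega>) = \<top>}"
  have [measurable]: "A \<in> sets M" unfolding A_def by measurable
  have le: "prob A \<le> 2 / sqrt (2 * pi * real (Suc m))" for m
  proof -
    have [measurable]: "W (real (Suc m)) \<in> borel_measurable M" "W 0 \<in> borel_measurable M"
      by (auto intro: measurable_at)
    have "A \<subseteq> {\<omega> \<in> space M. \<bar>W (real (Suc m)) \<omega> - W 0 \<omega>\<bar> \<le> 1}"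
    proof
      fix \<omega> assume \<omega>: "\<omega> \<in> A"
      have "W s \<omega> - W u \<omega> \<le> 1" if "s \<in> \<rat> \<inter> {0..}" "u \<in> \<rat> \<inter> {0..}" for s u
      proof (rule ccontr)
        assume "\<not> W s \<omega> - W u \<omega> \<le> 1"
        then have "rational_exit (\<lambda>t. W t \<omega>) \<le> ennreal (max s u)"
          unfolding rational_exit_def
          by (intro order_trans[OF INF_lower[OF that(1)] order_trans[OF INF_lower[OF that(2)]]]) simp
        with \<omega> show False by (simp add: A_def top_unique)
      qed
      from this[of "real (Suc m)" 0] this[of 0 "real (Suc m)"] \<omega>
      show "\<omega> \<in> {\<omega> \<in> space M. \<bar>W (real (Suc m)) \<omega> - W 0 \<omega>\<bar> \<le> 1}"
        by (auto simp: A_def abs_le_iff simp del: of_nat_Suc)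
    qed
    then have "prob A \<le> prob {\<omega> \<in> space M. \<bar>W (real (Suc m)) \<omega> - W 0 \<omega>\<bar> \<le> 1}"
      by (intro finite_measure_mono) measurable
    also have "\<dots> \<le> 2 / sqrt (2 * pi * real (Suc m))"
      by (rule prob_increment_le_1) simp
    finally show ?thesis .
  qed
  have "(\<lambda>m. 2 / sqrt (2 * pi * real (Suc m))) \<longlonglongrightarrow> 0"
    by real_asymp
  then have "prob A \<le> 0"
    by (rule LIMSEQ_le_const) (use le in blast)
  then have "prob A = 0"
    using measure_nonneg[of M A] by linarith
  then have "AE \<omega> in M. \<omega> \<notin> A"
    by (intro AE_not_in) (auto simp: null_sets_def emeasure_eq_measure)
  then show ?thesis
    by (rule AE_mp) (auto intro!: AE_I2 simp: A_def top.not_eq_extremum)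
qed

text \<open>The stopped identity is applied to the walk and to its negative, which share the exit;
  the sum of the expectations tends to 2. The product form yields
  \<open>1 + cosh \<theta> \<noteq> 0\<close> as a consequence instead of requiring it.\<close>

proposition exit_transform:
  fixes \<theta> :: complex
  assumes \<theta>: "0 \<le> Re (\<theta>\<^sup>2)"
  shows "expectation (\<lambda>\<omega>. exp (- (\<theta>\<^sup>2 / 2) * of_real (enn2real (rational_exit (\<lambda>t. W t \<omega>)))))
    * (1 + cosh \<theta>) = 2"
proof -
  \<comment> \<open>The horizon \<open>n \<delta>\<close> tends to infinity while the error \<open>n \<delta>\<^sup>2\<close> vanishes.\<close>
  define \<delta> where "\<delta> m = 1 / (real (Suc m))\<^sup>2" for m
  define n where "n m = (Suc m) ^ 3" for m
  define \<xi> where "\<xi> m k \<omega> = W (\<delta> m * real (Suc k)) \<omega> - W (\<delta> m * real k) \<omega>" for m k \<omega>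
  define \<tau> where "\<tau> m \<omega> = walk_exit (n m) (\<lambda>i. \<xi> m i \<omega>)" for m \<omega>
  define e where "e m \<omega> = exp (- (\<theta>\<^sup>2 / 2) * of_real (\<delta> m * \<tau> m \<omega>))" for m \<omega>
  define Y where "Y m \<omega> = e m \<omega> * capped_cosh \<theta> (drawdown (\<lambda>i. \<xi> m i \<omega>) (\<tau> m \<omega>))" for m \<omega>
  define Y' where "Y' m \<omega> = e m \<omega> * capped_cosh \<theta> (drawdown (\<lambda>i. - \<xi> m i \<omega>) (\<tau> m \<omega>))" for m \<omega>
  define S where "S m \<omega> = (\<Sum>k<\<tau> m \<omega>. (max_increment (\<lambda>i. \<xi> m i \<omega>) k)\<^sup>2)" for m \<omega>
  define S' where "S' m \<omega> = (\<Sum>k<\<tau> m \<omega>. (max_increment (\<lambda>i. - \<xi> m i \<omega>) k)\<^sup>2)" for m \<omega>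
  define a where "a = norm \<theta>"
  define T where "T \<omega> = enn2real (rational_exit (\<lambda>t. W t \<omega>))" for \<omega>
  define K where "K = 2 * exp (2 * a) * (48 * exp ((a + 1)\<^sup>2 / 2))"
  have [measurable]: "T \<in> borel_measurable M" unfolding T_def by measurable
  have \<delta>: "0 < \<delta> m" "\<delta> m \<le> 1" for m
    unfolding \<delta>_def by (simp_all add: divide_simps)
  have \<delta>_lim: "\<delta> \<longlonglongrightarrow> 0"
    unfolding \<delta>_def by real_asymp
  have horizon: "filterlim (\<lambda>m. \<delta> m * real (n m)) at_top sequentially"
    unfolding \<delta>_def n_def by real_asymp
  have meas[measurable]: "\<xi> m k \<in> borel_measurable M" for m k
    unfolding \<xi>_def using \<delta>(1)[of m] by (intro borel_measurable_diff measurable_at) (auto simp: less_imp_le)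
  have indep: "indep_vars (\<lambda>_. borel) (\<xi> m) {..<n m}" for m
    using independent_increments[of "\<lambda>k. \<delta> m * real k" "n m"] \<delta>(1)[of m]
    unfolding \<xi>_def by (simp add: algebra_simps)
  have normal: "distributed M lborel (\<xi> m k) (normal_density 0 (sqrt (\<delta> m)))" for m k
  proof -
    have "distributed M lborel (\<xi> m k) (normal_density 0 (sqrt (\<delta> m * real (Suc k) - \<delta> m * real k)))"
      unfolding \<xi>_def using \<delta>(1)[of m] by (intro normal_increments) auto
    moreover have "\<delta> m * real (Suc k) - \<delta> m * real k = \<delta> m" by (simp add: algebra_simps)
    ultimately show ?thesis by simp
  qed
  have indep': "indep_vars (\<lambda>_. borel) (\<lambda>k \<omega>. - \<xi> m k \<omega>) {..<n m}" for m
    by (rule indep_vars_compose2[OF indep]) simp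
  have normal': "distributed M lborel (\<lambda>\<omega>. - \<xi> m k \<omega>) (normal_density 0 (sqrt (\<delta> m)))" for m k
    using normal_density_affine[OF normal, of m "-1" 0 k] \<delta>(1)[of m] by simp
  have ex: "walk_exit (n m) (\<lambda>i. - \<xi> m i \<omega>) = \<tau> m \<omega>" for m \<omega>
    unfolding \<tau>_def by (rule walk_exit_minus)
  note E = borel_measurable_exit_cosh[OF meas indep normal \<delta> \<theta>, folded \<tau>_def, folded e_def, folded Y_def]
    integrable_sum_max_increment_squares[OF meas indep normal \<delta> \<theta>, folded \<tau>_def, folded S_def]
    expectation_exit_cosh[OF meas indep normal \<delta> \<theta>, folded \<tau>_def, folded e_def, folded Y_def S_def a_def]
  have meas': "(\<lambda>\<omega>. - \<xi> m k \<omega>) \<in> borel_measurable M" for m k by measurable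
  note E' = borel_measurable_exit_cosh[OF meas' indep' normal' \<delta> \<theta>, unfolded ex, folded e_def Y'_def]
    integrable_sum_max_increment_squares[OF meas' indep' normal' \<delta> \<theta>, unfolded ex, folded S'_def]
    expectation_exit_cosh[OF meas' indep' normal' \<delta> \<theta>, unfolded ex, folded e_def Y'_def S'_def a_def]
  have [measurable]: "Y m \<in> borel_measurable M" "Y' m \<in> borel_measurable M"
      "S m \<in> borel_measurable M" "S' m \<in> borel_measurable M" for m
    using E(1)[of m] E(2)[of m] E'(1)[of m] E'(2)[of m] by auto
  have e_le: "norm (e m \<omega>) \<le> 1" for m \<omega>
    unfolding e_def using \<theta> \<delta>(1)[of m] by (simp add: mult_nonneg_nonneg less_imp_le del: Re_power2)
  have Y_le: "norm (Y m \<omega>) \<le> exp (2 * a)" "norm (Y' m \<omega>) \<le> exp (2 * a)" for m \<omega>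
    unfolding Y_def Y'_def norm_mult a_def
    using mult_mono[OF e_le norm_capped_cosh_le] by simp_all
  have S_le: "\<bar>S m \<omega>\<bar> \<le> 2" "\<bar>S' m \<omega>\<bar> \<le> 2" for m \<omega>
  proof -
    have sq: "(\<Sum>k<walk_exit N \<eta>. (max_increment \<eta> k)\<^sup>2) \<le> 2" for N \<eta>
    proof -
      have "(\<Sum>k<walk_exit N \<eta>. (max_increment \<eta> k)\<^sup>2) \<le> (\<Sum>k<walk_exit N \<eta>. max_increment \<eta> k)"
        using max_increment_bounds[of \<eta>] by (intro sum_mono) (simp add: power2_eq_square mult_left_le)
      with sum_max_increment_le[of \<eta> N] show ?thesis by linarith
    qed
    have "0 \<le> S m \<omega>" "0 \<le> S' m \<omega>" by (auto simp: S_def S'_def intro: sum_nonneg)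
    moreover have "S m \<omega> \<le> 2" unfolding S_def \<tau>_def by (rule sq)
    moreover have "S' m \<omega> \<le> 2" unfolding S'_def ex[symmetric] by (rule sq)
    ultimately show "\<bar>S m \<omega>\<bar> \<le> 2" "\<bar>S' m \<omega>\<bar> \<le> 2" by auto
  qed
  have paths: "AE \<omega> in M. (\<lambda>m. Y m \<omega> + Y' m \<omega>) \<longlonglongrightarrow> exp (- (\<theta>\<^sup>2 / 2) * of_real (T \<omega>)) * (1 + cosh \<theta>)
      \<and> (\<lambda>m. S m \<omega>) \<longlonglongrightarrow> 0 \<and> (\<lambda>m. S' m \<omega>) \<longlonglongrightarrow> 0"
    using continuous_paths AE_exit_finite
  proof eventually_elim
    case (elim \<omega>)
    have T: "rational_exit (\<lambda>t. W t \<omega>) = ennreal (T \<omega>)" "0 \<le> T \<omega>"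
      using elim(2) by (simp_all add: T_def)
    have elim': "continuous_on {0..} (\<lambda>t. - W t \<omega>)"
      by (intro continuous_on_minus elim)
    \<comment> \<open>Negating the path exchanges the roles of the two witness times.\<close>
    have T': "rational_exit (\<lambda>t. - W t \<omega>) = ennreal (T \<omega>)"
      unfolding T(1)[symmetric] rational_exit_def by (subst INF_commute) (simp add: max.commute)
    have 1: "(\<lambda>m. \<delta> m * real (\<tau> m \<omega>)) \<longlonglongrightarrow> T \<omega>"
      unfolding \<tau>_def by (rule tendsto_walk_exit[OF elim(1) T \<delta>(1) \<delta>_lim horizon]) (simp add: \<xi>_def)
    have 2: "(\<lambda>m. capped_cosh \<theta> (drawdown (\<lambda>i. \<xi> m i \<omega>) (\<tau> m \<omega>))
        + capped_cosh \<theta> (drawdown (\<lambda>i. - \<xi> m i \<omega>) (\<tau> m \<omega>))) \<longlonglongrightarrow> 1 + cosh \<theta>"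
      unfolding \<tau>_def by (rule tendsto_capped_cosh_exit[OF elim(1) T \<delta>(1) \<delta>_lim horizon]) (simp add: \<xi>_def)
    have 3: "(\<lambda>m. S m \<omega>) \<longlonglongrightarrow> 0"
      unfolding \<tau>_def S_def by (rule tendsto_sum_max_increment_squares[OF elim(1) T \<delta>(1) \<delta>_lim horizon]) (simp add: \<xi>_def)
    have 4: "(\<lambda>m. S' m \<omega>) \<longlonglongrightarrow> 0"
      unfolding ex[symmetric] S'_def
      by (rule tendsto_sum_max_increment_squares[OF elim' T' T(2) \<delta>(1) \<delta>_lim horizon]) (simp add: \<xi>_def)
    have "(\<lambda>m. e m \<omega> * (capped_cosh \<theta> (drawdown (\<lambda>i. \<xi> m i \<omega>) (\<tau> m \<omega>))
        + capped_cosh \<theta> (drawdown (\<lambda>i. - \<xi> m i \<omega>) (\<tau> m \<omega>))))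
        \<longlonglongrightarrow> exp (- (\<theta>\<^sup>2 / 2) * of_real (T \<omega>)) * (1 + cosh \<theta>)"
      unfolding e_def by (intro tendsto_intros 1 2)
    then show ?case
      using 3 4 by (simp add: Y_def Y'_def distrib_left)
  qed
  \<comment> \<open>The cap at 2 provides the constant dominating function.\<close>
  have limY: "(\<lambda>m. expectation (\<lambda>\<omega>. Y m \<omega> + Y' m \<omega>))
      \<longlonglongrightarrow> expectation (\<lambda>\<omega>. exp (- (\<theta>\<^sup>2 / 2) * of_real (T \<omega>)) * (1 + cosh \<theta>))"
  proof (rule integral_dominated_convergence[where w="\<lambda>_. 2 * exp (2 * a)"])
    show "AE \<omega> in M. norm (Y m \<omega> + Y' m \<omega>) \<le> 2 * exp (2 * a)" for m
      using norm_triangle_le[OF add_mono[OF Y_le]] by simp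
    show "AE \<omega> in M. (\<lambda>m. Y m \<omega> + Y' m \<omega>) \<longlonglongrightarrow> exp (- (\<theta>\<^sup>2 / 2) * of_real (T \<omega>)) * (1 + cosh \<theta>)"
      using paths by eventually_elim blast
  qed simp_all
  have limS: "(\<lambda>m. expectation (S m)) \<longlonglongrightarrow> expectation (\<lambda>_. 0)"
  proof (rule integral_dominated_convergence[where w="\<lambda>_. 2"])
    show "AE \<omega> in M. (\<lambda>m. S m \<omega>) \<longlonglongrightarrow> 0"
      using paths by eventually_elim blast
  qed (use S_le in simp_all)
  have limS': "(\<lambda>m. expectation (S' m)) \<longlonglongrightarrow> expectation (\<lambda>_. 0)"
  proof (rule integral_dominated_convergence[where w="\<lambda>_. 2"])
    show "AE \<omega> in M. (\<lambda>m. S' m \<omega>) \<longlonglongrightarrow> 0"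
      using paths by eventually_elim blast
  qed (use S_le in simp_all)
  have small: "(\<lambda>m. a\<^sup>2 * exp a * expectation (S m) + a\<^sup>2 * exp a * expectation (S' m)
      + 2 * (real (n m) * (\<delta> m)\<^sup>2 * K)) \<longlonglongrightarrow> a\<^sup>2 * exp a * 0 + a\<^sup>2 * exp a * 0 + 2 * (0 * K)"
  proof (intro tendsto_intros)
    show "(\<lambda>m. real (n m) * (\<delta> m)\<^sup>2) \<longlonglongrightarrow> 0"
      unfolding n_def \<delta>_def by real_asymp
  qed (use limS limS' in simp_all)
  have [simp]: "integrable M (Y m)" "integrable M (Y' m)" for m
    using Y_le by (auto intro!: integrable_const_bound[of _ "exp (2 * a)"])
  have "norm (expectation (\<lambda>\<omega>. Y m \<omega> + Y' m \<omega>) - 2)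
      \<le> a\<^sup>2 * exp a * expectation (S m) + a\<^sup>2 * exp a * expectation (S' m)
      + 2 * (real (n m) * (\<delta> m)\<^sup>2 * K)" for m
  proof -
    have "expectation (\<lambda>\<omega>. Y m \<omega> + Y' m \<omega>) - 2 = (expectation (Y m) - 1) + (expectation (Y' m) - 1)"
      by simp
    also have "norm \<dots> \<le> norm (expectation (Y m) - 1) + norm (expectation (Y' m) - 1)"
      by (rule norm_triangle_ineq)
    finally show ?thesis
      using E(3)[of m] E'(3)[of m] by (simp add: K_def algebra_simps)
  qed
  then have "(\<lambda>m. expectation (\<lambda>\<omega>. Y m \<omega> + Y' m \<omega>) - 2) \<longlonglongrightarrow> 0"
    by (intro Lim_null_comparison[OF _ small[simplified]] always_eventually) simp
  then have "(\<lambda>m. expectation (\<lambda>\<omega>. Y m \<omega> + Y' m \<omega>)) \<longlonglongrightarrow> 2"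
    by (simp add: LIM_zero_iff)
  from LIMSEQ_unique[OF limY this] show ?thesis
    by (simp add: T_def)
qed

end

section \<open>Absolute values from characteristic functions\<close>

text \<open>With s = t^2 this is half the integral of (1 - cos (s x)) / s^2; integration by parts
  leads to the sine integral with limit pi / 2. The integrand is nonnegative for t > 0, so the
  fundamental theorem also yields integrability.\<close>

lemma integral_one_minus_cos_square_over_cube:
  fixes x :: real
  shows "set_integrable lborel {0<..} (\<lambda>t. (1 - cos (t\<^sup>2 * x)) / t ^ 3)" (is ?A)
    and "(LBINT t:{0<..}. (1 - cos (t\<^sup>2 * x)) / t ^ 3) = pi / 4 * \<bar>x\<bar>" (is ?B)
proof -
  have pos: "set_integrable lborel {0<..} (\<lambda>t. (1 - cos (t\<^sup>2 * x)) / t ^ 3) \<and>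
      (LBINT t:{0<..}. (1 - cos (t\<^sup>2 * x)) / t ^ 3) = pi / 4 * x" if x: "0 < x" for x :: real
  proof -
    define F where "F t = (x * Si (t\<^sup>2 * x) - (1 - cos (t\<^sup>2 * x)) / t\<^sup>2) / 2" for t :: real
    have ei: "einterval 0 \<infinity> = {0::real<..}" by (auto simp: einterval_def)
    have deriv: "DERIV F t :> (1 - cos (t\<^sup>2 * x)) / t ^ 3" if "0 < t" for t
    proof -
      have "DERIV F t :> (x * (sinc (t\<^sup>2 * x) * (2 * t * x)) -
          ((sin (t\<^sup>2 * x) * (2 * t * x)) * t\<^sup>2 - (1 - cos (t\<^sup>2 * x)) * (2 * t)) / (t\<^sup>2 * t\<^sup>2)) / 2"
        unfolding F_def using that
        by (auto intro!: derivative_eq_intros DERIV_chain2[OF DERIV_Si] simp: power2_eq_square)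
      moreover have "sinc (t\<^sup>2 * x) = sin (t\<^sup>2 * x) / (t\<^sup>2 * x)"
        using that x by simp
      moreover have "(x * (sn / (t\<^sup>2 * x) * (2 * t * x)) -
          ((sn * (2 * t * x)) * t\<^sup>2 - (1 - cs) * (2 * t)) / (t\<^sup>2 * t\<^sup>2)) / 2 = (1 - cs) / t ^ 3" for sn cs
        using that x by (simp add: divide_simps) (simp add: algebra_simps eval_nat_numeral)
      ultimately show ?thesis by (simp only:)
    qed
    have "((\<lambda>t. (1 - cos (t\<^sup>2 * x)) / t\<^sup>2) \<longlongrightarrow> 0) (at_right 0)"
      by real_asymp
    moreover have "isCont (\<lambda>t. Si (t\<^sup>2 * x)) 0"
      by (intro isCont_o2[OF _ isCont_Si] continuous_intros)
    then have "((\<lambda>t. Si (t\<^sup>2 * x)) \<longlongrightarrow> Si (0\<^sup>2 * x)) (at_right 0)"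
      using continuous_at_imp_continuous_at_within unfolding continuous_within by blast
    moreover have Si0: "Si 0 = 0" by (simp add: Si_def zero_ereal_def)
    ultimately have "(F \<longlongrightarrow> (x * Si (0\<^sup>2 * x) - 0) / 2) (at_right 0)"
      unfolding F_def by (intro tendsto_intros) auto
    with Si0 have F0: "(F \<longlongrightarrow> 0) (at_right 0)" by simp
    have "filterlim (\<lambda>t. t\<^sup>2 * x) at_top at_top"
      using x by real_asymp
    then have "((\<lambda>t. Si (t\<^sup>2 * x)) \<longlongrightarrow> pi / 2) at_top"
      by (rule filterlim_compose[OF Si_at_top])
    moreover have "((\<lambda>t. (1 - cos (t\<^sup>2 * x)) / t\<^sup>2) \<longlongrightarrow> 0) at_top"
    proof (rule Lim_null_comparison)
      show "\<forall>\<^sub>F t in at_top. norm ((1 - cos (t\<^sup>2 * x)) / t\<^sup>2) \<le> 2 / t\<^sup>2"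
      proof (intro always_eventually allI)
        fix t
        have "\<bar>1 - cos (t\<^sup>2 * x)\<bar> \<le> 2"
          using cos_ge_minus_one[of "t\<^sup>2 * x"] cos_le_one[of "t\<^sup>2 * x"] by linarith
        then show "norm ((1 - cos (t\<^sup>2 * x)) / t\<^sup>2) \<le> 2 / t\<^sup>2"
          by (simp add: abs_divide divide_right_mono)
      qed
      show "((\<lambda>t::real. 2 / t\<^sup>2) \<longlongrightarrow> 0) at_top" by real_asymp
    qed
    ultimately have FT: "(F \<longlongrightarrow> (x * (pi / 2) - 0) / 2) at_top"
      unfolding F_def by (intro tendsto_intros) auto
    have A: "((F \<circ> real_of_ereal) \<longlongrightarrow> 0) (at_right 0)"
      unfolding zero_ereal_def using F0 by (subst ereal_tendsto_simps) 
    have B: "((F \<circ> real_of_ereal) \<longlongrightarrow> (x * (pi / 2) - 0) / 2) (at_left \<infinity>)"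
      using FT by (subst ereal_tendsto_simps)
    note R = interval_integral_FTC_nonneg[of 0 \<infinity> F "\<lambda>t. (1 - cos (t\<^sup>2 * x)) / t ^ 3", OF _ _ _ _ A B]
    have "set_integrable lborel (einterval 0 \<infinity>) (\<lambda>t. (1 - cos (t\<^sup>2 * x)) / t ^ 3)"
      by (rule R(1)) (auto intro!: deriv AE_I2 continuous_intros)
    moreover have "(LBINT t=0..\<infinity>. (1 - cos (t\<^sup>2 * x)) / t ^ 3) = (x * (pi / 2) - 0) / 2 - 0"
      by (rule R(2)) (auto intro!: deriv AE_I2 continuous_intros)
    ultimately show ?thesis
      unfolding ei interval_lebesgue_integral_def by simp
  qed
  have cos: "cos (t\<^sup>2 * x) = cos (t\<^sup>2 * \<bar>x\<bar>)" for t
    by (cases "0 \<le> x") simp_all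
  show ?A ?B
    unfolding cos using pos[of "\<bar>x\<bar>"]
    by (cases "x = 0"; simp add: set_integrable_def set_lebesgue_integral_def)+
qed

text \<open>Fubini with the previous kernel. The signed weight and the sigma-finite measure allow
  two uses: weight 1 on the probability space for the main formula, and a pole density on its
  product with the line for the numerical series. The third bound later justifies termwise
  integration.\<close>

lemma integral_characteristic_deficit:
  fixes Q :: "'b measure" and c X :: "'b \<Rightarrow> real"
  assumes "sigma_finite_measure Q"
    and [measurable]: "c \<in> borel_measurable Q" "X \<in> borel_measurable Q"
    and int: "integrable Q (\<lambda>\<omega>. c \<omega> * \<bar>X \<omega>\<bar>)"
  defines "h \<equiv> \<lambda>t. (\<integral>\<omega>. c \<omega> * (1 - cos (t\<^sup>2 * X \<omega>)) \<partial>Q) / t ^ 3"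
  shows "set_integrable lborel {0<..} h" (is ?A)
    and "(LBINT t:{0<..}. h t) = pi / 4 * (\<integral>\<omega>. c \<omega> * \<bar>X \<omega>\<bar> \<partial>Q)" (is ?B)
    and "(LBINT t:{0<..}. \<bar>h t\<bar>) \<le> pi / 4 * (\<integral>\<omega>. \<bar>c \<omega>\<bar> * \<bar>X \<omega>\<bar> \<partial>Q)" (is ?C)
proof -
  interpret Q: sigma_finite_measure Q by fact
  interpret P: pair_sigma_finite Q lborel ..
  define g where "g \<omega> t = indicator {0<..} t * (c \<omega> * ((1 - cos (t\<^sup>2 * X \<omega>)) / t ^ 3))" for \<omega> and t :: real
  have k: "integrable lborel (\<lambda>t. indicator {0<..} t * ((1 - cos (t\<^sup>2 * x)) / t ^ 3))"
    "(\<integral>t. indicator {0<..} t * ((1 - cos (t\<^sup>2 * x)) / t ^ 3) \<partial>lborel) = pi / 4 * \<bar>x\<bar>" for x :: real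
    using integral_one_minus_cos_square_over_cube[of x]
    by (simp_all add: set_integrable_def set_lebesgue_integral_def)
  have g_eq: "g \<omega> = (\<lambda>t. c \<omega> * (indicator {0<..} t * ((1 - cos (t\<^sup>2 * X \<omega>)) / t ^ 3)))" for \<omega>
    by (auto simp: g_def)
  have norm_g: "\<bar>g \<omega> t\<bar> = \<bar>c \<omega>\<bar> * (indicator {0<..} t * ((1 - cos (t\<^sup>2 * X \<omega>)) / t ^ 3))" for \<omega> t
    unfolding g_eq by (auto simp: abs_mult indicator_def)
  have int_g: "integrable lborel (g \<omega>)" for \<omega>
    unfolding g_eq using k(1) by (rule integrable_mult_right)
  have I: "integrable (Q \<Otimes>\<^sub>M lborel) (\<lambda>(\<omega>, t). g \<omega> t)"
  proof (rule P.Fubini_integrable)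
    show "(\<lambda>(\<omega>, t). g \<omega> t) \<in> borel_measurable (Q \<Otimes>\<^sub>M lborel)"
      unfolding g_def by measurable
    have "(\<integral>t. \<bar>g \<omega> t\<bar> \<partial>lborel) = pi / 4 * norm (c \<omega> * \<bar>X \<omega>\<bar>)" for \<omega>
      by (simp only: norm_g integral_mult_right_zero k) (simp add: abs_mult)
    then have "(\<lambda>\<omega>. \<integral>t. norm (case (\<omega>, t) of (\<omega>, t) \<Rightarrow> g \<omega> t) \<partial>lborel) = (\<lambda>\<omega>. pi / 4 * norm (c \<omega> * \<bar>X \<omega>\<bar>))"
      unfolding split real_norm_def by (intro ext)
    then show "integrable Q (\<lambda>\<omega>. \<integral>t. norm (case (\<omega>, t) of (\<omega>, t) \<Rightarrow> g \<omega> t) \<partial>lborel)"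
      using int by simp
  qed (use int_g in simp)
  have gh: "(\<integral>\<omega>. g \<omega> t \<partial>Q) = indicator {0<..} t * h t" for t
  proof -
    have "g \<omega> t = (indicator {0<..} t / t ^ 3) * (c \<omega> * (1 - cos (t\<^sup>2 * X \<omega>)))" for \<omega>
      by (simp add: g_def)
    then show ?thesis by (simp add: h_def)
  qed
  show ?A
    using P.integrable_snd[OF I] by (simp add: gh set_integrable_def)
  have "(LBINT t:{0<..}. h t) = (\<integral>t. (\<integral>\<omega>. g \<omega> t \<partial>Q) \<partial>lborel)"
    by (simp add: gh set_lebesgue_integral_def)
  also have "\<dots> = (\<integral>\<omega>. (\<integral>t. g \<omega> t \<partial>lborel) \<partial>Q)"
    by (rule P.Fubini_integral[OF I])
  also have "\<dots> = (\<integral>\<omega>. pi / 4 * (c \<omega> * \<bar>X \<omega>\<bar>) \<partial>Q)"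
    unfolding g_eq by (simp only: integral_mult_right_zero k) (simp add: mult_ac)
  finally show ?B by simp
  have I': "integrable (Q \<Otimes>\<^sub>M lborel) (\<lambda>(\<omega>, t). \<bar>g \<omega> t\<bar>)"
    using integrable_norm[OF I] by (simp add: case_prod_unfold)
  have "(LBINT t:{0<..}. \<bar>h t\<bar>) = (\<integral>t. \<bar>\<integral>\<omega>. g \<omega> t \<partial>Q\<bar> \<partial>lborel)"
    by (simp add: gh set_lebesgue_integral_def abs_mult)
  also have "\<dots> \<le> (\<integral>t. (\<integral>\<omega>. \<bar>g \<omega> t\<bar> \<partial>Q) \<partial>lborel)"
  proof (rule integral_mono)
    show "integrable lborel (\<lambda>t. \<bar>\<integral>\<omega>. g \<omega> t \<partial>Q\<bar>)"
      using P.integrable_snd[OF I] by simp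
    show "integrable lborel (\<lambda>t. \<integral>\<omega>. \<bar>g \<omega> t\<bar> \<partial>Q)"
      using P.integrable_snd[OF I'] by simp
  qed (rule integral_abs_bound)
  also have "\<dots> = (\<integral>\<omega>. (\<integral>t. \<bar>g \<omega> t\<bar> \<partial>lborel) \<partial>Q)"
    by (rule P.Fubini_integral[OF I'])
  also have "\<dots> = pi / 4 * (\<integral>\<omega>. \<bar>c \<omega>\<bar> * \<bar>X \<omega>\<bar> \<partial>Q)"
    by (simp only: norm_g integral_mult_right_zero k) (simp add: mult_ac)
  finally show ?C .
qed

section \<open>Laplace transform and mean of the exceedance time\<close>

context standard_brownian_motion
begin

text \<open>The value is 0 where there is no exit, which happens only on a null set by
  \<open>AE_exit_finite\<close>.\<close>

definition exit :: "'a \<Rightarrow> real" where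
  "exit \<omega> = enn2real (rational_exit (\<lambda>t. W t \<omega>))"

lemma exit_measurable [measurable]: "exit \<in> borel_measurable M"
  unfolding exit_def by measurable

lemma exit_nonneg [simp]: "0 \<le> exit \<omega>"
  by (simp add: exit_def)

lemma AE_exceedance_time_eq: "AE \<omega> in M. exceedance_time (range_process W) \<omega> = ennreal (exit \<omega>)"
  using continuous_paths AE_exit_finite
  by eventually_elim (simp add: exceedance_time_eq_rational_exit exit_def)

lemma exit_laplace:
  assumes "0 \<le> \<mu>"
  shows "integrable M (\<lambda>\<omega>. exp (- \<mu> * exit \<omega>))"
    and "expectation (\<lambda>\<omega>. exp (- \<mu> * exit \<omega>)) = 2 / (1 + cosh (sqrt (2 * \<mu>)))"
proof -
  show "integrable M (\<lambda>\<omega>. exp (- \<mu> * exit \<omega>))"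
    by (rule integrable_const_bound[of _ 1]) (use assms in \<open>auto intro!: AE_I2\<close>)
  define s where "s = sqrt (2 * \<mu>)"
  have s: "s\<^sup>2 = 2 * \<mu>" using assms by (simp add: s_def)
  have "expectation (\<lambda>\<omega>. exp (- ((of_real s)\<^sup>2 / 2) * of_real (exit \<omega>))) * (1 + cosh (of_real s :: complex)) = 2"
    using exit_transform[of "of_real s"] by (simp add: exit_def)
  also have "(\<lambda>\<omega>. exp (- ((of_real s)\<^sup>2 / 2) * of_real (exit \<omega>))) = (\<lambda>\<omega>. complex_of_real (exp (- \<mu> * exit \<omega>)))"
    unfolding of_real_power[symmetric] s by (simp add: exp_of_real[symmetric])
  also have "cosh (of_real s :: complex) = of_real (cosh s)"
    by (simp add: cosh_def exp_of_real[symmetric] scaleR_conv_of_real)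
  finally have "complex_of_real (expectation (\<lambda>\<omega>. exp (- \<mu> * exit \<omega>)) * (1 + cosh s)) = of_real 2"
    by simp
  then have "expectation (\<lambda>\<omega>. exp (- \<mu> * exit \<omega>)) * (1 + cosh s) = 2"
    unfolding of_real_eq_iff .
  moreover have "1 + cosh s \<noteq> 0"
    using cosh_real_pos[of s] by linarith
  ultimately show "expectation (\<lambda>\<omega>. exp (- \<mu> * exit \<omega>)) = 2 / (1 + cosh (sqrt (2 * \<mu>)))"
    by (simp add: s_def field_simps)
qed

text \<open>For \<theta> = (1 + \<i>) s the square 2 \<i> s^2 has real part 0, just inside the range
  of \<open>exit_transform\<close>.\<close>

lemma exit_characteristic:
  "expectation (\<lambda>\<omega>. exp (- \<i> * of_real (s\<^sup>2 * exit \<omega>))) * (1 + cosh ((1 + \<i>) * of_real s)) = 2"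
proof -
  have sq: "((1 + \<i>) * of_real s)\<^sup>2 = 2 * \<i> * of_real (s\<^sup>2)"
    by (simp add: power2_eq_square algebra_simps)
  have "expectation (\<lambda>\<omega>. exp (- (((1 + \<i>) * of_real s)\<^sup>2 / 2) * of_real (exit \<omega>)))
      * (1 + cosh ((1 + \<i>) * of_real s)) = 2"
    unfolding exit_def by (rule exit_transform) (simp add: sq)
  then show ?thesis
    unfolding sq by (simp add: mult.assoc)
qed

text \<open>The approximations 2^n (1 - exp (- x / 2^n)) increase to x, and their expectations are
  known from the Laplace transform; monotone convergence gives integrability and mean at
  once.\<close>

lemma exit_integrable: "integrable M exit"
  and expectation_exit: "expectation exit = 1 / 2"
proof -
  define g where "g n \<omega> = 2 ^ n * (1 - exp (- (1 / 2 ^ n) * exit \<omega>))" for n :: nat and \<omega>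
  have int: "integrable M (g n)" for n
    unfolding g_def
    by (intro integrable_mult_right Bochner_Integration.integrable_diff exit_laplace(1)) auto
  \<comment> \<open>Halving the exponent replaces \<open>1 - q * q\<close> by
    \<open>2 * (1 - q)\<close>; the difference is a square. This is why the parameters are
    dyadic.\<close>
  have mono: "mono (\<lambda>n. g n \<omega>)" for \<omega>
  proof (rule incseq_SucI)
    fix n
    define q where "q = exp (- (1 / 2 ^ Suc n) * exit \<omega>)"
    have "exp (- (1 / 2 ^ n) * exit \<omega>) = q * q"
      by (simp add: q_def mult_exp_exp)
    moreover have "0 \<le> (1 - q)\<^sup>2" by simp
    then have "2 ^ n * (1 - q * q) \<le> 2 ^ n * (2 * (1 - q))"
      by (intro mult_left_mono) (auto simp: power2_eq_square algebra_simps)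
    ultimately show "g n \<omega> \<le> g (Suc n) \<omega>"
      unfolding g_def q_def[symmetric] by simp
  qed
  have lim: "(\<lambda>n. g n \<omega>) \<longlonglongrightarrow> exit \<omega>" for \<omega>
  proof -
    have "((\<lambda>x::real. x * (1 - exp (- (1 / x) * exit \<omega>))) \<longlongrightarrow> exit \<omega>) at_top"
    proof (cases "exit \<omega> = 0")
      case False
      define c where "c = exit \<omega>"
      have "0 < c" using False by (simp add: c_def order.not_eq_order_implies_strict)
      then show ?thesis unfolding c_def[symmetric] by real_asymp
    qed simp
    moreover have "filterlim (\<lambda>n::nat. 2 ^ n :: real) at_top sequentially"
      by real_asymp
    ultimately show ?thesis
      unfolding g_def by (rule filterlim_compose)
  qed
  \<comment> \<open>Here s^2 = 2 / 2^n, so the prefactor 2 / s^2 is 2^n, while 1 - 2 / (1 + cosh s)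
    behaves like s^2 / 4.\<close>
  have "((\<lambda>s::real. 2 / s\<^sup>2 * (1 - 2 / (1 + cosh s))) \<longlongrightarrow> 1 / 2) (at_right 0)"
    unfolding cosh_field_def by real_asymp
  moreover have "filterlim (\<lambda>n::nat. sqrt (2 * (1 / 2 ^ n))) (at_right 0) sequentially"
  proof -
    have "(\<lambda>n::nat. 2 * (1 / 2 ^ n) :: real) \<longlonglongrightarrow> 0" by real_asymp
    from tendsto_real_sqrt[OF this] show ?thesis
      by (simp add: filterlim_at)
  qed
  ultimately have "(\<lambda>n::nat. 2 / (sqrt (2 * (1 / 2 ^ n)))\<^sup>2 * (1 - 2 / (1 + cosh (sqrt (2 * (1 / 2 ^ n)))))) \<longlonglongrightarrow> (1 / 2 :: real)"
    by (rule filterlim_compose)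
  then have "(\<lambda>n::nat. 2 ^ n * (1 - 2 / (1 + cosh (sqrt (2 * (1 / 2 ^ n)))))) \<longlonglongrightarrow> (1 / 2 :: real)"
    by simp
  moreover have "expectation (g n) = 2 ^ n * (1 - 2 / (1 + cosh (sqrt (2 * (1 / 2 ^ n)))))" for n
    unfolding g_def using exit_laplace[of "1 / 2 ^ n"] by (simp add: prob_space)
  ultimately have limE: "(\<lambda>n. expectation (g n)) \<longlonglongrightarrow> 1 / 2" by simp
  show "integrable M exit"
    by (rule integrable_monotone_convergence[OF int AE_I2 AE_I2 limE]) (use mono lim in auto)
  show "expectation exit = 1 / 2"
    by (rule integral_monotone_convergence[OF int AE_I2 AE_I2 limE]) (use mono lim in auto)
qed

text \<open>Differentiation of the Laplace transform under the expectation, the difference quotients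
  being dominated by \<open>exit\<close>. The double poles of the expansion create the factor
  \<open>exit \<omega>\<close>.\<close>

lemma exit_laplace_deriv:
  assumes \<mu>: "0 < \<mu>"
  defines "s \<equiv> sqrt (2 * \<mu>)"
  shows "integrable M (\<lambda>\<omega>. exit \<omega> * exp (- \<mu> * exit \<omega>))"
    and "expectation (\<lambda>\<omega>. exit \<omega> * exp (- \<mu> * exit \<omega>)) = 2 * sinh s / (s * (1 + cosh s)\<^sup>2)"
proof -
  show "integrable M (\<lambda>\<omega>. exit \<omega> * exp (- \<mu> * exit \<omega>))"
    by (rule Bochner_Integration.integrable_bound[OF exit_integrable])
      (use \<mu> in \<open>auto intro!: AE_I2 mult_left_le\<close>)
  define \<phi> where "\<phi> x = 2 / (1 + cosh (sqrt (2 * x)))" for x :: real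
  define g where "g n \<omega> = (exp (- \<mu> * exit \<omega>) - exp (- (\<mu> + inverse (real (Suc n))) * exit \<omega>)) / inverse (real (Suc n))" for n \<omega>
  have limg: "(\<lambda>n. g n \<omega>) \<longlonglongrightarrow> exit \<omega> * exp (- \<mu> * exit \<omega>)" for \<omega>
  proof -
    have "((\<lambda>x. exp (- x * exit \<omega>)) has_real_derivative - exit \<omega> * exp (- \<mu> * exit \<omega>)) (at \<mu>)"
      by (auto intro!: derivative_eq_intros)
    then have "((\<lambda>h. (exp (- (\<mu> + h) * exit \<omega>) - exp (- \<mu> * exit \<omega>)) / h) \<longlongrightarrow> - exit \<omega> * exp (- \<mu> * exit \<omega>)) (at 0)"
      unfolding DERIV_def .
    moreover have "filterlim (\<lambda>n. inverse (real (Suc n))) (at 0) sequentially"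
      using LIMSEQ_inverse_real_of_nat by (simp add: filterlim_at)
    ultimately have "(\<lambda>n. (exp (- (\<mu> + inverse (real (Suc n))) * exit \<omega>) - exp (- \<mu> * exit \<omega>)) / inverse (real (Suc n)))
        \<longlonglongrightarrow> - exit \<omega> * exp (- \<mu> * exit \<omega>)"
      by (rule filterlim_compose)
    from tendsto_minus[OF this] show ?thesis
      by (simp add: g_def minus_divide_left)
  qed
  have g_le: "norm (g n \<omega>) \<le> exit \<omega>" for n \<omega>
  proof -
    define h where "h = inverse (real (Suc n))"
    have h: "0 < h" by (simp add: h_def)
    have e: "exp (- (\<mu> + h) * exit \<omega>) = exp (- \<mu> * exit \<omega>) * exp (- h * exit \<omega>)"
      by (simp add: mult_exp_exp algebra_simps)
    have geq: "g n \<omega> = exp (- \<mu> * exit \<omega>) * ((1 - exp (- h * exit \<omega>)) / h)"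
      unfolding g_def h_def[symmetric] e by (simp add: right_diff_distrib)
    moreover have "exp (- \<mu> * exit \<omega>) \<le> 1" using \<mu> by simp
    moreover have "(1 - exp (- h * exit \<omega>)) / h \<le> exit \<omega>"
      using h exp_ge_add_one_self[of "- h * exit \<omega>"] by (simp add: field_simps)
    moreover have nn: "0 \<le> (1 - exp (- h * exit \<omega>)) / h"
      using h by simp
    ultimately have "exp (- \<mu> * exit \<omega>) * ((1 - exp (- h * exit \<omega>)) / h) \<le> 1 * exit \<omega>"
      by (intro mult_mono) auto
    with nn show ?thesis
      unfolding geq real_norm_def by (subst abs_of_nonneg) (auto intro: mult_nonneg_nonneg simp del: times_divide_eq_right)
  qed
  have [measurable]: "g n \<in> borel_measurable M" for n
    unfolding g_def by measurable
  have 1: "(\<lambda>n. expectation (g n)) \<longlonglongrightarrow> expectation (\<lambda>\<omega>. exit \<omega> * exp (- \<mu> * exit \<omega>))"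
  proof (rule integral_dominated_convergence[where w=exit])
    show "AE \<omega> in M. (\<lambda>n. g n \<omega>) \<longlonglongrightarrow> exit \<omega> * exp (- \<mu> * exit \<omega>)"
      by (rule AE_I2) (rule limg)
    show "AE \<omega> in M. norm (g n \<omega>) \<le> exit \<omega>" for n
      by (rule AE_I2) (rule g_le)
  qed (use exit_integrable in simp_all)
  have Eg: "expectation (g n) = - ((\<phi> (\<mu> + inverse (real (Suc n))) - \<phi> \<mu>) / inverse (real (Suc n)))" for n
  proof -
    have "0 \<le> \<mu> + inverse (real (Suc n))" using \<mu> by simp
    then show ?thesis
      unfolding g_def \<phi>_def
      using exit_laplace[of \<mu>] exit_laplace[of "\<mu> + inverse (real (Suc n))"] \<mu>
      by (simp add: minus_divide_left del: of_nat_Suc)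
  qed
  have c: "1 + cosh s \<noteq> 0" using cosh_real_pos[of s] by linarith
  have "((\<lambda>x. sqrt (2 * x)) has_real_derivative (inverse (sqrt (2 * \<mu>)) / 2) * 2) (at \<mu>)"
    by (rule DERIV_chain2[OF DERIV_real_sqrt]) (use \<mu> in \<open>auto intro!: derivative_eq_intros\<close>)
  then have d1: "((\<lambda>x. sqrt (2 * x)) has_real_derivative 1 / s) (at \<mu>)"
    by (simp add: s_def inverse_eq_divide)
  have "((\<lambda>t. 2 / (1 + cosh t)) has_real_derivative - (2 * sinh s) / (1 + cosh s)\<^sup>2) (at s)"
    using c by (auto intro!: derivative_eq_intros simp: power2_eq_square)
  then have "(\<phi> has_real_derivative (- (2 * sinh s) / (1 + cosh s)\<^sup>2) * (1 / s)) (at \<mu>)"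
    unfolding \<phi>_def s_def by (rule DERIV_chain2) (rule d1[unfolded s_def])
  then have "(\<phi> has_real_derivative - (2 * (sinh s * (1 / s))) / (1 + cosh s)\<^sup>2) (at \<mu>)"
    by (simp add: mult_ac)
  then have "((\<lambda>h. (\<phi> (\<mu> + h) - \<phi> \<mu>) / h) \<longlongrightarrow> - (2 * (sinh s * (1 / s))) / (1 + cosh s)\<^sup>2) (at 0)"
    by (simp add: DERIV_def)
  moreover have "filterlim (\<lambda>n. inverse (real (Suc n))) (at 0) sequentially"
    using LIMSEQ_inverse_real_of_nat by (simp add: filterlim_at)
  ultimately have "(\<lambda>n. (\<phi> (\<mu> + inverse (real (Suc n))) - \<phi> \<mu>) / inverse (real (Suc n)))
      \<longlonglongrightarrow> - (2 * (sinh s * (1 / s))) / (1 + cosh s)\<^sup>2"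
    by (rule filterlim_compose)
  from tendsto_minus[OF this] have "(\<lambda>n. expectation (g n)) \<longlonglongrightarrow> 2 * (sinh s * (1 / s)) / (1 + cosh s)\<^sup>2"
    unfolding Eg by simp
  from LIMSEQ_unique[OF 1 this]
  show "expectation (\<lambda>\<omega>. exit \<omega> * exp (- \<mu> * exit \<omega>)) = 2 * sinh s / (s * (1 + cosh s)\<^sup>2)"
    by simp
qed

end

section \<open>Partial fractions of the squared hyperbolic secant\<close>

text \<open>Logarithmic derivative of Euler's reflection formula for Gamma z Gamma (1 - z).\<close>

lemma Digamma_reflection:
  fixes z :: complex
  assumes z: "z \<notin> \<int>"
  shows "Digamma z - Digamma (1 - z) = - (of_real pi * cos (of_real pi * z) / sin (of_real pi * z))"
proof -
  have nz: "z \<notin> \<int>\<^sub>\<le>\<^sub>0" "1 - z \<notin> \<int>\<^sub>\<le>\<^sub>0"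
    using z nonpos_Ints_Int[of z] nonpos_Ints_Int[of "1 - z"] Ints_diff[of 1 "1 - z"] by auto
  have s: "sin (of_real pi * z) \<noteq> 0"
    using z by (simp add: sin_eq_0) (metis Ints_of_int)
  have "((\<lambda>z. Gamma z * Gamma (1 - z)) has_field_derivative
      Gamma z * Gamma (1 - z) * (Digamma z - Digamma (1 - z))) (at z)"
    using nz by (auto intro!: derivative_eq_intros simp: algebra_simps)
  moreover have "((\<lambda>z. of_real pi / sin (of_real pi * z)) has_field_derivative
      - (of_real pi * (of_real pi * cos (of_real pi * z))) / (sin (of_real pi * z))\<^sup>2) (at z)"
    using s by (auto intro!: derivative_eq_intros simp: power2_eq_square algebra_simps)
  ultimately have "Gamma z * Gamma (1 - z) * (Digamma z - Digamma (1 - z))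
      = - (of_real pi * (of_real pi * cos (of_real pi * z))) / (sin (of_real pi * z))\<^sup>2"
    unfolding Gamma_reflection_complex by (rule DERIV_unique)
  then have A: "(of_real pi / sn) * D = - (of_real pi * (of_real pi * cs)) / sn\<^sup>2"
    if "sn = sin (of_real pi * z)" "cs = cos (of_real pi * z)" "D = Digamma z - Digamma (1 - z)" for sn cs D
    unfolding Gamma_reflection_complex that .
  have B: "D = - (P * cs / sn)" if "(P / sn) * D = - (P * (P * cs)) / sn\<^sup>2" "P \<noteq> 0" "sn \<noteq> 0"
    for P sn cs D :: complex
  proof -
    have "D = (sn / P) * ((P / sn) * D)" using that(2,3) by simp
    also have "\<dots> = - (P * cs / sn)" unfolding that(1) using that(2,3) by (simp add: power2_eq_square)
    finally show ?thesis .
  qed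
  show ?thesis
    by (rule B[OF A[OF refl refl refl] _ s]) simp
qed

lemma Trigamma_reflection:
  fixes z :: complex
  assumes z: "z \<notin> \<int>"
  shows "Polygamma 1 z + Polygamma 1 (1 - z) = (of_real pi / sin (of_real pi * z))\<^sup>2"
proof -
  have nz: "z \<notin> \<int>\<^sub>\<le>\<^sub>0" "1 - z \<notin> \<int>\<^sub>\<le>\<^sub>0"
    using z nonpos_Ints_Int[of z] nonpos_Ints_Int[of "1 - z"] Ints_diff[of 1 "1 - z"] by auto
  have s: "sin (of_real pi * z) \<noteq> 0"
    using z by (simp add: sin_eq_0) (metis Ints_of_int)
  let ?c = "\<lambda>z. - (of_real pi * cos (of_real pi * z) / sin (of_real pi * z)) :: complex"
  have 1: "((\<lambda>z. Digamma z - Digamma (1 - z)) has_field_derivative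
      Polygamma 1 z + Polygamma 1 (1 - z)) (at z)"
    using nz by (auto intro!: derivative_eq_intros)
  have "(?c has_field_derivative
      - (((- (of_real pi * (sin (of_real pi * z) * of_real pi))) * sin (of_real pi * z)
        - (of_real pi * cos (of_real pi * z)) * (cos (of_real pi * z) * of_real pi))
        / (sin (of_real pi * z) * sin (of_real pi * z)))) (at z)"
    using s by (auto intro!: derivative_eq_intros)
  \<comment> \<open>The digamma identity is differentiated on the open complement of the
    integers.\<close>
  then have 2: "((\<lambda>z. Digamma z - Digamma (1 - z)) has_field_derivative
      - (((- (of_real pi * (sin (of_real pi * z) * of_real pi))) * sin (of_real pi * z)
        - (of_real pi * cos (of_real pi * z)) * (cos (of_real pi * z) * of_real pi))
        / (sin (of_real pi * z) * sin (of_real pi * z)))) (at z)"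
    by (rule has_field_derivative_transform_within_open[of _ _ _ "- \<int>"])
      (use z closed_Ints in \<open>auto simp: Digamma_reflection\<close>)
  have 3: "- (((- (of_real pi * (sn * of_real pi))) * sn - (of_real pi * cs) * (cs * of_real pi)) / (sn * sn))
      = (of_real pi / sn)\<^sup>2" if "sn = sin (of_real pi * z)" "cs = cos (of_real pi * z)" for sn cs
  proof -
    have "- ((- (of_real pi * (sn * of_real pi))) * sn - (of_real pi * cs) * (cs * of_real pi))
        = (of_real pi)\<^sup>2 * (sn\<^sup>2 + cs\<^sup>2)" by (simp add: power2_eq_square algebra_simps)
    also have "sn\<^sup>2 + cs\<^sup>2 = 1" unfolding that by simp
    finally show ?thesis
      by (simp only: minus_divide_left power_divide power2_eq_square[of sn] mult_1_right)
  qed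
  from DERIV_unique[OF 1 2] show ?thesis
    unfolding 3[OF refl refl] .
qed

text \<open>At z = 1 / 2 + \<i> x / pi one has sin (pi z) = cosh x, so
  \<open>Trigamma_reflection\<close> and the series of inverse squares for the trigamma function
  give the expansion.\<close>

lemma sech_squared_partial_fractions:
  fixes x :: complex
  assumes x: "cosh x \<noteq> 0"
  defines "a \<equiv> \<lambda>k :: nat. complex_of_real (pi * (real k + 1 / 2))"
  shows "(\<lambda>k. 1 / (a k + \<i> * x)\<^sup>2 + 1 / (a k - \<i> * x)\<^sup>2) sums (1 / (cosh x)\<^sup>2)"
proof -
  define y where "y = \<i> * x / of_real pi"
  define z where "z = 1 / 2 + y"
  have y: "of_real pi * y = \<i> * x" by (simp add: y_def)
  have sz: "sin (of_real pi * z) = cosh x"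
  proof -
    have "of_real pi * z = of_real pi / 2 + \<i> * x"
      unfolding z_def distrib_left y by simp
    then have "sin (of_real pi * z) = cos (\<i> * x)"
      by (simp add: sin_add)
    then show ?thesis by (simp add: cosh_conv_cos)
  qed
  have z: "z \<notin> \<int>"
  proof
    assume "z \<in> \<int>"
    then have "sin (of_real pi * z) = 0"
      by (auto elim!: Ints_cases simp: sin_eq_0)
    with sz x show False by simp
  qed
  have z': "1 - z = 1 / 2 - y" by (simp add: z_def)
  have ne: "z \<noteq> 0" "1 - z \<noteq> 0" using z by auto
  have s: "(\<lambda>k. inverse ((w + of_nat k) ^ 2)) sums Polygamma 1 w" if "w \<noteq> 0" for w :: complex
    using Polygamma_converges'[OF that, of 2] summable_sums
    by (simp add: Polygamma_def power2_eq_square)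
  from sums_add[OF s[OF ne(1)] s[OF ne(2)]]
  have "(\<lambda>k. inverse ((z + of_nat k) ^ 2) + inverse ((1 - z + of_nat k) ^ 2)) sums (of_real pi / cosh x)\<^sup>2"
    unfolding Trigamma_reflection[OF z] sz .
  from sums_mult[OF this, of "1 / (of_real pi)\<^sup>2"]
  have "(\<lambda>k. 1 / (of_real pi)\<^sup>2 * (inverse ((z + of_nat k) ^ 2) + inverse ((1 - z + of_nat k) ^ 2)))
      sums (1 / (cosh x)\<^sup>2)"
    by (simp add: power_divide)
  moreover have "1 / (of_real pi)\<^sup>2 * (inverse ((z + of_nat k) ^ 2) + inverse ((1 - z + of_nat k) ^ 2))
      = 1 / (a k + \<i> * x)\<^sup>2 + 1 / (a k - \<i> * x)\<^sup>2" for k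
  proof -
    have "a k + \<i> * x = of_real pi * (z + of_nat k)" "a k - \<i> * x = of_real pi * (1 - z + of_nat k)"
      unfolding a_def z' unfolding z_def distrib_left right_diff_distrib y by (simp_all add: algebra_simps)
    then have e: "(a k + \<i> * x)\<^sup>2 = (of_real pi)\<^sup>2 * (z + of_nat k)\<^sup>2"
      "(a k - \<i> * x)\<^sup>2 = (of_real pi)\<^sup>2 * (1 - z + of_nat k)\<^sup>2"
      by (simp_all only: power_mult_distrib)
    show ?thesis
      unfolding e by (simp only: distrib_left divide_inverse inverse_mult_distrib mult_1_left)
  qed
  ultimately show ?thesis by simp
qed

text \<open>The positive zeros of the cosine; the poles of sech lie at plus and minus \<i> times
  these.\<close>

definition node :: "nat \<Rightarrow> real" where
  "node k = pi * (real k + 1 / 2)"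

lemma node_pos [simp]: "0 < node k"
  unfolding node_def by (intro mult_pos_pos) auto

lemma node_nonzero [simp]: "node k \<noteq> 0"
  using node_pos[of k] by linarith

lemma pair_of_poles:
  fixes a w :: complex
  assumes "a + w \<noteq> 0" "a - w \<noteq> 0"
  shows "1 / (a + w)\<^sup>2 + 1 / (a - w)\<^sup>2 = 2 * (a\<^sup>2 + w\<^sup>2) / (a\<^sup>2 - w\<^sup>2)\<^sup>2"
proof -
  have "a\<^sup>2 - w\<^sup>2 = (a + w) * (a - w)" by (simp add: power2_eq_square algebra_simps)
  then have "(a\<^sup>2 - w\<^sup>2)\<^sup>2 = (a + w)\<^sup>2 * (a - w)\<^sup>2" by (simp add: power_mult_distrib)
  moreover have "2 * (a\<^sup>2 + w\<^sup>2) = (a - w)\<^sup>2 + (a + w)\<^sup>2" by (simp add: power2_eq_square algebra_simps)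
  ultimately show ?thesis using assms by (simp add: add_divide_distrib)
qed

lemma sech_squared_expansion:
  fixes x :: complex
  assumes x: "cosh x \<noteq> 0"
  shows "(\<lambda>k. 2 * (of_real ((node k)\<^sup>2) - x\<^sup>2) / (of_real ((node k)\<^sup>2) + x\<^sup>2)\<^sup>2) sums (1 / (cosh x)\<^sup>2)"
proof -
  have "2 * (of_real ((node k)\<^sup>2) - x\<^sup>2) / (of_real ((node k)\<^sup>2) + x\<^sup>2)\<^sup>2
      = 1 / (of_real (node k) + \<i> * x)\<^sup>2 + 1 / (of_real (node k) - \<i> * x)\<^sup>2" for k
  proof -
    have cosn: "cos (of_real (node k) :: complex) = 0"
    proof -
      have "cos (node k) = 0"
        unfolding node_def by (simp add: distrib_left cos_add)
      then show ?thesis using cos_of_real[of "node k", where 'a=complex] by simp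
    qed
    have "of_real (node k) + \<i> * x \<noteq> 0"
    proof
      assume "of_real (node k) + \<i> * x = 0"
      then have "\<i> * x = - of_real (node k)" by (simp add: eq_neg_iff_add_eq_0 add.commute)
      then have "cosh x = cos (- of_real (node k))" by (simp add: cosh_conv_cos)
      with cosn x show False by simp
    qed
    moreover have "of_real (node k) - \<i> * x \<noteq> 0"
    proof
      assume "of_real (node k) - \<i> * x = 0"
      then have "\<i> * x = of_real (node k)" by simp
      then have "cosh x = cos (of_real (node k))" by (simp add: cosh_conv_cos)
      with cosn x show False by simp
    qed
    ultimately show ?thesis
      by (simp add: pair_of_poles power_mult_distrib)
  qed
  then show ?thesis
    using sech_squared_partial_fractions[OF x] by (simp add: node_def)
qed

lemma sech_squared_expansion_real:
  "(\<lambda>k. 2 * ((node k)\<^sup>2 - x\<^sup>2) / ((node k)\<^sup>2 + x\<^sup>2)\<^sup>2) sums (1 / (cosh x)\<^sup>2)"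
proof -
  have c: "cosh (complex_of_real x) = of_real (cosh x)"
    by (simp add: cosh_def exp_of_real[symmetric] scaleR_conv_of_real)
  have "cosh x \<noteq> 0" using cosh_real_pos[of x] by linarith
  with sech_squared_expansion[of "of_real x"]
  have "(\<lambda>k. complex_of_real (2 * ((node k)\<^sup>2 - x\<^sup>2) / ((node k)\<^sup>2 + x\<^sup>2)\<^sup>2)) sums of_real (1 / (cosh x)\<^sup>2)"
    by (simp add: c)
  then show ?thesis unfolding sums_of_real_iff .
qed

lemma sums_inverse_node_squares: "(\<lambda>k. 2 / (node k)\<^sup>2) sums 1"
proof -
  have "2 * ((node k)\<^sup>2 - 0\<^sup>2) / ((node k)\<^sup>2 + 0\<^sup>2)\<^sup>2 = 2 / (node k)\<^sup>2" for k
    using node_pos[of k] by (simp add: power2_eq_square)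
  with sech_squared_expansion_real[of 0] show ?thesis by simp
qed

lemma node_ge_1: "1 \<le> node k"
proof -
  have "1 \<le> pi * (1 / 2)" using pi_gt3 by simp
  also have "\<dots> \<le> node k" unfolding node_def by (intro mult_left_mono) auto
  finally show ?thesis .
qed

text \<open>Compares the second Taylor coefficients at 0 in the expansion of sech squared.\<close>

lemma sums_inverse_node_fourth: "(\<lambda>k. 6 / (node k) ^ 4) sums 1"
proof -
  define g where "g k n = 2 * (3 * (node k)\<^sup>2 + (inverse (real (Suc n)))\<^sup>2) /
      ((node k)\<^sup>2 * ((node k)\<^sup>2 + (inverse (real (Suc n)))\<^sup>2)\<^sup>2)" for k n
  have g_sums: "(\<lambda>k. g k n) sums ((1 - 1 / (cosh (inverse (real (Suc n))))\<^sup>2) / (inverse (real (Suc n)))\<^sup>2)" for n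
  proof -
    define x where "x = inverse (real (Suc n))"
    have x: "0 < x" by (simp add: x_def)
    have "(\<lambda>k. (2 / (node k)\<^sup>2 - 2 * ((node k)\<^sup>2 - x\<^sup>2) / ((node k)\<^sup>2 + x\<^sup>2)\<^sup>2) / x\<^sup>2)
        sums ((1 - 1 / (cosh x)\<^sup>2) / x\<^sup>2)"
      by (intro sums_divide sums_diff sums_inverse_node_squares sech_squared_expansion_real)
    moreover have "(2 / (node k)\<^sup>2 - 2 * ((node k)\<^sup>2 - x\<^sup>2) / ((node k)\<^sup>2 + x\<^sup>2)\<^sup>2) / x\<^sup>2 = g k n" for k
    proof -
      have gen: "(2 / A - 2 * (A - B) / (A + B)\<^sup>2) / B = 2 * (3 * A + B) / (A * (A + B)\<^sup>2)"
        if "0 < A" "0 < B" for A B :: real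
      proof -
        have "A + B \<noteq> 0" using that by linarith
        then have "2 / A - 2 * (A - B) / (A + B)\<^sup>2 = (2 * (A + B)\<^sup>2 - 2 * (A - B) * A) / (A * (A + B)\<^sup>2)"
          using that by (subst diff_frac_eq) auto
        also have "2 * (A + B)\<^sup>2 - 2 * (A - B) * A = B * (2 * (3 * A + B))"
          by (simp add: power2_eq_square algebra_simps)
        finally show ?thesis using that by simp
      qed
      show ?thesis
        unfolding g_def x_def[symmetric] using node_pos[of k] x by (intro gen) auto
    qed
    ultimately show ?thesis by (simp add: x_def)
  qed
  have g_lim: "(\<lambda>n. g k n) \<longlonglongrightarrow> 6 / (node k) ^ 4" for k
  proof -
    have "(\<lambda>n. g k n) \<longlonglongrightarrow> 2 * (3 * (node k)\<^sup>2 + 0\<^sup>2) / ((node k)\<^sup>2 * ((node k)\<^sup>2 + 0\<^sup>2)\<^sup>2)"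
      unfolding g_def by (intro tendsto_intros LIMSEQ_inverse_real_of_nat) simp
    also have "2 * (3 * (node k)\<^sup>2 + 0\<^sup>2) / ((node k)\<^sup>2 * ((node k)\<^sup>2 + 0\<^sup>2)\<^sup>2) = 6 / (node k) ^ 4"
      using node_pos[of k] by (simp add: field_simps eval_nat_numeral)
    finally show ?thesis .
  qed
  \<comment> \<open>A summable bound uniform in \<open>n\<close> for Tannery's theorem; the
    numerator is absorbed by the square because nodes are at least 1.\<close>
  have g_le: "norm (g k n) \<le> 6 / (node k)\<^sup>2" for k n
  proof -
    define A B where "A = (node k)\<^sup>2" and "B = (inverse (real (Suc n)))\<^sup>2"
    have A: "1 \<le> A" "0 \<le> B" using node_ge_1[of k] by (auto simp: A_def B_def)
    have 1: "3 * A + B \<le> 3 * (A + B)\<^sup>2"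
    proof -
      have "(A + B) * 1 \<le> (A + B) * (A + B)" using A by (intro mult_left_mono) auto
      then have "A + B \<le> (A + B)\<^sup>2" by (simp only: power2_eq_square mult_1_right)
      then show ?thesis using A by linarith
    qed
    have "g k n = 2 * (3 * A + B) / (A * (A + B)\<^sup>2)" by (simp add: g_def A_def B_def)
    also have "\<dots> \<le> 2 * (3 * (A + B)\<^sup>2) / (A * (A + B)\<^sup>2)"
      using 1 A by (intro divide_right_mono mult_left_mono) auto
    also have "\<dots> = 6 / A"
    proof -
      have "(A + B)\<^sup>2 \<noteq> 0" using A by simp
      then show ?thesis by simp
    qed
    finally have "g k n \<le> 6 / A" .
    moreover have "0 \<le> g k n" using A by (simp add: g_def)
    ultimately show ?thesis by (simp add: A_def)
  qed
  have "summable (\<lambda>k. 6 / (node k)\<^sup>2)"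
    using summable_mult[OF sums_summable[OF sums_inverse_node_squares], of 3] by simp
  then have T: "summable (\<lambda>k. norm (6 / (node k) ^ 4))"
     "(\<lambda>n. \<Sum>k. g k n) \<longlonglongrightarrow> (\<Sum>k. 6 / (node k) ^ 4)"
    using tannerys_theorem[of g "\<lambda>k. 6 / (node k) ^ 4" sequentially "\<lambda>k. 6 / (node k)\<^sup>2"] g_lim g_le
    by (auto simp: always_eventually)
  have "(\<lambda>n. \<Sum>k. g k n) = (\<lambda>n. (1 - 1 / (cosh (inverse (real (Suc n))))\<^sup>2) / (inverse (real (Suc n)))\<^sup>2)"
    using g_sums by (auto simp: sums_unique[symmetric])
  \<comment> \<open>1 - 1 / cosh^2 x behaves like x^2 at 0.\<close>
  also have "\<dots> \<longlonglongrightarrow> 1"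
    unfolding cosh_field_def by real_asymp
  finally have "(\<Sum>k. 6 / (node k) ^ 4) = 1"
    using T(2) LIMSEQ_unique by blast
  then show ?thesis
    using summable_sums[OF summable_norm_cancel[OF T(1)]] by simp
qed

section \<open>Numerical bounds for the series\<close>

text \<open>A Taylor polynomial of degree 6 at pi / 64, followed by six squarings, each rounded
  outwards to 12 decimals.\<close>

lemma exp_pi_bounds: "23.14069 \<le> exp pi" "exp pi \<le> (23.140695 :: real)"
proof -
  define l u :: real where "l = 490873852 / 10000000000" and "u = 490873853 / 10000000000"
  have lu: "l \<le> pi / 64" "pi / 64 \<le> u"
    using pi_approx by (simp_all add: l_def u_def)
  have tay: "\<bar>exp x - (\<Sum>i\<le>6. x ^ i / fact i)\<bar> \<le> 3 * x ^ 7 / fact 6" if "0 \<le> x" "x \<le> 1" for x :: real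
  proof -
    have "\<bar>exp x - (\<Sum>i\<le>6. x ^ i / fact i)\<bar> \<le> exp \<bar>x\<bar> * \<bar>x\<bar> ^ 7 / fact 6"
      using Taylor_exp_field[of x 6] by simp
    also have "\<dots> \<le> 3 * x ^ 7 / fact 6"
    proof (intro divide_right_mono mult_mono)
      have "exp \<bar>x\<bar> \<le> exp 1" using that by simp
      also have "\<dots> \<le> 3" by (rule exp_le)
      finally show "exp \<bar>x\<bar> \<le> 3" .
    qed (use that in auto)
    finally show ?thesis .
  qed
  have square: "exp (pi / y) = (exp (pi / (2 * y)))\<^sup>2" if "y \<noteq> 0" for y
    using that by (simp add: power2_eq_square mult_exp_exp field_simps)
  have lower: "c \<le> exp (pi / y)" if "d \<le> exp (pi / (2 * y))" "c \<le> d\<^sup>2" "0 \<le> d" "y \<noteq> 0" for c d y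
    unfolding square[OF that(4)] using power_mono[OF that(1,3), of 2] that(2) by linarith
  have upper: "exp (pi / y) \<le> c" if "exp (pi / (2 * y)) \<le> d" "d\<^sup>2 \<le> c" "y \<noteq> 0" for c d y
    unfolding square[OF that(3)] using power_mono[OF that(1), of 2] that(2) by simp
  have "1050312128462 / 1000000000000 \<le> (\<Sum>i\<le>6. l ^ i / fact i) - 3 * l ^ 7 / fact 6"
    unfolding l_def power_divide by (simp add: atMost_nat_numeral fact_numeral)
  also have "\<dots> \<le> exp l"
    using tay[of l] by (simp add: l_def abs_le_iff)
  also have "\<dots> \<le> exp (pi / 64)" using lu by simp
  finally have L: "1050312128462 / 1000000000000 \<le> exp (pi / 64)" .
  have "exp (pi / 64) \<le> exp u" using lu by simp
  also have "\<dots> \<le> (\<Sum>i\<le>6. u ^ i / fact i) + 3 * u ^ 7 / fact 6"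
    using tay[of u] by (simp add: u_def abs_le_iff)
  also have "\<dots> \<le> 1050312128574 / 1000000000000"
    unfolding u_def power_divide by (simp add: atMost_nat_numeral fact_numeral)
  finally have U: "exp (pi / 64) \<le> 1050312128574 / 1000000000000" .
  have L1: "1103155567194 / 1000000000000 \<le> exp (pi / 32)"
    by (rule lower[where d="1050312128462 / 1000000000000"]) (use L in \<open>simp_all add: power_divide\<close>)
  have U1: "exp (pi / 32) \<le> 1103155567430 / 1000000000000"
    by (rule upper[where d="1050312128574 / 1000000000000"]) (use U in \<open>simp_all add: power_divide\<close>)
  have L2: "1216952205431 / 1000000000000 \<le> exp (pi / 16)"
    by (rule lower[where d="1103155567194 / 1000000000000"]) (use L1 in \<open>simp_all add: power_divide\<close>)
  have U2: "exp (pi / 16) \<le> 1216952205952 / 1000000000000"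
    by (rule upper[where d="1103155567430 / 1000000000000"]) (use U1 in \<open>simp_all add: power_divide\<close>)
  have L3: "1480972670303 / 1000000000000 \<le> exp (pi / 8)"
    by (rule lower[where d="1216952205431 / 1000000000000"]) (use L2 in \<open>simp_all add: power_divide\<close>)
  have U3: "exp (pi / 8) \<le> 1480972671572 / 1000000000000"
    by (rule upper[where d="1216952205952 / 1000000000000"]) (use U2 in \<open>simp_all add: power_divide\<close>)
  have L4: "2193280050184 / 1000000000000 \<le> exp (pi / 4)"
    by (rule lower[where d="1480972670303 / 1000000000000"]) (use L3 in \<open>simp_all add: power_divide\<close>)
  have U4: "exp (pi / 4) \<le> 2193280053944 / 1000000000000"
    by (rule upper[where d="1480972671572 / 1000000000000"]) (use U3 in \<open>simp_all add: power_divide\<close>)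
  have L5: "4810477378535 / 1000000000000 \<le> exp (pi / 2)"
    by (rule lower[where d="2193280050184 / 1000000000000"]) (use L4 in \<open>simp_all add: power_divide\<close>)
  have U5: "exp (pi / 2) \<le> 4810477395029 / 1000000000000"
    by (rule upper[where d="2193280053944 / 1000000000000"]) (use U4 in \<open>simp_all add: power_divide\<close>)
  have L6: "23140692609396 / 1000000000000 \<le> exp (pi / 1)"
    by (rule lower[where d="4810477378535 / 1000000000000"]) (use L5 in \<open>simp_all add: power_divide\<close>)
  have U6: "exp (pi / 1) \<le> 23140692768085 / 1000000000000"
    by (rule upper[where d="4810477395029 / 1000000000000"]) (use U5 in \<open>simp_all add: power_divide\<close>)
  show "23.14069 \<le> exp pi" using L6 by simp
  show "exp pi \<le> (23.140695 :: real)" using U6 by simp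
qed

definition sech_term :: "real \<Rightarrow> real" where
  "sech_term a = (3 / a ^ 4 + 2 * tanh a / a ^ 3) / (cosh a)\<^sup>2"

text \<open>Everything is expressed by exp (2 a), because at a node this is an odd power of exp
  pi.\<close>

lemma sech_term_exp:
  assumes "0 < a"
  shows "sech_term a = 4 * exp (2 * a) / (exp (2 * a) + 1)\<^sup>2 *
     (3 / a ^ 4 + 2 * ((exp (2 * a) - 1) / (exp (2 * a) + 1)) / a ^ 3)"
proof -
  have e: "exp (2 * a) = exp a * exp a" by (simp add: mult_exp_exp)
  have m: "exp (- a) = 1 / exp a" by (simp add: exp_minus inverse_eq_divide)
  have p: "exp a * exp a + 1 \<noteq> 0" by (smt (verit) mult_pos_pos exp_gt_zero)
  have c: "cosh a = (exp a * exp a + 1) / (2 * exp a)"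
    unfolding cosh_field_def m by (simp add: field_simps)
  have s: "sinh a = (exp a * exp a - 1) / (2 * exp a)"
    unfolding sinh_field_def m by (simp add: field_simps)
  have t: "tanh a = (exp a * exp a - 1) / (exp a * exp a + 1)"
    unfolding tanh_def s c by simp
  have "1 / (cosh a)\<^sup>2 = 4 * (exp a * exp a) / (exp a * exp a + 1)\<^sup>2"
    unfolding c power_divide by (simp add: power2_eq_square)
  then have "sech_term a = (3 / a ^ 4 + 2 * tanh a / a ^ 3) * (4 * (exp a * exp a) / (exp a * exp a + 1)\<^sup>2)"
    unfolding sech_term_def by (metis mult.right_neutral times_divide_eq_right)
  then show ?thesis
    unfolding t e by (simp only: mult.commute)
qed

text \<open>Interval arithmetic: every occurrence of \<open>a\<close> and of exp (2 a) is replaced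
  separately by its unfavourable endpoint.\<close>

lemma sech_term_bounds:
  assumes a: "0 < al" "al \<le> a" "a \<le> au" and X: "1 \<le> Xl" "Xl \<le> exp (2 * a)" "exp (2 * a) \<le> Xu"
  shows "4 * Xl / (Xu + 1)\<^sup>2 * (3 / au ^ 4 + 2 * ((Xl - 1) / (Xu + 1)) / au ^ 3) \<le> sech_term a"
    and "sech_term a \<le> 4 * Xu / (Xl + 1)\<^sup>2 * (3 / al ^ 4 + 2 * ((Xu - 1) / (Xl + 1)) / al ^ 3)"
proof -
  define X where "X = exp (2 * a)"
  have X: "1 \<le> Xl" "Xl \<le> X" "X \<le> Xu" using X by (simp_all add: X_def)
  have eq: "sech_term a = 4 * X / (X + 1)\<^sup>2 * (3 / a ^ 4 + 2 * ((X - 1) / (X + 1)) / a ^ 3)"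
    unfolding X_def by (rule sech_term_exp) (use a in linarith)
  show "4 * Xl / (Xu + 1)\<^sup>2 * (3 / au ^ 4 + 2 * ((Xl - 1) / (Xu + 1)) / au ^ 3) \<le> sech_term a"
    unfolding eq
    by (intro mult_mono add_mono divide_left_mono frac_le power_mono mult_left_mono mult_pos_pos zero_less_power
        add_nonneg_nonneg divide_nonneg_nonneg mult_nonneg_nonneg) (use a X in auto)
  show "sech_term a \<le> 4 * Xu / (Xl + 1)\<^sup>2 * (3 / al ^ 4 + 2 * ((Xu - 1) / (Xl + 1)) / al ^ 3)"
    unfolding eq
    by (intro mult_mono add_mono divide_left_mono frac_le power_mono mult_left_mono mult_pos_pos zero_less_power
        add_nonneg_nonneg divide_nonneg_nonneg mult_nonneg_nonneg) (use a X in auto)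
qed

text \<open>For a \<ge> 4 the bracket is below 1 / 4, a value chosen to cancel the 4 in cosh^2 a
  \<ge> exp (2 a) / 4.\<close>

lemma sech_term_le_tail:
  assumes a: "4 \<le> a"
  shows "0 \<le> sech_term a" "sech_term a \<le> exp (- (2 * a))"
proof -
  have t: "0 \<le> tanh a" "tanh a \<le> 1"
    using a tanh_real_lt_1[of a] by (auto simp: less_imp_le)
  show "0 \<le> sech_term a"
    unfolding sech_term_def using a t by (intro divide_nonneg_nonneg add_nonneg_nonneg mult_nonneg_nonneg) auto
  have "3 / a ^ 4 + 2 * tanh a / a ^ 3 \<le> 3 / 4 ^ 4 + 2 * 1 / 4 ^ 3"
    using a t by (intro add_mono frac_le mult_left_mono power_mono) auto
  also have "\<dots> \<le> 1 / 4" by simp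
  finally have b: "3 / a ^ 4 + 2 * tanh a / a ^ 3 \<le> 1 / 4" .
  have "exp a / 2 \<le> cosh a" by (simp add: cosh_field_def)
  then have "(exp a / 2)\<^sup>2 \<le> (cosh a)\<^sup>2" by (rule power_mono) simp
  then have c: "exp (2 * a) / 4 \<le> (cosh a)\<^sup>2"
    by (simp add: power_divide power2_eq_square mult_exp_exp)
  have "sech_term a \<le> (1 / 4) / (exp (2 * a) / 4)"
    unfolding sech_term_def using b c by (intro frac_le) auto
  then show "sech_term a \<le> exp (- (2 * a))"
    by (simp add: exp_minus inverse_eq_divide)
qed

text \<open>Two terms are evaluated, and the rest is at most 2 / 23^5. The width 10^-6 is what six
  correctly rounded decimals of the final value require.\<close>

lemma sech_series_bounds:
  assumes "(\<lambda>k. sech_term (node k)) sums S"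
  shows "0.1534455 \<le> S" "S \<le> 0.1534465"
proof -
  let ?t = "\<lambda>k. sech_term (node k)"
  define E where "E = exp pi"
  have E: "23.14069 \<le> E" "E \<le> 23.140695" using exp_pi_bounds by (simp_all add: E_def)
  have n2: "exp (2 * node k) = E ^ (2 * k + 1)" for k
  proof -
    have "2 * node k = real (2 * k + 1) * pi" by (simp add: node_def algebra_simps)
    then show ?thesis unfolding E_def by (simp only: exp_of_nat_mult)
  qed
  have n0: "1.5707963 \<le> node 0" "node 0 \<le> 1.5707964" and n1: "4.712388 \<le> node 1" "node 1 \<le> 4.71239"
    using pi_approx by (simp_all add: node_def)
  have t0: "0.1534375 \<le> ?t 0" "?t 0 \<le> 0.1534379"
  proof -
    have b: "1 \<le> (23.14069 :: real)" "23.14069 \<le> exp (2 * node 0)" "exp (2 * node 0) \<le> 23.140695"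
      unfolding n2 using E by simp_all
    note B = sech_term_bounds[OF _ n0 b]
    show "0.1534375 \<le> ?t 0"
      by (rule order_trans[OF _ B(1)]) (simp_all add: power_divide)
    show "?t 0 \<le> 0.1534379"
      by (rule order_trans[OF B(2)]) (simp_all add: power_divide)
  qed
  have t1: "0.00000805 \<le> ?t 1" "?t 1 \<le> 0.0000082"
  proof -
    have "(12391 :: real) \<le> 23.14069 ^ 3" by (simp add: power_divide)
    also have "\<dots> \<le> E ^ 3" using E by (intro power_mono) auto
    finally have l: "12391 \<le> E ^ 3" .
    have "E ^ 3 \<le> 23.140695 ^ 3" using E by (intro power_mono) auto
    also have "\<dots> \<le> (12392 :: real)" by (simp add: power_divide)
    finally have u: "E ^ 3 \<le> 12392" .
    have "2 * 1 + 1 = (3 :: nat)" by simp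
    then have b: "1 \<le> (12391 :: real)" "12391 \<le> exp (2 * node 1)" "exp (2 * node 1) \<le> 12392"
      unfolding n2 using l u by simp_all
    note B = sech_term_bounds[OF _ n1 b]
    show "0.00000805 \<le> ?t 1"
      by (rule order_trans[OF _ B(1)]) (simp_all add: power_divide)
    show "?t 1 \<le> 0.0000082"
      by (rule order_trans[OF B(2)]) (simp_all add: power_divide)
  qed
  have big: "4 \<le> node (k + 2)" for k
  proof -
    have "4 \<le> pi * (5 / 2)" using pi_gt3 by simp
    also have "\<dots> \<le> node (k + 2)" unfolding node_def by (intro mult_left_mono) auto
    finally show ?thesis .
  qed
  have tail: "(\<lambda>k. ?t (k + 2)) sums (S - (?t 0 + ?t 1))"
    using sums_split_initial_segment[OF assms, of 2] by (simp add: numeral_2_eq_2)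
  have "0 \<le> S - (?t 0 + ?t 1)"
    by (rule sums_le[OF _ sums_zero tail]) (use sech_term_le_tail(1)[OF big] in auto)
  then show "0.1534455 \<le> S" using t0(1) t1(1) by simp
  \<comment> \<open>Deliberately crude: exp pi \<ge> 23 for five factors and its square \<ge> 2 for
    each further term suffice.\<close>
  have le: "?t (k + 2) \<le> (1 / 23 ^ 5) * (1 / 2) ^ k" for k
  proof -
    have "?t (k + 2) \<le> exp (- (2 * node (k + 2)))" by (rule sech_term_le_tail(2)[OF big])
    also have "\<dots> = 1 / (E ^ 5 * E ^ (2 * k))"
    proof -
      have "2 * (k + 2) + 1 = 5 + 2 * k" by simp
      then have "exp (2 * node (k + 2)) = E ^ 5 * E ^ (2 * k)"
        using n2[of "k + 2"] by (simp only: power_add)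
      then show ?thesis by (simp only: exp_minus inverse_eq_divide)
    qed
    also have "\<dots> \<le> 1 / (23 ^ 5 * 2 ^ k)"
    proof (intro divide_left_mono mult_mono)
      show "23 ^ 5 \<le> E ^ 5" using E by (intro power_mono) auto
      have "(2 :: real) ^ k \<le> (E\<^sup>2) ^ k"
      proof (rule power_mono)
        have "2 * 1 \<le> E * E" using E by (intro mult_mono) auto
        then show "2 \<le> E\<^sup>2" by (simp add: power2_eq_square)
      qed simp
      then show "2 ^ k \<le> E ^ (2 * k)" by (simp add: power_mult)
    qed (use E in auto)
    finally show ?thesis by (simp add: power_divide)
  qed
  have "(\<lambda>k. (1 / 23 ^ 5) * (1 / 2) ^ k) sums ((1 / 23 ^ 5) * (1 / (1 - 1 / 2 :: real)))"
    by (intro sums_mult geometric_sums) simp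
  from sums_le[OF le tail this] show "S \<le> 0.1534465"
    using t0(2) t1(2) by simp
qed

section \<open>Inverse transforms of the partial fractions\<close>

lemma integral_FTC_Ioi:
  fixes f F :: "real \<Rightarrow> 'a::euclidean_space"
  assumes F: "\<And>s. (F has_vector_derivative f s) (at s)" and f: "continuous_on UNIV f"
    and int: "set_integrable lborel {a<..} f" and lim: "(F \<longlongrightarrow> 0) at_top"
  shows "(LBINT s:{a<..}. f s) = - F a"
proof -
  have ei: "einterval (ereal a) \<infinity> = {a<..}" by (auto simp: einterval_def)
  have "isCont F a" using F has_vector_derivative_continuous by blast
  then have "(F \<longlongrightarrow> F a) (at_right a)"
    using continuous_at_imp_continuous_at_within unfolding continuous_within by blast
  then have A: "((F \<circ> real_of_ereal) \<longlongrightarrow> F a) (at_right (ereal a))"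
    by (subst ereal_tendsto_simps)
  have B: "((F \<circ> real_of_ereal) \<longlongrightarrow> 0) (at_left \<infinity>)"
    using lim by (subst ereal_tendsto_simps)
  have "(LBINT s=ereal a..\<infinity>. f s) = 0 - F a"
    by (rule interval_integral_FTC_integrable[OF _ F _ _ A B])
      (use f int in \<open>simp_all add: ei continuous_on_eq_continuous_at\<close>)
  then show ?thesis
    by (simp add: interval_lebesgue_integral_def ei)
qed

text \<open>The inverse Laplace transform of the pair of double poles of the exit transform at
  \<open>-l\<close>; it is not of constant sign.\<close>

definition pole_density :: "real \<Rightarrow> real \<Rightarrow> real" where
  "pole_density l s = 4 * (2 * l * s - 1) * exp (- l * s)"

text \<open>Half of the decay absorbs the polynomial. With u = l s and h = exp (u / 2), the
  estimates 1 \<le> h, u \<le> 2 h and u^2 \<le> 16 h give 4 (4 + 1) = 20 and 4 (32 + 2) =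
  136.\<close>

lemma pole_density_bounds:
  assumes l: "0 < l" and s: "0 \<le> s"
  shows "\<bar>pole_density l s\<bar> \<le> 20 * exp (- (s * (l / 2)))"
    and "\<bar>pole_density l s\<bar> * s \<le> 136 / l * exp (- (s * (l / 2)))"
proof -
  define u where "u = l * s"
  have u: "0 \<le> u" using l s by (simp add: u_def)
  define h where "h = exp (u / 2)"
  define q where "q = exp (u / 4)"
  have "1 + u / 4 \<le> q" unfolding q_def by (rule exp_ge_add_one_self)
  then have q: "1 \<le> q" "u \<le> 4 * q" using u by linarith+
  have "1 + u / 2 \<le> h" unfolding h_def by (rule exp_ge_add_one_self)
  then have h: "1 \<le> h" "u \<le> 2 * h" using u by linarith+
  have hq: "h = q * q" by (simp add: h_def q_def mult_exp_exp)
  have u2: "u * u \<le> 16 * h"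
    using mult_mono[OF q(2) q(2)] u q unfolding hq by simp
  have e: "exp (- l * s) * h = exp (- (s * (l / 2)))"
    by (simp add: h_def u_def mult_exp_exp)
  have p: "\<bar>pole_density l s\<bar> \<le> 4 * (2 * u + 1) * exp (- l * s)"
  proof -
    have "\<bar>2 * l * s - 1\<bar> \<le> 2 * u + 1" using u unfolding u_def by (auto simp: abs_le_iff)
    then show ?thesis
      unfolding pole_density_def abs_mult by (intro mult_mono) auto
  qed
  also have "\<dots> \<le> 4 * (5 * h) * exp (- l * s)"
    using h by (intro mult_right_mono mult_left_mono) auto
  also have "\<dots> = 20 * exp (- (s * (l / 2)))"
    unfolding e[symmetric] by simp
  finally show "\<bar>pole_density l s\<bar> \<le> 20 * exp (- (s * (l / 2)))" .
  have "\<bar>pole_density l s\<bar> * s \<le> (4 * (2 * u + 1) * exp (- l * s)) * s"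
    using s by (intro mult_right_mono p)
  also have "\<dots> = 4 / l * ((2 * (u * u) + u) * exp (- l * s))"
    using l by (simp add: u_def field_simps)
  also have "\<dots> \<le> 4 / l * ((34 * h) * exp (- l * s))"
    using l h(2) u2 by (intro mult_left_mono mult_right_mono) auto
  also have "\<dots> = 136 / l * exp (- (s * (l / 2)))"
    unfolding e[symmetric] by simp
  finally show "\<bar>pole_density l s\<bar> * s \<le> 136 / l * exp (- (s * (l / 2)))" .
qed

lemma continuous_pole_density: "continuous_on A (pole_density l)"
  unfolding pole_density_def by (intro continuous_intros)

lemma pole_density_measurable [measurable]: "pole_density l \<in> borel_measurable borel"
  by (rule borel_measurable_continuous_onI) (rule continuous_pole_density)

text \<open>Linear growth of \<open>g\<close> covers both uses: complex exponentials (A = 0) and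
  \<open>s - t\<close> (A = 1).\<close>

lemma set_integrable_pole_density_mult:
  fixes g :: "real \<Rightarrow> 'a :: {banach, real_normed_algebra, second_countable_topology}"
  assumes l: "0 < l" and [measurable]: "g \<in> borel_measurable borel"
    and g: "\<And>s. 0 \<le> s \<Longrightarrow> norm (g s) \<le> A * s + B" "0 \<le> A" "0 \<le> B" and a: "0 \<le> a"
  shows "set_integrable lborel {a<..} (\<lambda>s. pole_density l s *\<^sub>R g s)"
proof -
  have "set_integrable lborel {0<..} (\<lambda>s. (A * (136 / l) + B * 20) * exp (- (s * (l / 2))))"
    using integrable_I0i_exp_mscale[of "l / 2"] l by simp
  then have "set_integrable lborel {0<..} (\<lambda>s. pole_density l s *\<^sub>R g s)"
    unfolding set_integrable_def
  proof (rule Bochner_Integration.integrable_bound)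
    show "AE s in lborel. norm (indicator {0<..} s *\<^sub>R pole_density l s *\<^sub>R g s)
        \<le> norm (indicator {0<..} s *\<^sub>R ((A * (136 / l) + B * 20) * exp (- (s * (l / 2)))))"
    proof (intro AE_I2)
      fix s :: real
      have "norm (pole_density l s *\<^sub>R g s) \<le> (A * (136 / l) + B * 20) * exp (- (s * (l / 2)))" if s: "0 < s"
      proof -
        have "norm (pole_density l s *\<^sub>R g s) \<le> \<bar>pole_density l s\<bar> * (A * s + B)"
          using g(1)[of s] s by (simp add: mult_left_mono)
        also have "\<dots> = A * (\<bar>pole_density l s\<bar> * s) + B * \<bar>pole_density l s\<bar>"
          by (simp add: algebra_simps)
        also have "\<dots> \<le> A * (136 / l * exp (- (s * (l / 2)))) + B * (20 * exp (- (s * (l / 2))))"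
          using pole_density_bounds[OF l, of s] s g by (intro add_mono mult_left_mono) auto
        finally show ?thesis by (simp add: distrib_right mult.assoc)
      qed
      moreover have "0 \<le> (A * (136 / l) + B * 20) * exp (- (s * (l / 2)))"
        using l g by (intro mult_nonneg_nonneg add_nonneg_nonneg) auto
      ultimately show "norm (indicator {0<..} s *\<^sub>R pole_density l s *\<^sub>R g s)
        \<le> norm (indicator {0<..} s *\<^sub>R ((A * (136 / l) + B * 20) * exp (- (s * (l / 2)))))"
        by (simp add: indicator_def)
    qed
  qed measurable
  then show ?thesis
    by (rule set_integrable_subset) (use a in auto)
qed

lemma integral_pole_density_exp:
  assumes l: "0 < l"
  shows "(LBINT s:{0<..}. pole_density l s *\<^sub>R exp (\<i> * of_real (\<omega> * s)))
      = 4 * (of_real l + \<i> * of_real \<omega>) / (of_real l - \<i> * of_real \<omega>)\<^sup>2"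
proof -
  define \<zeta> where "\<zeta> = of_real l - \<i> * of_real \<omega>"
  have \<zeta>: "\<zeta> \<noteq> 0" using l by (auto simp: \<zeta>_def complex_eq_iff)
  \<comment> \<open>Antiderivative of (8 l s - 4) exp (- \<zeta> s), by parts; at 0 the two last
    terms combine through 2 l - \<zeta> = l + \<i> \<omega>.\<close>
  define F where "F s = - (4 * (2 * of_real l * of_real s / \<zeta> + 2 * of_real l / \<zeta>\<^sup>2 - 1 / \<zeta>)) * exp (- \<zeta> * of_real s)" for s
  have eq: "pole_density l s *\<^sub>R exp (\<i> * of_real (\<omega> * s))
      = 4 * (2 * of_real l * of_real s - 1) * exp (- \<zeta> * of_real s)" for s
  proof -
    have "complex_of_real (exp (- l * s)) * exp (\<i> * of_real (\<omega> * s)) = exp (- \<zeta> * of_real s)"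
      by (simp add: exp_of_real[symmetric] mult_exp_exp \<zeta>_def algebra_simps)
    then show ?thesis
      unfolding pole_density_def by (simp add: scaleR_conv_of_real mult.assoc)
  qed
  have "(LBINT s:{0<..}. pole_density l s *\<^sub>R exp (\<i> * of_real (\<omega> * s))) = - F 0"
  proof (rule integral_FTC_Ioi)
    show "(F has_vector_derivative pole_density l s *\<^sub>R exp (\<i> * of_real (\<omega> * s))) (at s)" for s
    proof -
      have d1: "((\<lambda>z. - (4 * (2 * of_real l * z / \<zeta> + 2 * of_real l / \<zeta>\<^sup>2 - 1 / \<zeta>)))
          has_field_derivative - (4 * (2 * of_real l / \<zeta>))) (at (of_real s))"
        using \<zeta> by (auto intro!: derivative_eq_intros)
      have d2: "((\<lambda>z. exp (- \<zeta> * z)) has_field_derivative exp (- \<zeta> * of_real s) * (- \<zeta>)) (at (of_real s))"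
        by (auto intro!: derivative_eq_intros)
      note DERIV_mult[OF d1 d2]
      moreover have "- (4 * (2 * of_real l / \<zeta>)) * e +
          e * (- \<zeta>) * (- (4 * (2 * of_real l * x / \<zeta> + 2 * of_real l / \<zeta>\<^sup>2 - 1 / \<zeta>)))
          = 4 * (2 * of_real l * x - 1) * e" for e x
      proof -
        have c: "2 * of_real l * x / \<zeta> * \<zeta> = 2 * of_real l * x"
          "2 * of_real l / \<zeta>\<^sup>2 * \<zeta> = 2 * of_real l / \<zeta>" "1 / \<zeta> * \<zeta> = 1"
          using \<zeta> by (simp_all add: power2_eq_square)
        moreover have "- (4 * L) * e + e * (- \<zeta>) * (- (4 * (a + b - d)))
            = e * (4 * (a * \<zeta> + b * \<zeta> - d * \<zeta>) - 4 * L)" for L a b d :: complex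
          by (simp add: algebra_simps)
        moreover have "e * (4 * (X + Y - 1) - 4 * Y) = 4 * (X - 1) * e" for X Y :: complex
          by (simp add: algebra_simps)
        ultimately show ?thesis by (simp only:)
      qed
      ultimately have "((\<lambda>z. - (4 * (2 * of_real l * z / \<zeta> + 2 * of_real l / \<zeta>\<^sup>2 - 1 / \<zeta>)) * exp (- \<zeta> * z))
          has_field_derivative 4 * (2 * of_real l * of_real s - 1) * exp (- \<zeta> * of_real s)) (at (of_real s))"
        by (simp only:)
      from has_vector_derivative_real_field[OF this] show ?thesis
        unfolding F_def eq .
    qed
    show "continuous_on UNIV (\<lambda>s. pole_density l s *\<^sub>R exp (\<i> * of_real (\<omega> * s)))"
      by (intro continuous_intros continuous_pole_density)
    show "set_integrable lborel {0<..} (\<lambda>s. pole_density l s *\<^sub>R exp (\<i> * of_real (\<omega> * s)))"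
      by (rule set_integrable_pole_density_mult[OF l, where A=0 and B=1]) auto
    show "(F \<longlongrightarrow> 0) at_top"
    proof (rule Lim_null_comparison)
      define A B where "A = norm (8 * of_real l / \<zeta>)" and "B = norm (4 * (2 * of_real l / \<zeta>\<^sup>2 - 1 / \<zeta>))"
      show "((\<lambda>s. (A * s + B) * exp (- l * s)) \<longlongrightarrow> 0) at_top"
        using l by real_asymp
      show "\<forall>\<^sub>F s in at_top. norm (F s) \<le> (A * s + B) * exp (- l * s)"
        using eventually_ge_at_top[of 0]
      proof eventually_elim
        case (elim s)
        have r: "Re \<zeta> = l" by (simp add: \<zeta>_def)
        have "F s = - (8 * of_real l / \<zeta> * of_real s + 4 * (2 * of_real l / \<zeta>\<^sup>2 - 1 / \<zeta>)) * exp (- \<zeta> * of_real s)"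
          by (simp add: F_def algebra_simps)
        then have "norm (F s) = norm (8 * of_real l / \<zeta> * of_real s + 4 * (2 * of_real l / \<zeta>\<^sup>2 - 1 / \<zeta>)) * exp (- l * s)"
          by (simp only: norm_mult norm_minus_cancel norm_exp_eq_Re) (simp add: r)
        also have "\<dots> \<le> (A * s + B) * exp (- l * s)"
          unfolding A_def B_def using elim
          by (intro mult_right_mono norm_triangle_le add_mono) (simp_all add: norm_mult norm_divide)
        finally show ?case .
      qed
    qed
  qed
  also have "- F 0 = 4 * (of_real l + \<i> * of_real \<omega>) / \<zeta>\<^sup>2"
  proof -
    have "1 / \<zeta> = \<zeta> / \<zeta>\<^sup>2"
      using \<zeta> by (simp add: power2_eq_square)
    then have "- F 0 = 4 * (2 * of_real l - \<zeta>) / \<zeta>\<^sup>2"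
      by (simp add: F_def diff_divide_distrib right_diff_distrib)
    also have "2 * of_real l - \<zeta> = of_real l + \<i> * of_real \<omega>" by (simp add: \<zeta>_def)
    finally show ?thesis .
  qed
  finally show ?thesis unfolding \<zeta>_def .
qed

lemma integral_pole_density_linear:
  assumes l: "0 < l" and a: "0 \<le> a"
  shows "(LBINT s:{a<..}. pole_density l s * (s - t))
    = 4 * exp (- l * a) * ((a - t) * (2 * a + 1 / l) + 2 * a / l + 3 / l\<^sup>2)"
proof -
  define F where "F s = - (4 * exp (- l * s) * ((s - t) * (2 * s + 1 / l) + 2 * s / l + 3 / l\<^sup>2))" for s
  have "(LBINT s:{a<..}. pole_density l s * (s - t)) = - F a"
  proof (rule integral_FTC_Ioi)
    show "(F has_vector_derivative pole_density l s * (s - t)) (at s)" for s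
    proof -
      define P P' where "P = (s - t) * (2 * s + 1 / l) + 2 * s / l + 3 / l\<^sup>2"
        and "P' = (2 * s + 1 / l) + 2 * (s - t) + 2 / l"
      have d1: "((\<lambda>s. 4 * exp (- l * s)) has_real_derivative 4 * (exp (- l * s) * (- l))) (at s)"
        by (auto intro!: derivative_eq_intros)
      have d2: "((\<lambda>s. (s - t) * (2 * s + 1 / l) + 2 * s / l + 3 / l\<^sup>2) has_real_derivative P') (at s)"
        using l by (auto intro!: derivative_eq_intros simp: P'_def)
      have "l * P = (s - t) * (2 * (l * s) + 1) + 2 * s + 3 / l"
        using l by (simp add: P_def distrib_left power2_eq_square mult.left_commute[of l])
      then have "l * P - P' = (s - t) * (2 * l * s - 1)"
        by (simp add: P'_def algebra_simps)
      moreover have "- (4 * (exp (- l * s) * (- l)) * P + P' * (4 * exp (- l * s)))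
          = 4 * exp (- l * s) * (l * P - P')"
        by (simp add: algebra_simps)
      ultimately have "- (4 * (exp (- l * s) * (- l)) * P + P' * (4 * exp (- l * s)))
          = 4 * exp (- l * s) * ((s - t) * (2 * l * s - 1))"
        by (simp only:)
      moreover have "(F has_real_derivative - (4 * (exp (- l * s) * (- l)) * P + P' * (4 * exp (- l * s)))) (at s)"
        unfolding F_def P_def using DERIV_minus[OF DERIV_mult[OF d1 d2]] .
      moreover have "pole_density l s * (s - t) = 4 * exp (- l * s) * ((s - t) * (2 * l * s - 1))"
        by (simp add: pole_density_def)
      ultimately show ?thesis
        by (simp only: has_real_derivative_iff_has_vector_derivative)
    qed
    show "continuous_on UNIV (\<lambda>s. pole_density l s * (s - t))"
      by (intro continuous_intros continuous_pole_density)
    have "set_integrable lborel {a<..} (\<lambda>s. pole_density l s *\<^sub>R (s - t))"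
      by (rule set_integrable_pole_density_mult[OF l _ _ _ _ a, where A=1 and B="\<bar>t\<bar>"]) auto
    then show "set_integrable lborel {a<..} (\<lambda>s. pole_density l s * (s - t))" by simp
    show "(F \<longlongrightarrow> 0) at_top"
      unfolding F_def using l by real_asymp
  qed
  then show ?thesis by (simp add: F_def)
qed

text \<open>On s > 0, |s - t| is twice the part of s - t beyond t minus s - t itself. The result
  involves \<open>t\<close> only through \<open>t\<close>, \<open>exp (- l * t)\<close> and
  \<open>t * exp (- l * t)\<close>, whose means at the exit time are known.\<close>

lemma integral_pole_density_abs:
  assumes l: "0 < l" and t: "0 \<le> t"
  shows "(LBINT s:{0<..}. pole_density l s * \<bar>s - t\<bar>)
    = 4 * t / l - 12 / l\<^sup>2 + 8 * (2 * (t * exp (- l * t)) / l + 3 * exp (- l * t) / l\<^sup>2)"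
proof -
  have i: "set_integrable lborel {b<..} (\<lambda>s. pole_density l s * (s - t))" if "0 \<le> b" for b
    using set_integrable_pole_density_mult[OF l _ _ _ _ that, of "\<lambda>s. s - t" 1 "\<bar>t\<bar>"] by simp
  have "(LBINT s:{0<..}. pole_density l s * \<bar>s - t\<bar>)
      = (\<integral>s. 2 * (indicator {t<..} s *\<^sub>R (pole_density l s * (s - t)))
          - indicator {0<..} s *\<^sub>R (pole_density l s * (s - t)) \<partial>lborel)"
    unfolding set_lebesgue_integral_def
    by (intro Bochner_Integration.integral_cong) (use t in \<open>auto simp: indicator_def algebra_simps\<close>)
  also have "\<dots> = 2 * (LBINT s:{t<..}. pole_density l s * (s - t)) - (LBINT s:{0<..}. pole_density l s * (s - t))"
    unfolding set_lebesgue_integral_def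
    using i[OF t] i[of 0] by (simp add: set_integrable_def)
  also have "\<dots> = 4 * t / l - 12 / l\<^sup>2 + 8 * (2 * (t * exp (- l * t)) / l + 3 * exp (- l * t) / l\<^sup>2)"
    unfolding integral_pole_density_linear[OF l t] integral_pole_density_linear[OF l order_refl]
    by (simp add: algebra_simps)
  finally show ?thesis .
qed

section \<open>The integral as a series\<close>

text \<open>The Fourier transform of \<open>pole_density l\<close> at \<open>t\<^sup>2\<close>.\<close>

definition pole_char :: "real \<Rightarrow> real \<Rightarrow> complex" where
  "pole_char l t = 4 * (of_real l + \<i> * of_real (t\<^sup>2)) / (of_real l - \<i> * of_real (t\<^sup>2))\<^sup>2"

context standard_brownian_motion
begin

definition exit_char :: "real \<Rightarrow> complex" where
  "exit_char t = expectation (\<lambda>\<omega>. exp (- \<i> * of_real (t\<^sup>2 * exit \<omega>)))"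

lemma exit_char_integrable:
  "integrable M (\<lambda>\<omega>. exp (- \<i> * of_real (t\<^sup>2 * exit \<omega>)))"
  "integrable M (\<lambda>\<omega>. exp (\<i> * of_real (t\<^sup>2 * exit \<omega>)))"
  by (auto intro!: integrable_const_bound[of _ 1] AE_I2)

lemma cnj_exit_char: "expectation (\<lambda>\<omega>. exp (\<i> * of_real (t\<^sup>2 * exit \<omega>))) = cnj (exit_char t)"
proof -
  have "exp (\<i> * of_real (t\<^sup>2 * exit \<omega>)) = cnj (exp (- \<i> * of_real (t\<^sup>2 * exit \<omega>)))" for \<omega>
    by (simp add: exp_cnj)
  then show ?thesis by (simp add: exit_char_def)
qed

text \<open>The denominator cannot vanish, since its product with the transform is 2. For the
  modulus, cosh (t + \<i> t) = cosh t cos t + \<i> sinh t sin t, and the squares of the two parts,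
  after adding 1 to the first, sum to (cos t + cosh t)^2.\<close>

lemma exit_char_eq: "exit_char t = 2 / (1 + cosh ((1 + \<i>) * of_real t))"
  and norm_cosh_diagonal: "norm (1 + cosh ((1 + \<i>) * complex_of_real t)) = cos t + cosh t"
proof -
  have e: "exit_char t * (1 + cosh ((1 + \<i>) * of_real t)) = 2"
    using exit_characteristic[of t] by (simp add: exit_char_def)
  then have "1 + cosh ((1 + \<i>) * complex_of_real t) \<noteq> 0" by auto
  with e show "exit_char t = 2 / (1 + cosh ((1 + \<i>) * of_real t))" by (simp add: field_simps)
  have "cosh ((1 + \<i>) * complex_of_real t) = cosh (of_real t + \<i> * of_real t)" by (simp add: distrib_right)
  also have "\<dots> = of_real (cosh t * cos t) + \<i> * of_real (sinh t * sin t)"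
  proof -
    have "cosh (complex_of_real t) = of_real (cosh t)" "sinh (complex_of_real t) = of_real (sinh t)"
      by (simp_all add: cosh_def sinh_def exp_of_real[symmetric] scaleR_conv_of_real)
    moreover have "cosh (\<i> * complex_of_real t) = of_real (cos t)"
      "sinh (\<i> * complex_of_real t) = \<i> * of_real (sin t)"
      by (simp_all add: cosh_conv_cos sinh_conv_sin cos_of_real sin_of_real)
    ultimately show ?thesis by (simp add: cosh_add)
  qed
  finally have c: "cosh ((1 + \<i>) * complex_of_real t) = of_real (cosh t * cos t) + \<i> * of_real (sinh t * sin t)" .
  have "(1 + cosh t * cos t)\<^sup>2 + (sinh t * sin t)\<^sup>2 = (cos t + cosh t)\<^sup>2"
  proof -
    have "(sinh t * sin t)\<^sup>2 = ((cosh t)\<^sup>2 - 1) * (1 - (cos t)\<^sup>2)"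
      by (simp add: power_mult_distrib sinh_square_eq sin_squared_eq)
    then show ?thesis by (simp add: power2_eq_square algebra_simps)
  qed
  moreover have "0 \<le> cos t + cosh t"
    using cosh_real_ge_1[of t] cos_ge_minus_one[of t] by linarith
  ultimately show "norm (1 + cosh ((1 + \<i>) * complex_of_real t)) = cos t + cosh t"
    unfolding c by (simp add: cmod_def)
qed

lemma exit_char_norm_square: "exit_char t * cnj (exit_char t) = of_real (4 / (cos t + cosh t)\<^sup>2)"
  unfolding complex_norm_square[symmetric] exit_char_eq norm_divide norm_cosh_diagonal
  by (simp add: power_divide)

text \<open>\<open>4 / l\<close> is the value of \<open>pole_char l\<close> at 0; summed over all
  poles these values give the 1 in \<open>deficit\<close>.\<close>

definition pole_deficit :: "real \<Rightarrow> real \<Rightarrow> real" where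
  "pole_deficit l t = (4 / l - Re (exit_char t * pole_char l t)) / t ^ 3"

text \<open>\<open>integral_characteristic_deficit\<close> on the product with the line, with weight
  \<open>pole_density l s\<close> and difference \<open>s - exit \<omega>\<close>: formally, the
  exit time is compared with an independent time of signed density.\<close>

lemma integral_pole_deficit:
  assumes l: "0 < l"
  shows "set_integrable lborel {0<..} (pole_deficit l)" (is ?A)
    and "(LBINT t:{0<..}. pole_deficit l t) = pi / 4 * (2 / l - 12 / l\<^sup>2
      + 8 * (2 * expectation (\<lambda>\<omega>. exit \<omega> * exp (- l * exit \<omega>)) / l
           + 3 * expectation (\<lambda>\<omega>. exp (- l * exit \<omega>)) / l\<^sup>2))" (is ?B)
    and "(LBINT t:{0<..}. \<bar>pole_deficit l t\<bar>) \<le> pi / 4 * (272 / l\<^sup>2 + 20 / l)" (is ?C)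
proof -
  interpret P: pair_sigma_finite M lborel ..
  define c where "c \<equiv> \<lambda>(\<omega> :: 'a, s). indicator {0<..} s * pole_density l s"
  define X where "X \<equiv> \<lambda>(\<omega>, s). s - exit \<omega>"
  define D where "D = (\<lambda>s. indicator {0<..} s * exp (- (s * (l / 2))))"
  have [measurable]: "D \<in> borel_measurable borel" unfolding D_def by measurable
  have c_meas[measurable]: "c \<in> borel_measurable (M \<Otimes>\<^sub>M lborel)" unfolding c_def by measurable
  have X_meas[measurable]: "X \<in> borel_measurable (M \<Otimes>\<^sub>M lborel)" unfolding X_def by measurable
  have intD: "integrable lborel D"
    using integrable_I0i_exp_mscale[of "l / 2"] l by (simp add: D_def set_integrable_def)
  have D: "integral\<^sup>L lborel D = 2 / l"
    using LBINT_I0i_exp_mscale[of "l / 2"] l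
    by (simp add: D_def interval_lebesgue_integral_0_infty set_lebesgue_integral_def)
  have D_nn: "0 \<le> D s" for s by (simp add: D_def)
  \<comment> \<open>Common dominating functions; with E exit = 1 / 2 and integral 2 / l of
    \<open>D\<close>, the choice A = 136 / l, B = 20 gives 272 / l^2 + 20 / l.\<close>
  have bound: "integrable (M \<Otimes>\<^sub>M lborel) (\<lambda>(\<omega>, s). (A + B * exit \<omega>) * D s)"
    "(\<integral>(\<omega>, s). (A + B * exit \<omega>) * D s \<partial>(M \<Otimes>\<^sub>M lborel)) = (A + B / 2) * (2 / l)"
    if "0 \<le> A" "0 \<le> B" for A B
  proof -
    show I: "integrable (M \<Otimes>\<^sub>M lborel) (\<lambda>(\<omega>, s). (A + B * exit \<omega>) * D s)"
    proof (rule P.Fubini_integrable)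
      have "(\<integral>s. norm ((A + B * exit \<omega>) * D s) \<partial>lborel) = (A + B * exit \<omega>) * (2 / l)" for \<omega>
        using that D_nn D by (simp add: abs_mult)
      then show "integrable M (\<lambda>\<omega>. \<integral>s. norm (case (\<omega>, s) of (\<omega>, s) \<Rightarrow> (A + B * exit \<omega>) * D s) \<partial>lborel)"
        using exit_integrable by simp
    qed (use intD in simp_all)
    have "(\<integral>(\<omega>, s). (A + B * exit \<omega>) * D s \<partial>(M \<Otimes>\<^sub>M lborel))
        = (\<integral>\<omega>. (\<integral>s. (A + B * exit \<omega>) * D s \<partial>lborel) \<partial>M)"
      using P.integral_fst'[OF I] by simp
    also have "\<dots> = (A + B / 2) * (2 / l)"
      using exit_integrable by (simp add: D expectation_exit prob_space)
    finally show "(\<integral>(\<omega>, s). (A + B * exit \<omega>) * D s \<partial>(M \<Otimes>\<^sub>M lborel)) = (A + B / 2) * (2 / l)" .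
  qed
  have c_le: "\<bar>c (\<omega>, s)\<bar> \<le> (20 + 0 * exit \<omega>) * D s" for \<omega> s
    using pole_density_bounds(1)[OF l, of s] by (simp add: c_def D_def indicator_def)
  have cX_le: "\<bar>c (\<omega>, s)\<bar> * \<bar>X (\<omega>, s)\<bar> \<le> (136 / l + 20 * exit \<omega>) * D s" for \<omega> s
  proof (cases "0 < s")
    case True
    have "\<bar>s - exit \<omega>\<bar> \<le> s + exit \<omega>"
      using True exit_nonneg[of \<omega>] by linarith
    then have "\<bar>pole_density l s\<bar> * \<bar>s - exit \<omega>\<bar> \<le> \<bar>pole_density l s\<bar> * (s + exit \<omega>)"
      by (intro mult_left_mono) auto
    also have "\<dots> = \<bar>pole_density l s\<bar> * s + \<bar>pole_density l s\<bar> * exit \<omega>"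
      by (rule distrib_left)
    also have "\<dots> \<le> 136 / l * exp (- (s * (l / 2))) + 20 * exp (- (s * (l / 2))) * exit \<omega>"
      using pole_density_bounds[OF l, of s] True by (intro add_mono mult_right_mono) auto
    also have "\<dots> = (136 / l + 20 * exit \<omega>) * exp (- (s * (l / 2)))"
      by (simp add: algebra_simps)
    finally show ?thesis using True by (simp add: c_def X_def D_def)
  qed (simp add: c_def D_def)
  have intcX: "integrable (M \<Otimes>\<^sub>M lborel) (\<lambda>p. c p * \<bar>X p\<bar>)"
  proof (rule Bochner_Integration.integrable_bound[OF bound(1)[of "136 / l" 20]])
    show "AE p in M \<Otimes>\<^sub>M lborel. norm (c p * \<bar>X p\<bar>) \<le> norm (case p of (\<omega>, s) \<Rightarrow> (136 / l + 20 * exit \<omega>) * D s)"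
      using cX_le by (intro AE_I2) (auto simp: abs_mult intro: order_trans[OF _ abs_ge_self])
  qed (use l in simp_all)
  have intc: "integrable (M \<Otimes>\<^sub>M lborel) (\<lambda>p. c p * (1 - cos (t\<^sup>2 * X p)))" for t
  proof (rule Bochner_Integration.integrable_bound[OF integrable_mult_right[OF bound(1)[of 20 0], of 2]])
    show "AE p in M \<Otimes>\<^sub>M lborel. norm (c p * (1 - cos (t\<^sup>2 * X p)))
        \<le> norm (2 * (case p of (\<omega>, s) \<Rightarrow> (20 + 0 * exit \<omega>) * D s))"
    proof (intro AE_I2)
      fix p :: "'a \<times> real"
      obtain \<omega> s where p: "p = (\<omega>, s)" by force
      have "\<bar>1 - cos (t\<^sup>2 * X p)\<bar> \<le> 2"
        using cos_ge_minus_one[of "t\<^sup>2 * X p"] cos_le_one[of "t\<^sup>2 * X p"] by linarith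
      then have "\<bar>c p\<bar> * \<bar>1 - cos (t\<^sup>2 * X p)\<bar> \<le> ((20 + 0 * exit \<omega>) * D s) * 2"
        unfolding p using c_le D_nn by (intro mult_mono) auto
      then show "norm (c p * (1 - cos (t\<^sup>2 * X p))) \<le> norm (2 * (case p of (\<omega>, s) \<Rightarrow> (20 + 0 * exit \<omega>) * D s))"
        using D_nn[of s] by (simp add: p abs_mult)
    qed
  qed simp_all
  \<comment> \<open>The integral over the line comes first: frequency 0 gives the total mass 4 / l,
    frequency t^2 gives \<open>pole_char\<close>.\<close>
  have inner: "(\<integral>s. c (\<omega>, s) * (1 - cos (t\<^sup>2 * X (\<omega>, s))) \<partial>lborel)
      = 4 / l - Re (exp (- \<i> * of_real (t\<^sup>2 * exit \<omega>)) * pole_char l t)" for \<omega> t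
  proof -
    let ?e = "\<lambda>r s. exp (\<i> * of_real (r * s))"
    have i: "set_integrable lborel {0<..} (\<lambda>s. pole_density l s *\<^sub>R ?e r s)" for r
      by (rule set_integrable_pole_density_mult[OF l, where A=0 and B=1]) auto
    have v: "(LBINT s:{0<..}. pole_density l s *\<^sub>R ?e (t\<^sup>2) s) = pole_char l t"
      "(LBINT s:{0<..}. pole_density l s *\<^sub>R ?e 0 s) = of_real (4 / l)"
      unfolding integral_pole_density_exp[OF l] pole_char_def using l by (simp_all add: power2_eq_square)
    have lin: "(\<integral>s. Re (f s - z * g s) \<partial>lborel) = Re (integral\<^sup>L lborel f - z * integral\<^sup>L lborel g)"
      if "integrable lborel f" "integrable lborel g" for f g :: "real \<Rightarrow> complex" and z
      using that by (subst integral_Re) simp_all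
    define w where "w = exp (- \<i> * of_real (t\<^sup>2 * exit \<omega>))"
    have "c (\<omega>, s) * (1 - cos (t\<^sup>2 * X (\<omega>, s)))
        = Re (indicator {0<..} s *\<^sub>R (pole_density l s *\<^sub>R ?e 0 s)
            - w * (indicator {0<..} s *\<^sub>R (pole_density l s *\<^sub>R ?e (t\<^sup>2) s)))" for s
    proof -
      have "w * ?e (t\<^sup>2) s = exp (\<i> * of_real (t\<^sup>2 * X (\<omega>, s)))"
        by (simp add: w_def mult_exp_exp X_def algebra_simps)
      then have "Re (w * ?e (t\<^sup>2) s) = cos (t\<^sup>2 * X (\<omega>, s))"
        by (simp add: Re_exp)
      moreover have "indicator {0<..} s *\<^sub>R (pole_density l s *\<^sub>R ?e 0 s)
            - w * (indicator {0<..} s *\<^sub>R (pole_density l s *\<^sub>R ?e (t\<^sup>2) s))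
          = c (\<omega>, s) *\<^sub>R (1 - w * ?e (t\<^sup>2) s)"
        by (simp add: c_def scaleR_conv_of_real algebra_simps)
      ultimately show ?thesis by simp
    qed
    then have "(\<integral>s. c (\<omega>, s) * (1 - cos (t\<^sup>2 * X (\<omega>, s))) \<partial>lborel)
      = (\<integral>s. Re (indicator {0<..} s *\<^sub>R (pole_density l s *\<^sub>R ?e 0 s)
            - w * (indicator {0<..} s *\<^sub>R (pole_density l s *\<^sub>R ?e (t\<^sup>2) s))) \<partial>lborel)"
      by simp
    also have "\<dots> = Re (of_real (4 / l) - w * pole_char l t)"
      unfolding v[symmetric] set_lebesgue_integral_def
      by (rule lin) (use i in \<open>simp_all only: set_integrable_def\<close>)
    finally show ?thesis by (simp add: w_def)
  qed
  have h: "(\<integral>p. c p * (1 - cos (t\<^sup>2 * X p)) \<partial>(M \<Otimes>\<^sub>M lborel)) / t ^ 3 = pole_deficit l t" for t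
  proof -
    have "(\<integral>p. c p * (1 - cos (t\<^sup>2 * X p)) \<partial>(M \<Otimes>\<^sub>M lborel))
        = (\<integral>\<omega>. 4 / l - Re (exp (- \<i> * of_real (t\<^sup>2 * exit \<omega>)) * pole_char l t) \<partial>M)"
      unfolding P.integral_fst'[OF intc, symmetric] inner ..
    also have "\<dots> = 4 / l - Re (exit_char t * pole_char l t)"
      using integral_Re[OF integrable_mult_left[OF exit_char_integrable(1)[of t], of "pole_char l t"]]
        integrable_Re[OF integrable_mult_left[OF exit_char_integrable(1)[of t], of "pole_char l t"]]
      by (simp add: prob_space exit_char_def)
    finally show ?thesis by (simp add: pole_deficit_def)
  qed
  note K = integral_characteristic_deficit[OF P.P.sigma_finite_measure_axioms c_meas X_meas intcX, unfolded h]
  show ?A using K(1) by (simp add: h[abs_def])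
  have "(LBINT t:{0<..}. pole_deficit l t) = pi / 4 * (\<integral>p. c p * \<bar>X p\<bar> \<partial>(M \<Otimes>\<^sub>M lborel))"
    using K(2) .
  also have "(\<integral>p. c p * \<bar>X p\<bar> \<partial>(M \<Otimes>\<^sub>M lborel)) = (\<integral>\<omega>. (LBINT s:{0<..}. pole_density l s * \<bar>s - exit \<omega>\<bar>) \<partial>M)"
    unfolding P.integral_fst'[OF intcX, symmetric]
    by (simp add: c_def X_def set_lebesgue_integral_def mult.assoc)
  also have "\<dots> = (\<integral>\<omega>. 4 * exit \<omega> / l - 12 / l\<^sup>2
      + 8 * (2 * (exit \<omega> * exp (- l * exit \<omega>)) / l + 3 * exp (- l * exit \<omega>) / l\<^sup>2) \<partial>M)"
    by (simp only: integral_pole_density_abs[OF l exit_nonneg])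
  also have "\<dots> = 2 / l - 12 / l\<^sup>2
      + 8 * (2 * expectation (\<lambda>\<omega>. exit \<omega> * exp (- l * exit \<omega>)) / l
           + 3 * expectation (\<lambda>\<omega>. exp (- l * exit \<omega>)) / l\<^sup>2)"
    using exit_integrable exit_laplace(1)[of l] exit_laplace_deriv(1)[OF l] l
    by (simp add: expectation_exit prob_space)
  finally show ?B .
  have "(LBINT t:{0<..}. \<bar>pole_deficit l t\<bar>) \<le> pi / 4 * (\<integral>p. \<bar>c p\<bar> * \<bar>X p\<bar> \<partial>(M \<Otimes>\<^sub>M lborel))"
    using K(3) .
  also have "(\<integral>p. \<bar>c p\<bar> * \<bar>X p\<bar> \<partial>(M \<Otimes>\<^sub>M lborel))
      \<le> (\<integral>(\<omega>, s). (136 / l + 20 * exit \<omega>) * D s \<partial>(M \<Otimes>\<^sub>M lborel))"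
  proof (rule integral_mono)
    show "integrable (M \<Otimes>\<^sub>M lborel) (\<lambda>p. \<bar>c p\<bar> * \<bar>X p\<bar>)"
      using integrable_abs[OF intcX] by (simp add: abs_mult)
    show "integrable (M \<Otimes>\<^sub>M lborel) (\<lambda>(\<omega>, s). (136 / l + 20 * exit \<omega>) * D s)"
      by (rule bound) (use l in auto)
  qed (use cX_le in auto)
  also have "\<dots> = 272 / l\<^sup>2 + 20 / l"
    using l by (subst bound(2)) (auto simp: field_simps power2_eq_square)
  finally show ?C by simp
qed

end

definition deficit :: "real \<Rightarrow> real" where
  "deficit t = (1 - 4 / (cos t + cosh t)\<^sup>2) * (1 / t ^ 3)"

section \<open>Termwise integration over the poles\<close>

context standard_brownian_motion
begin

text \<open>The half-angle formula turns the conjugated transform into 1 / cosh^2 x with x^2 = -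
  \<i> t^2 / 2; clearing this factor 1/2 gives the parameter l = 2 a^2 for a node a.\<close>

lemma sums_pole_char: "(\<lambda>k. pole_char (2 * (node k)\<^sup>2) t) sums cnj (exit_char t)"
proof -
  define x where "x = (1 - \<i>) * of_real t / 2"
  have x2: "x\<^sup>2 = - \<i> * of_real (t\<^sup>2) / 2"
    by (simp add: x_def power2_eq_square algebra_simps)
  have "2 * (cosh x)\<^sup>2 = 1 + cosh (2 * x)"
    by (simp add: cosh_double_cosh)
  also have "2 * x = cnj ((1 + \<i>) * of_real t)"
    by (simp add: x_def)
  also have "1 + cosh (cnj ((1 + \<i>) * of_real t)) = cnj (1 + cosh ((1 + \<i>) * of_real t))"
    by (simp add: cosh_def exp_cnj)
  finally have c: "2 * (cosh x)\<^sup>2 = cnj (1 + cosh ((1 + \<i>) * of_real t))" .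
  have e: "exit_char t * (1 + cosh ((1 + \<i>) * of_real t)) = 2"
    using exit_characteristic[of t] by (simp add: exit_char_def)
  then have nz: "1 + cosh ((1 + \<i>) * complex_of_real t) \<noteq> 0" by auto
  have "2 * (cosh x)\<^sup>2 \<noteq> 0"
    unfolding c complex_cnj_zero_iff by (rule nz)
  then have "cosh x \<noteq> 0" by auto
  from sech_squared_expansion[OF this]
  have "(\<lambda>k. 2 * (of_real ((node k)\<^sup>2) - x\<^sup>2) / (of_real ((node k)\<^sup>2) + x\<^sup>2)\<^sup>2) sums (1 / (cosh x)\<^sup>2)" .
  also have "1 / (cosh x)\<^sup>2 = 2 / (2 * (cosh x)\<^sup>2)" by simp
  also have "\<dots> = cnj (exit_char t)"
    unfolding c exit_char_eq by simp
  also have "(\<lambda>k. 2 * (of_real ((node k)\<^sup>2) - x\<^sup>2) / (of_real ((node k)\<^sup>2) + x\<^sup>2)\<^sup>2)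
      = (\<lambda>k. pole_char (2 * (node k)\<^sup>2) t)"
  proof
    fix k
    define N D where "N = of_real (2 * (node k)\<^sup>2) + \<i> * of_real (t\<^sup>2)"
      and "D = of_real (2 * (node k)\<^sup>2) - \<i> * of_real (t\<^sup>2)"
    have e: "of_real ((node k)\<^sup>2) - x\<^sup>2 = N / 2" "of_real ((node k)\<^sup>2) + x\<^sup>2 = D / 2"
      by (simp_all add: x2 N_def D_def field_simps)
    show "2 * (of_real ((node k)\<^sup>2) - x\<^sup>2) / (of_real ((node k)\<^sup>2) + x\<^sup>2)\<^sup>2 = pole_char (2 * (node k)\<^sup>2) t"
      unfolding e pole_char_def N_def[symmetric] D_def[symmetric] by (simp add: power_divide)
  qed
  finally show ?thesis .
qed

text \<open>The numerator is 4 times the conjugate of the base of the denominator, so one power of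
  the modulus cancels.\<close>

lemma norm_pole_char_le:
  assumes "0 < l"
  shows "norm (pole_char l t) \<le> 4 / l"
proof -
  define D where "D = of_real l - \<i> * of_real (t\<^sup>2)"
  have D: "l \<le> norm D"
    using complex_Re_le_cmod[of D] by (simp add: D_def)
  have "norm (of_real l + \<i> * of_real (t\<^sup>2)) = norm D"
    by (simp add: D_def cmod_def)
  then have "norm (pole_char l t) = 4 * norm D / (norm D)\<^sup>2"
    unfolding pole_char_def D_def[symmetric] norm_divide norm_mult norm_power by simp
  also have "\<dots> = 4 / norm D"
    using D assms by (simp add: power2_eq_square)
  also have "\<dots> \<le> 4 / l"
    using D assms by (intro divide_left_mono mult_pos_pos) auto
  finally show ?thesis .
qed

lemma sums_pole_deficit: "(\<lambda>k. pole_deficit (2 * (node k)\<^sup>2) t) sums deficit t"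
  and summable_pole_deficit: "summable (\<lambda>k. \<bar>pole_deficit (2 * (node k)\<^sup>2) t\<bar>)"
proof -
  have "(\<lambda>k. Re (exit_char t * pole_char (2 * (node k)\<^sup>2) t)) sums Re (exit_char t * cnj (exit_char t))"
    by (intro sums_Re sums_mult sums_pole_char)
  also have "Re (exit_char t * cnj (exit_char t)) = 4 / (cos t + cosh t)\<^sup>2"
    unfolding exit_char_norm_square by simp
  finally have 1: "(\<lambda>k. Re (exit_char t * pole_char (2 * (node k)\<^sup>2) t)) sums (4 / (cos t + cosh t)\<^sup>2)" .
  have 2: "(\<lambda>k. 4 / (2 * (node k)\<^sup>2)) sums 1"
    using sums_inverse_node_squares by simp
  show "(\<lambda>k. pole_deficit (2 * (node k)\<^sup>2) t) sums deficit t"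
    using sums_divide[OF sums_diff[OF 2 1], of "t ^ 3"] by (simp add: pole_deficit_def deficit_def)
  have phi: "norm (exit_char t) \<le> 1"
  proof -
    have "norm (exit_char t) \<le> expectation (\<lambda>\<omega>. norm (exp (- \<i> * of_real (t\<^sup>2 * exit \<omega>))))"
      unfolding exit_char_def by (rule integral_norm_bound)
    then show ?thesis by (simp add: prob_space)
  qed
  show "summable (\<lambda>k. \<bar>pole_deficit (2 * (node k)\<^sup>2) t\<bar>)"
  proof (rule summable_comparison_test')
    show "summable (\<lambda>k. 2 * (4 / (2 * (node k)\<^sup>2)) / \<bar>t ^ 3\<bar>)"
      using sums_summable[OF 2] by (intro summable_divide summable_mult)
    show "norm \<bar>pole_deficit (2 * (node k)\<^sup>2) t\<bar> \<le> 2 * (4 / (2 * (node k)\<^sup>2)) / \<bar>t ^ 3\<bar>" if "0 \<le> k" for k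
    proof -
      define l where "l = 2 * (node k)\<^sup>2"
      have l: "0 < l" by (simp add: l_def)
      have "\<bar>Re (exit_char t * pole_char l t)\<bar> \<le> norm (exit_char t) * norm (pole_char l t)"
        using abs_Re_le_cmod[of "exit_char t * pole_char l t"] by (simp add: norm_mult)
      also have "\<dots> \<le> 1 * (4 / l)"
        by (intro mult_mono phi norm_pole_char_le l) auto
      finally have "\<bar>4 / l - Re (exit_char t * pole_char l t)\<bar> \<le> 2 * (4 / l)"
        using l by (simp add: abs_le_iff)
      from divide_right_mono[OF this abs_ge_zero[of "t ^ 3"]] show ?thesis
        unfolding pole_deficit_def l_def[symmetric] by (simp only: abs_divide real_norm_def abs_abs)
    qed
  qed
qed

text \<open>The L1 bounds 272 / l^2 + 20 / l are summable over l = 2 a^2, which permits exchanging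
  sum and integral.\<close>

lemma integral_deficit_sech_terms:
  "set_integrable lborel {0<..} deficit"
  "(\<lambda>k. sech_term (node k)) sums (2 / pi * (LBINT t:{0<..}. deficit t))"
proof -
  define l where "l k = 2 * (node k)\<^sup>2" for k
  have l: "0 < l k" for k by (simp add: l_def)
  define f where "f k t = indicator {0<..} t *\<^sub>R pole_deficit (l k) t" for k and t :: real
  have int: "integrable lborel (f k)" for k
    using integral_pole_deficit(1)[OF l[of k]] by (simp add: f_def[abs_def] set_integrable_def)
  have f_sums: "(\<lambda>k. f k t) sums (indicator {0<..} t *\<^sub>R deficit t)" for t
    unfolding f_def l_def by (intro sums_scaleR_right sums_pole_deficit)
  have sq: "summable (\<lambda>k. 2 / (node k)\<^sup>2)" "summable (\<lambda>k. 6 / (node k) ^ 4)"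
    using sums_inverse_node_squares sums_inverse_node_fourth by (auto dest: sums_summable)
  have l2: "1 / l k = 1 / 4 * (2 / (node k)\<^sup>2)" "1 / (l k)\<^sup>2 = 1 / 24 * (6 / (node k) ^ 4)" for k
    by (simp_all add: l_def power_mult_distrib flip: power_mult)
  have sumf: "AE t in lborel. summable (\<lambda>k. norm (f k t))"
    using summable_pole_deficit by (intro AE_I2) (auto simp: f_def l_def indicator_def)
  have sumi: "summable (\<lambda>k. \<integral>t. norm (f k t) \<partial>lborel)"
  proof (rule summable_comparison_test')
    show "summable (\<lambda>k. pi / 4 * (272 * (1 / 24 * (6 / (node k) ^ 4)) + 20 * (1 / 4 * (2 / (node k)\<^sup>2))))"
      using sq by (intro summable_mult summable_add)
    fix k :: nat
    have "(\<integral>t. norm (f k t) \<partial>lborel) = (LBINT t:{0<..}. \<bar>pole_deficit (l k) t\<bar>)"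
      by (simp add: f_def set_lebesgue_integral_def abs_mult)
    also have "\<dots> \<le> pi / 4 * (272 * (1 / (l k)\<^sup>2) + 20 * (1 / l k))"
      using integral_pole_deficit(3)[OF l[of k]] by simp
    also have "\<dots> = pi / 4 * (272 * (1 / 24 * (6 / (node k) ^ 4)) + 20 * (1 / 4 * (2 / (node k)\<^sup>2)))"
      unfolding l2 ..
    finally have "(\<integral>t. norm (f k t) \<partial>lborel)
        \<le> pi / 4 * (272 * (1 / 24 * (6 / (node k) ^ 4)) + 20 * (1 / 4 * (2 / (node k)\<^sup>2)))" .
    moreover have "0 \<le> (\<integral>t. norm (f k t) \<partial>lborel)"
      by (rule integral_nonneg_AE) simp
    ultimately show "norm (\<integral>t. norm (f k t) \<partial>lborel)
        \<le> pi / 4 * (272 * (1 / 24 * (6 / (node k) ^ 4)) + 20 * (1 / 4 * (2 / (node k)\<^sup>2)))"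
      by (simp only: real_norm_def abs_of_nonneg)
  qed
  have fsum: "(\<Sum>k. f k t) = indicator {0<..} t *\<^sub>R deficit t" for t
    using sums_unique[OF f_sums] by simp
  show "set_integrable lborel {0<..} deficit"
    using integrable_suminf[OF int sumf sumi] by (simp only: fsum set_integrable_def)
  have S: "(\<lambda>k. integral\<^sup>L lborel (f k)) sums (LBINT t:{0<..}. deficit t)"
    using sums_integral[OF int sumf sumi] by (simp only: fsum set_lebesgue_integral_def)
  have summand: "integral\<^sup>L lborel (f k) = pi / 4 * (1 / 2 * (2 / (node k)\<^sup>2)) - pi / 4 * (1 / 2 * (6 / (node k) ^ 4))
      + pi / 2 * sech_term (node k)" for k
  proof -
    define n where "n = node k"
    have n: "0 < n" by (simp add: n_def)
    \<comment> \<open>At the pole parameter, sqrt (2 l) = 2 n, so the half-angle formula makes the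
      Laplace transform 1 / cosh^2 n.\<close>
    have sq: "sqrt (2 * l k) = 2 * n"
    proof -
      have "2 * l k = (2 * n)\<^sup>2" by (simp add: l_def n_def power_mult_distrib)
      then show ?thesis using n by (simp only: real_sqrt_abs)
    qed
    have c: "cosh n \<noteq> 0" using cosh_real_pos[of n] by linarith
    have ch: "1 + cosh (2 * n) = 2 * (cosh n)\<^sup>2" by (simp add: cosh_double_cosh)
    have E0: "expectation (\<lambda>\<omega>. exp (- l k * exit \<omega>)) = 1 / (cosh n)\<^sup>2"
      using exit_laplace(2)[of "l k"] l[of k] by (simp add: sq ch)
    have E1: "expectation (\<lambda>\<omega>. exit \<omega> * exp (- l k * exit \<omega>)) = tanh n / (2 * n * (cosh n)\<^sup>2)"
    proof -
      have "expectation (\<lambda>\<omega>. exit \<omega> * exp (- l k * exit \<omega>)) = 2 * (2 * sinh n * cosh n) / (2 * n * (2 * (cosh n)\<^sup>2)\<^sup>2)"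
        using exit_laplace_deriv(2)[OF l[of k]] unfolding sq ch sinh_double .
      also have "\<dots> = tanh n / (2 * n * (cosh n)\<^sup>2)"
        unfolding tanh_def using c n by (simp add: power2_eq_square)
      finally show ?thesis .
    qed
    have "integral\<^sup>L lborel (f k) = (LBINT t:{0<..}. pole_deficit (l k) t)"
      by (simp add: f_def[abs_def] set_lebesgue_integral_def)
    also have "\<dots> = pi / 4 * (2 * (1 / l k) - 12 * (1 / (l k)\<^sup>2)
        + 8 * (2 * (tanh n / (2 * n * (cosh n)\<^sup>2)) * (1 / l k) + 3 * (1 / (cosh n)\<^sup>2) * (1 / (l k)\<^sup>2)))"
      unfolding integral_pole_deficit(2)[OF l[of k]] E0 E1 by simp
    also have "8 * (2 * (tanh n / (2 * n * (cosh n)\<^sup>2)) * (1 / l k) + 3 * (1 / (cosh n)\<^sup>2) * (1 / (l k)\<^sup>2))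
        = 2 * sech_term n"
    proof -
      have "8 * (2 * (T / (2 * n * C)) * (1 / 4 * (2 / n\<^sup>2)) + 3 * (1 / C) * (1 / 24 * (6 / n ^ 4)))
          = 2 * ((3 / n ^ 4 + 2 * T / n ^ 3) / C)" for T C
        by (simp add: add_divide_distrib power2_eq_square power3_eq_cube mult_ac)
      then show ?thesis
        unfolding l2 n_def[symmetric] sech_term_def by blast
    qed
    finally show ?thesis
      unfolding l2 n_def by (simp add: algebra_simps)
  qed
  \<comment> \<open>The rational parts 2 / l and 12 / l^2 each sum to 1 / 2 and cancel; only the
    sech terms remain.\<close>
  have "(\<lambda>k. (integral\<^sup>L lborel (f k) - pi / 4 * (1 / 2 * (2 / (node k)\<^sup>2))) + pi / 4 * (1 / 2 * (6 / (node k) ^ 4)))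
      sums (((LBINT t:{0<..}. deficit t) - pi / 4 * (1 / 2 * 1)) + pi / 4 * (1 / 2 * 1))"
    by (intro sums_add sums_diff S sums_mult sums_inverse_node_squares sums_inverse_node_fourth)
  then have "(\<lambda>k. pi / 2 * sech_term (node k)) sums (LBINT t:{0<..}. deficit t)"
    by (simp add: summand)
  from sums_mult[OF this, of "2 / pi"]
  show "(\<lambda>k. sech_term (node k)) sums (2 / pi * (LBINT t:{0<..}. deficit t))"
    by simp
qed

end

text \<open>Finiteness and integrability are asserted explicitly because \<open>enn2real\<close> and
  the Bochner integral would otherwise return the default 0. The approximation is read as an error
  of at most half a unit in the sixth decimal.\<close>

theorem lemma1p7:
  fixes M :: "'a measure" and W1 W2 :: "real \<Rightarrow> 'a \<Rightarrow> real"
  assumes "standard_brownian_motion M W1"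
    and "standard_brownian_motion M W2"
    and "independent_processes M W1 W2"
  shows "let r = (\<integral>\<^sup>+ \<omega>. min (exceedance_time (range_process W1) \<omega>)
                               (exceedance_time (range_process W2) \<omega>) \<partial>M);
             f = (\<lambda>t :: real. (1 - 4 / (cos t + cosh t)\<^sup>2) * (1 / t ^ 3))
         in set_integrable lborel {0<..} f \<and>
            r < \<infinity> \<and>
            enn2real r = 1 / 2 - 2 / pi * (LBINT t:{0<..}. f t) \<and>
            \<bar>enn2real r - 0.346554\<bar> \<le> 5 / 10 ^ 7"
proof -
  interpret A: standard_brownian_motion M W1 by fact
  interpret B: standard_brownian_motion M W2 by fact
  define X where "X \<omega> = A.exit \<omega> - B.exit \<omega>" for \<omega>
  have [measurable]: "X \<in> borel_measurable M" unfolding X_def by measurable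
  have "A.indep_var (\<Pi>\<^sub>M t\<in>{0..}. borel) (\<lambda>\<omega>. \<lambda>t\<in>{0..}. W1 t \<omega>) (\<Pi>\<^sub>M t\<in>{0..}. borel) (\<lambda>\<omega>. \<lambda>t\<in>{0..}. W2 t \<omega>)"
    using assms(3) by (simp add: independent_processes_def)
  then have "A.indep_var borel ((\<lambda>w. enn2real (rational_exit w)) \<circ> (\<lambda>\<omega>. \<lambda>t\<in>{0..}. W1 t \<omega>))
      borel ((\<lambda>w. enn2real (rational_exit w)) \<circ> (\<lambda>\<omega>. \<lambda>t\<in>{0..}. W2 t \<omega>))"
    using borel_measurable_rational_exit by (intro A.indep_var_compose) auto
  then have indep: "A.indep_var borel A.exit borel B.exit"
    by (simp add: comp_def rational_exit_restrict A.exit_def[abs_def] B.exit_def[abs_def])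
  have char_eq: "B.exit_char t = A.exit_char t" for t
    by (simp add: A.exit_char_eq B.exit_char_eq)
  \<comment> \<open>By independence and equality of the two transforms, the characteristic function
    of the difference is the squared modulus of the common one, hence real.\<close>
  have cosX: "A.expectation (\<lambda>\<omega>. 1 - cos (t\<^sup>2 * X \<omega>)) = 1 - 4 / (cos t + cosh t)\<^sup>2" for t
  proof -
    have i: "A.indep_var borel (\<lambda>\<omega>. exp (- \<i> * of_real (t\<^sup>2 * A.exit \<omega>)))
        borel (\<lambda>\<omega>. exp (\<i> * of_real (t\<^sup>2 * B.exit \<omega>)))"
      using A.indep_var_compose[OF indep, of "\<lambda>x. exp (- \<i> * of_real (t\<^sup>2 * x))" borel
          "\<lambda>x. exp (\<i> * of_real (t\<^sup>2 * x))" borel]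
      by (simp add: comp_def)
    have "A.expectation (\<lambda>\<omega>. exp (- \<i> * of_real (t\<^sup>2 * A.exit \<omega>)) * exp (\<i> * of_real (t\<^sup>2 * B.exit \<omega>)))
        = A.exit_char t * cnj (A.exit_char t)"
      using A.indep_var_lebesgue_integral[OF i A.exit_char_integrable(1) B.exit_char_integrable(2)]
      by (simp only: A.exit_char_def[symmetric] B.cnj_exit_char char_eq)
    then have E: "A.expectation (\<lambda>\<omega>. exp (- \<i> * of_real (t\<^sup>2 * A.exit \<omega>)) * exp (\<i> * of_real (t\<^sup>2 * B.exit \<omega>)))
        = of_real (4 / (cos t + cosh t)\<^sup>2)"
      unfolding A.exit_char_norm_square .
    have re: "cos (t\<^sup>2 * X \<omega>) = Re (exp (- \<i> * of_real (t\<^sup>2 * A.exit \<omega>)) * exp (\<i> * of_real (t\<^sup>2 * B.exit \<omega>)))" for \<omega>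
    proof -
      have "exp (- \<i> * of_real (t\<^sup>2 * A.exit \<omega>)) * exp (\<i> * of_real (t\<^sup>2 * B.exit \<omega>)) = exp (- \<i> * of_real (t\<^sup>2 * X \<omega>))"
        by (simp add: mult_exp_exp X_def algebra_simps)
      then show ?thesis by (simp add: Re_exp)
    qed
    have "A.expectation (\<lambda>\<omega>. cos (t\<^sup>2 * X \<omega>)) = 4 / (cos t + cosh t)\<^sup>2"
      unfolding re
      using integral_Re[OF A.indep_var_integrable[OF i A.exit_char_integrable(1) B.exit_char_integrable(2)]]
      unfolding E by simp
    moreover have "integrable M (\<lambda>\<omega>. cos (t\<^sup>2 * X \<omega>))"
      by (rule A.integrable_const_bound[of _ 1]) auto
    ultimately show ?thesis by (simp add: A.prob_space)
  qed
  have X_int: "integrable M (\<lambda>\<omega>. 1 * \<bar>X \<omega>\<bar>)"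
    unfolding X_def using A.exit_integrable B.exit_integrable by simp
  have "(LBINT t:{0<..}. deficit t) = pi / 4 * A.expectation (\<lambda>\<omega>. 1 * \<bar>X \<omega>\<bar>)"
    using integral_characteristic_deficit(2)[OF A.sigma_finite_measure_axioms _ _ X_int]
    by (simp add: cosX deficit_def)
  then have absX: "A.expectation (\<lambda>\<omega>. \<bar>X \<omega>\<bar>) = 2 * (2 / pi * (LBINT t:{0<..}. deficit t))"
    by (simp add: field_simps)
  have min_eq: "min (A.exit \<omega>) (B.exit \<omega>) = (A.exit \<omega> + B.exit \<omega> - \<bar>X \<omega>\<bar>) / 2" for \<omega>
    by (simp add: X_def min_def abs_if)
  have min_int: "integrable M (\<lambda>\<omega>. min (A.exit \<omega>) (B.exit \<omega>))"
    using A.exit_integrable B.exit_integrable by simp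
  have Emin: "A.expectation (\<lambda>\<omega>. min (A.exit \<omega>) (B.exit \<omega>)) = 1 / 2 - 2 / pi * (LBINT t:{0<..}. deficit t)"
    unfolding min_eq using A.exit_integrable B.exit_integrable X_int
    by (simp add: A.expectation_exit B.expectation_exit absX)
  have "(\<integral>\<^sup>+ \<omega>. min (exceedance_time (range_process W1) \<omega>) (exceedance_time (range_process W2) \<omega>) \<partial>M)
      = (\<integral>\<^sup>+ \<omega>. ennreal (min (A.exit \<omega>) (B.exit \<omega>)) \<partial>M)"
    by (rule nn_integral_cong_AE, use A.AE_exceedance_time_eq B.AE_exceedance_time_eq in eventually_elim)
      (simp add: min_def ennreal_le_iff)
  also have "\<dots> = ennreal (A.expectation (\<lambda>\<omega>. min (A.exit \<omega>) (B.exit \<omega>)))"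
    by (rule nn_integral_eq_integral[OF min_int]) simp
  finally have r: "(\<integral>\<^sup>+ \<omega>. min (exceedance_time (range_process W1) \<omega>) (exceedance_time (range_process W2) \<omega>) \<partial>M)
      = ennreal (1 / 2 - 2 / pi * (LBINT t:{0<..}. deficit t))"
    unfolding Emin .
  have S: "0.1534455 \<le> 2 / pi * (LBINT t:{0<..}. deficit t)" "2 / pi * (LBINT t:{0<..}. deficit t) \<le> 0.1534465"
    by (rule sech_series_bounds[OF A.integral_deficit_sech_terms(2)])+
  \<comment> \<open>1 / 2 - 0.1534455 and 1 / 2 - 0.1534465 are exactly 0.346554 plus and minus 5 /
    10^7.\<close>
  have num: "0 \<le> 1 / 2 - y" "\<bar>(1 / 2 - y) - 0.346554\<bar> \<le> 5 / 10 ^ 7"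
    if "0.1534455 \<le> y" "y \<le> 0.1534465" for y :: real
    using that unfolding abs_le_iff by simp_all
  have f: "(\<lambda>t. (1 - 4 / (cos t + cosh t)\<^sup>2) * (1 / t ^ 3)) = deficit"
    by (simp add: deficit_def fun_eq_iff)
  show ?thesis
    unfolding Let_def r f enn2real_ennreal[OF num(1)[OF S]]
    using A.integral_deficit_sech_terms(1) num(2)[OF S] by simp
qed

end
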